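(* Let $(\mathcal T_i)_{i\in\mathbb N_0}$ be a generalised preferential attachment tree with random attachment weights as in the context, and let $(F(k))_{k\in\mathbb N_0}$ have the common law of the sequences $(F_j(k))_{k\in\mathbb N_0}$. Then: \begin{enumerate} \item If $\sum_{j=0}^\infty F(j)^{-2}=\infty$ almost surely, then almost surely $(\mathcal T_i)_{i\in\mathbb N_0}$ does not have a persistent hub. \item Suppose that (a) there is a sequence $(x_j)_{j\in\mathbb N_0}$ with $\sum_{j=0}^\infty x_j^{-2}<\infty$ such that $F(j)\ge x_j$ almost surely for every $j$, and (b) there exists $\lambda>0$ such that \[\sum_{i=0}^\infty\prod_{j=0}^i\mathbb E\Big[\frac{F(j)}{F(j)+\lambda}\Big]<\infty.\] Then almost surely $(\mathcal T_i)_{i\in\mathbb N_0}$ has a unique persistent hub. \end{enumerate}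
   Context: Generalised preferential attachment tree: for each $j\in\mathbb N_0$ let $(F_j(k))_{k\in\mathbb N_0}$ be a sequence of mutually independent positive random variables, these sequences being independent and identically distributed over $j$. $\mathcal T_0$ consists of a single node labelled $0$. Given $\mathcal T_k$ (with nodes $0,\dots,k$), form $\mathcal T_{k+1}$ by choosing a node $j$ of $\mathcal T_k$ with probability $F_j(\deg^+(j,\mathcal T_k))/\mathcal Z_k$, where $\mathcal Z_k=\sum_{j=0}^kF_j(\deg^+(j,\mathcal T_k))$, and adding a new node $k+1$ with an edge directed from $j$ to $k+1$. Here $\deg^+(u,T)$ denotes the out-degree of $u$ in the directed tree $T$ (and $-\infty$ if $u\notin T$). For a sequence of directed trees $(\mathcal T_n)_{n\in\mathbb N_0}$, $u$ is a persistent hub if $\deg^+(u,\mathcal T_n)=\max_{v\in\mathcal T_n}\deg^+(v,\mathcal T_n)$ for all but finitely many $n$; it is a unique persistent hub if, moreover, every persistent hub equals $u$.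
   Formalization: In (a) the numbers x_j are required to be positive; with negative x_j allowed the claim fails, e.g. F ≡ 1 and x_j = −(j+1) satisfy (a) and (b), but by part 1 there is no persistent hub. *)

theory Defs
  imports "HOL-Probability.Probability"
begin

text \<open>A sequence of directed trees \<open>(T_n)\<close> where \<open>T_n\<close> has nodes \<open>0..n\<close> and node \<open>i \<ge> 1\<close>
  is attached by an edge from its parent \<open>p i\<close> is encoded by the parent function \<open>p\<close>.\<close>

definition outdeg :: "(nat \<Rightarrow> nat) \<Rightarrow> nat \<Rightarrow> nat \<Rightarrow> nat" where
  "outdeg p n u = card {i \<in> {1..n}. p i = u}"

definition persistent_hub :: "(nat \<Rightarrow> nat) \<Rightarrow> nat \<Rightarrow> bool" where
  "persistent_hub p u \<longleftrightarrow>
     (\<forall>\<^sub>F n in sequentially. u \<le> n \<and> outdeg p n u = Max (outdeg p n ` {0..n}))"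

definition unique_persistent_hub :: "(nat \<Rightarrow> nat) \<Rightarrow> nat \<Rightarrow> bool" where
  "unique_persistent_hub p u \<longleftrightarrow> persistent_hub p u \<and> (\<forall>v. persistent_hub p v \<longrightarrow> v = u)"

definition gpa_Z :: "(nat \<Rightarrow> nat \<Rightarrow> 'a \<Rightarrow> real) \<Rightarrow> (nat \<Rightarrow> 'a \<Rightarrow> nat) \<Rightarrow> nat \<Rightarrow> 'a \<Rightarrow> real" where
  "gpa_Z F P k \<omega> = (\<Sum>j\<le>k. F j (outdeg (\<lambda>i. P i \<omega>) k j) \<omega>)"

definition gpa_hist :: "(nat \<Rightarrow> nat \<Rightarrow> 'a \<Rightarrow> real) \<Rightarrow> (nat \<Rightarrow> 'a \<Rightarrow> nat) \<Rightarrow> nat \<Rightarrow> 'a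
    \<Rightarrow> ((nat \<times> nat) \<Rightarrow> real) \<times> (nat \<Rightarrow> nat)" where
  "gpa_hist F P k \<omega> = ((\<lambda>(j, d). F j d \<omega>), (\<lambda>i. if i \<le> k then P i \<omega> else 0))"

definition gpa_hist_space :: "(((nat \<times> nat) \<Rightarrow> real) \<times> (nat \<Rightarrow> nat)) measure" where
  "gpa_hist_space = pair_measure (PiM UNIV (\<lambda>_. borel)) (PiM UNIV (\<lambda>_. count_space UNIV))"

text \<open>Generalised preferential attachment tree with random weights on the probability
  space \<open>M\<close>: the weights are mutually independent, positive, the sequences
  \<open>(F j k)_k\<close> are identically distributed over \<open>j\<close>, and conditionally on the weights and
  on \<open>T_k\<close>, node \<open>k+1\<close> is attached to \<open>j \<le> k\<close> with probability \<open>F_j(deg j)/Z_k\<close>.\<close>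
definition gpa_tree :: "'a measure \<Rightarrow> (nat \<Rightarrow> nat \<Rightarrow> 'a \<Rightarrow> real) \<Rightarrow> (nat \<Rightarrow> 'a \<Rightarrow> nat) \<Rightarrow> bool" where
  "gpa_tree M F P \<longleftrightarrow>
     prob_space M \<and>
     (\<forall>j d. F j d \<in> borel_measurable M) \<and>
     (\<forall>j d. AE \<omega> in M. F j d \<omega> > 0) \<and>
     prob_space.indep_vars M (\<lambda>_. borel) (\<lambda>(j, d). F j d) UNIV \<and>
     (\<forall>j. distr M (PiM UNIV (\<lambda>_. borel)) (\<lambda>\<omega> d. F j d \<omega>)
          = distr M (PiM UNIV (\<lambda>_. borel)) (\<lambda>\<omega> d. F 0 d \<omega>)) \<and>
     (\<forall>i. P i \<in> measurable M (count_space UNIV)) \<and>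
     (\<forall>k j B. j \<le> k \<longrightarrow> B \<in> sets gpa_hist_space \<longrightarrow>
        measure M {\<omega> \<in> space M. gpa_hist F P k \<omega> \<in> B \<and> P (Suc k) \<omega> = j}
        = integral\<^sup>L M (\<lambda>\<omega>. indicator {\<omega> \<in> space M. gpa_hist F P k \<omega> \<in> B} \<omega> *
              (F j (outdeg (\<lambda>i. P i \<omega>) k j) \<omega> / gpa_Z F P k \<omega>)))"

end

theory Submission
  imports Defs
begin

text \<open>
  The tree is embedded in continuous time: node \<open>j\<close> waits \<open>x (j, d) = e / F\<^sub>j(d)\<close> with \<open>e\<close> standard
  exponential between its \<open>d\<close>-th and \<open>(d+1)\<close>-st child. By memorylessness the sequence of parents
  read off in order of birth has the law of the attachment tree, and now the waiting times are
  independent, with a law that does not depend on \<open>j\<close>. Degrees are compared through the times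
  \<open>birth u + (\<Sum>d<n. x (u, d))\<close> at which \<open>u\<close> reaches degree \<open>n\<close>.

  For the first part, \<open>\<Sum> F(j)\<^sup>-\<^sup>2 = \<infinity>\<close> makes the characteristic functions of the symmetric sums
  \<open>\<Sum>d<n. x (u, d) - x (v, d)\<close> tend to \<open>0\<close>, so these sums oscillate between \<open>-\<infinity>\<close> and \<open>\<infinity>\<close> and
  any two nodes overtake each other infinitely often, as long as the process does not explode. If
  it explodes, each node has only finitely many children; but the process in which every node keeps
  only its first \<open>m\<close> children has a mean Laplace transform below \<open>1\<close> at large arguments and does not
  explode, so the degrees are unbounded and again there is no hub.

  For the second part, \<open>\<Sum>d<n. x (u, d)\<close> minus its mean converges almost surely and has
  exponentially small lower deviations, while condition (b) gives \<open>E \<Sum>\<^sub>u exp (- t birth u) < \<infinity>\<close>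
  for some \<open>t\<close>. By Borel-Cantelli only finitely many nodes ever beat node \<open>0\<close>; among these the
  centred limits are pairwise different, since the first waiting time has no atoms, and the
  smallest one belongs to the unique hub.
\<close>

section \<open>The tree grown by a family of clocks\<close>

text \<open>In the discrete tree all degrees are coupled through the normalisation
  \<open>gpa_Z\<close>; in continuous time every node runs on its own row of clocks, and only its
  birth depends on the others. The series of F(j)^(-2) enters because 2 / F^2 is the second moment
  of e / F: it governs whether the centred time to reach degree n settles down or keeps fluctuating.
  The mean of exp (- s e / F) given F is F / (F + s), so the series in (b) is the expected
  discounted number of children of a single node. The obstacle in the first part is that no moment
  of the weights is available, so explosion cannot be ruled out, and after an explosion the
  crossings of two hitting times need not be seen in the tree. The Laplace transform of the first
  waiting time still tends to 0, and cutting degrees at m leaves finitely many products containing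
  it; this yields a contraction without any moment.\<close>

fun birth_time :: "(nat \<Rightarrow> nat) \<Rightarrow> (nat \<times> nat \<Rightarrow> real) \<Rightarrow> nat \<Rightarrow> real" where
  "birth_time p x 0 = 0"
| "birth_time p x (Suc k) =
     (if p (Suc k) \<le> k
      then birth_time p x (p (Suc k)) + (\<Sum>d\<le>outdeg p k (p (Suc k)). x (p (Suc k), d)) else 0)"

definition arrival :: "(nat \<Rightarrow> nat) \<Rightarrow> (nat \<times> nat \<Rightarrow> real) \<Rightarrow> nat \<Rightarrow> nat \<Rightarrow> real" where
  "arrival p x j n = birth_time p x j + (\<Sum>d<n. x (j, d))"

definition next_birth :: "(nat \<Rightarrow> nat) \<Rightarrow> (nat \<times> nat \<Rightarrow> real) \<Rightarrow> nat \<Rightarrow> nat \<Rightarrow> real" where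
  "next_birth p x k j = arrival p x j (Suc (outdeg p k j))"

text \<open>Ties have probability 0 for exponential clocks, but a fixed rule defines the tree for
  every family of clocks, so no null set has to be carried along.\<close>

definition first_argmin :: "nat \<Rightarrow> (nat \<Rightarrow> real) \<Rightarrow> nat" where
  "first_argmin k g = (LEAST j. j \<le> k \<and> (\<forall>i\<le>k. g j \<le> g i))"

text \<open>The next parent depends on the whole prefix, through degrees and birth times, so the
  recursion runs over prefixes; \<open>clock_tree\<close> is their diagonal, and by
  \<open>clock_prefix_eq\<close> later steps never change earlier entries.\<close>

primrec clock_prefix :: "(nat \<times> nat \<Rightarrow> real) \<Rightarrow> nat \<Rightarrow> nat \<Rightarrow> nat" where
  "clock_prefix x 0 = (\<lambda>_. 0)"
| "clock_prefix x (Suc k) =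
     (clock_prefix x k)(Suc k := first_argmin k (next_birth (clock_prefix x k) x k))"

definition clock_tree :: "(nat \<times> nat \<Rightarrow> real) \<Rightarrow> nat \<Rightarrow> nat" where
  "clock_tree x i = clock_prefix x i i"

lemma first_argmin_props:
  "first_argmin k g \<le> k" "i \<le> k \<Longrightarrow> g (first_argmin k g) \<le> g i"
proof -
  have "\<exists>j\<in>{..k}. \<forall>i\<in>{..k}. g j \<le> g i"
    by (metis arg_min_if_finite(1) arg_min_least finite_atMost atMost_iff empty_iff le0)
  then have ex: "\<exists>j. j \<le> k \<and> (\<forall>i\<le>k. g j \<le> g i)" by auto
  from LeastI_ex[OF this] show "first_argmin k g \<le> k" "i \<le> k \<Longrightarrow> g (first_argmin k g) \<le> g i"
    unfolding first_argmin_def by auto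
qed

text \<open>The strict inequality for smaller indices encodes the tie rule. Written as finitely many
  comparisons with \<open>g j\<close>, the event is measurable and, once \<open>g j\<close> is
  fixed, a product event in the other clocks.\<close>

lemma first_argmin_eq_iff:
  assumes "j \<le> k"
  shows "first_argmin k g = j \<longleftrightarrow> (\<forall>i\<le>k. if i < j then g j < g i else g j \<le> g i)"
proof
  assume eq: "first_argmin k g = j"
  show "\<forall>i\<le>k. if i < j then g j < g i else g j \<le> g i"
  proof (intro allI impI)
    fix i assume i: "i \<le> k"
    have le: "g j \<le> g i" if "i \<le> k" for i using first_argmin_props(2)[of i k g] eq that by simp
    have "g j < g i" if "i < j"
    proof (rule ccontr)
      assume "\<not> g j < g i"
      then have "\<forall>i'\<le>k. g i \<le> g i'" using le by force
      then have "first_argmin k g \<le> i" unfolding first_argmin_def using i by (intro Least_le) auto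
      then show False using that eq by simp
    qed
    then show "if i < j then g j < g i else g j \<le> g i" using le i by simp
  qed
next
  assume h: "\<forall>i\<le>k. if i < j then g j < g i else g j \<le> g i"
  show "first_argmin k g = j"
    unfolding first_argmin_def
  proof (rule Least_equality)
    show "j \<le> k \<and> (\<forall>i\<le>k. g j \<le> g i)" using h assms by (meson order_less_imp_le)
    fix y assume "y \<le> k \<and> (\<forall>i\<le>k. g y \<le> g i)"
    then show "j \<le> y" using h assms by (meson leI not_less)
  qed
qed

lemma outdeg_cong: "(\<And>i. 1 \<le> i \<Longrightarrow> i \<le> n \<Longrightarrow> p i = p' i) \<Longrightarrow> outdeg p n u = outdeg p' n u"
  unfolding outdeg_def by (rule arg_cong[where f=card]) auto

lemma outdeg_0 [simp]: "outdeg p 0 u = 0"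
  by (simp add: outdeg_def)

lemma outdeg_Suc: "outdeg p (Suc n) u = outdeg p n u + (if p (Suc n) = u then 1 else 0)"
proof -
  have "{i \<in> {1..Suc n}. p i = u} =
    (if p (Suc n) = u then insert (Suc n) {i \<in> {1..n}. p i = u} else {i \<in> {1..n}. p i = u})"
    by (auto simp: le_Suc_eq)
  then show ?thesis unfolding outdeg_def by (auto simp: card_insert_if)
qed

lemma outdeg_le: "outdeg p n u \<le> n"
  by (induction n) (auto simp: outdeg_Suc)

lemma outdeg_mono: "m \<le> n \<Longrightarrow> outdeg p m u \<le> outdeg p n u"
  unfolding outdeg_def by (intro card_mono) auto

lemma outdeg_eq_0:
  assumes "\<And>i. p (Suc i) \<le> i" "n \<le> u"
  shows "outdeg p n u = 0"
  using assms(2)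
proof (induction n)
  case (Suc n)
  then show ?case using assms(1)[of n] by (auto simp: outdeg_Suc)
qed simp

text \<open>The induction follows the ancestry of \<open>k\<close>. The guard
  \<open>p (Suc k) \<le> k\<close> in \<open>birth_time\<close> makes that recursion well-founded
  for an arbitrary \<open>p\<close> and keeps it among the rows below \<open>k\<close>.\<close>

lemma birth_time_cong:
  assumes "\<And>i. 1 \<le> i \<Longrightarrow> i \<le> k \<Longrightarrow> p i = p' i" "\<And>j d. j < k \<Longrightarrow> x (j, d) = y (j, d)"
  shows "birth_time p x k = birth_time p' y k"
  using assms
proof (induction k rule: less_induct)
  case (less k)
  show ?case
  proof (cases k)
    case (Suc m)
    have eq: "p (Suc m) = p' (Suc m)" using less.prems(1) Suc by simp
    have o: "outdeg p m u = outdeg p' m u" for u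
      using less.prems(1) Suc by (intro outdeg_cong) simp
    show ?thesis
    proof (cases "p' (Suc m) \<le> m")
      case True
      have "birth_time p x (p' (Suc m)) = birth_time p' y (p' (Suc m))"
        using True Suc less.prems by (intro less.IH) auto
      moreover have "x (p' (Suc m), d) = y (p' (Suc m), d)" for d
        using True Suc less.prems(2) by auto
      ultimately show ?thesis using Suc True eq o by simp
    next
      case False
      then show ?thesis using Suc eq by simp
    qed
  qed simp
qed

lemma next_birth_cong:
  assumes "\<And>i. 1 \<le> i \<Longrightarrow> i \<le> k \<Longrightarrow> p i = p' i" "\<And>j d. j \<le> k \<Longrightarrow> x (j, d) = y (j, d)" "j \<le> k"
  shows "next_birth p x k j = next_birth p' y k j"
proof -
  have "birth_time p x j = birth_time p' y j" using assms by (intro birth_time_cong) auto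
  moreover have "outdeg p k j = outdeg p' k j" using assms by (intro outdeg_cong) auto
  ultimately show ?thesis using assms by (simp add: next_birth_def arrival_def)
qed

lemma first_argmin_cong: "(\<And>i. i \<le> k \<Longrightarrow> g i = h i) \<Longrightarrow> first_argmin k g = first_argmin k h"
  unfolding first_argmin_def by (rule arg_cong[where f=Least]) auto

lemma clock_prefix_eq: "i \<le> k \<Longrightarrow> clock_prefix x k i = clock_tree x i"
proof (induction k)
  case (Suc k)
  then show ?case by (cases "i = Suc k") (simp_all add: clock_tree_def)
qed (simp add: clock_tree_def)

lemma clock_tree_Suc:
  "clock_tree x (Suc k) = first_argmin k (next_birth (clock_tree x) x k)"
proof -
  have "clock_tree x (Suc k) = first_argmin k (next_birth (clock_prefix x k) x k)"
    by (simp add: clock_tree_def)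
  also have "\<dots> = first_argmin k (next_birth (clock_tree x) x k)"
    by (intro first_argmin_cong next_birth_cong) (auto simp: clock_prefix_eq)
  finally show ?thesis .
qed

lemma clock_tree_Suc_le: "clock_tree x (Suc k) \<le> k"
  by (simp add: clock_tree_Suc first_argmin_props)

lemma clock_tree_0: "clock_tree x 0 = 0"
  by (simp add: clock_tree_def)

lemma clock_tree_cong:
  assumes "\<And>j d. j < k \<Longrightarrow> x (j, d) = y (j, d)"
  shows "i \<le> k \<Longrightarrow> clock_tree x i = clock_tree y i"
proof (induction i rule: less_induct)
  case (less i)
  show ?case
  proof (cases i)
    case (Suc m)
    show ?thesis unfolding Suc clock_tree_Suc
      using less Suc assms by (intro first_argmin_cong next_birth_cong) auto
  qed (simp add: clock_tree_0)
qed

section \<open>Birth times, hitting times and degrees in the clock tree\<close>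

definition birth :: "(nat \<times> nat \<Rightarrow> real) \<Rightarrow> nat \<Rightarrow> real" where
  "birth x k = birth_time (clock_tree x) x k"

definition hit :: "(nat \<times> nat \<Rightarrow> real) \<Rightarrow> nat \<Rightarrow> nat \<Rightarrow> real" where
  "hit x j n = birth x j + (\<Sum>d<n. x (j, d))"

definition deg :: "(nat \<times> nat \<Rightarrow> real) \<Rightarrow> nat \<Rightarrow> nat \<Rightarrow> nat" where
  "deg x = outdeg (clock_tree x)"

text \<open>The tree is now itself a function of the clocks, yet up to node \<open>k\<close> it
  reads only rows below \<open>k\<close>. This makes the birth of a node independent of its own
  row.\<close>

lemma birth_cong: "(\<And>j d. j < k \<Longrightarrow> x (j, d) = y (j, d)) \<Longrightarrow> birth x k = birth y k"
  unfolding birth_def by (intro birth_time_cong clock_tree_cong) auto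

lemma deg_cong: "(\<And>j d. j < k \<Longrightarrow> x (j, d) = y (j, d)) \<Longrightarrow> deg x k u = deg y k u"
  unfolding deg_def by (intro outdeg_cong clock_tree_cong) auto

lemma next_birth_clock_tree: "next_birth (clock_tree x) x k j = hit x j (Suc (deg x k j))"
  by (simp add: next_birth_def arrival_def hit_def birth_def deg_def)

lemma birth_0 [simp]: "birth x 0 = 0"
  by (simp add: birth_def)

lemma birth_Suc: "birth x (Suc k) = hit x (clock_tree x (Suc k)) (Suc (deg x k (clock_tree x (Suc k))))"
  using clock_tree_Suc_le[of x k] by (simp add: birth_def hit_def deg_def lessThan_Suc_atMost)

lemma birth_Suc_le: "j \<le> k \<Longrightarrow> birth x (Suc k) \<le> hit x j (Suc (deg x k j))"
  using first_argmin_props(2)[of j k "next_birth (clock_tree x) x k"]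
  by (simp add: birth_Suc next_birth_clock_tree clock_tree_Suc[symmetric])

lemma deg_Suc: "deg x (Suc k) j = deg x k j + (if clock_tree x (Suc k) = j then 1 else 0)"
  by (simp add: deg_def outdeg_Suc)

lemma deg_le: "deg x k j \<le> k"
  by (simp add: deg_def outdeg_le)

lemma deg_mono: "k \<le> l \<Longrightarrow> deg x k j \<le> deg x l j"
  by (simp add: deg_def outdeg_mono)

lemma deg_self [simp]: "deg x k k = 0"
  unfolding deg_def by (rule outdeg_eq_0) (auto intro: clock_tree_Suc_le)

context
  fixes x :: "nat \<times> nat \<Rightarrow> real"
  assumes pos: "\<And>i. 0 < x i"
begin

lemma hit_strict_mono: "m < n \<Longrightarrow> hit x j m < hit x j n"
  unfolding hit_def using pos by (intro add_strict_left_mono sum_strict_mono2[where b=m]) (auto intro: less_imp_le)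

lemma hit_mono: "m \<le> n \<Longrightarrow> hit x j m \<le> hit x j n"
  using hit_strict_mono[of m n j] by (cases "m = n") auto

text \<open>A birth is the earliest pending ring, and a newborn node rings only after its birth.
  Together with \<open>hit_deg_le_birth\<close> this places every birth time between the last and
  the next ring of each node, the dictionary between degrees and times.\<close>

lemma birth_le_hit: "j \<le> k \<Longrightarrow> birth x k \<le> hit x j (Suc (deg x k j))"
proof (induction k arbitrary: j)
  case 0
  then show ?case using pos[of "(0,0)"] by (simp add: hit_def)
next
  case (Suc k)
  show ?case
  proof (cases "j = Suc k")
    case True
    then show ?thesis using pos[of "(Suc k, 0)"] by (simp add: hit_def)
  next
    case False
    then have j: "j \<le> k" using Suc.prems by simp
    have "birth x (Suc k) \<le> hit x j (Suc (deg x k j))" using birth_Suc_le[OF j] .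
    also have "\<dots> \<le> hit x j (Suc (deg x (Suc k) j))" by (intro hit_mono) (simp add: deg_Suc)
    finally show ?thesis .
  qed
qed

lemma birth_mono_Suc: "birth x k \<le> birth x (Suc k)"
  unfolding birth_Suc using birth_le_hit[OF clock_tree_Suc_le] by simp

lemma birth_mono: "k \<le> l \<Longrightarrow> birth x k \<le> birth x l"
  by (rule lift_Suc_mono_le[of "birth x", OF birth_mono_Suc])

lemma birth_nonneg: "0 \<le> birth x k"
  using birth_mono[of 0 k] by simp

lemma hit_deg_le_birth: "j \<le> k \<Longrightarrow> hit x j (deg x k j) \<le> birth x k"
proof (induction k)
  case 0
  then show ?case by (simp add: hit_def)
next
  case (Suc k)
  consider "j = Suc k" | "j \<le> k" "clock_tree x (Suc k) = j" | "j \<le> k" "clock_tree x (Suc k) \<noteq> j"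
    using Suc.prems by linarith
  then show ?case
  proof cases
    case 1
    then show ?thesis by (simp add: hit_def)
  next
    case 2
    then show ?thesis by (simp add: deg_Suc birth_Suc)
  next
    case 3
    then show ?thesis using Suc.IH birth_mono_Suc[of k] by (simp add: deg_Suc)
  qed
qed

text \<open>If \<open>v\<close> has n children by now, then \<open>u\<close>, which reaches degree n
  earlier, has at least n as well. Only the current degree of \<open>v\<close> has to be
  compared.\<close>

lemma deg_le_of_hit_less:
  assumes "u \<le> k" "v \<le> k" "hit x u (deg x k v) < hit x v (deg x k v)"
  shows "deg x k v \<le> deg x k u"
proof (rule ccontr)
  assume "\<not> deg x k v \<le> deg x k u"
  then have "hit x u (Suc (deg x k u)) \<le> hit x u (deg x k v)" by (intro hit_mono) simp
  moreover have "birth x k \<le> hit x u (Suc (deg x k u))" using birth_le_hit assms by simp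
  ultimately show False using hit_deg_le_birth[of v k] assms by simp
qed

lemma deg_unbounded:
  assumes "\<And>B. \<exists>k. B < birth x k"
  shows "\<exists>k\<ge>m. n \<le> deg x k u"
proof -
  obtain k where "hit x u n < birth x k" using assms by blast
  then have "hit x u n < birth x (max k (max m u))" using birth_mono[of k "max k (max m u)"] by simp
  also have "\<dots> \<le> hit x u (Suc (deg x (max k (max m u)) u))" by (intro birth_le_hit) simp
  finally have "\<not> Suc (deg x (max k (max m u)) u) \<le> n" using hit_mono by (meson not_less)
  then show ?thesis by (intro exI[of _ "max k (max m u)"]) auto
qed

section \<open>Hub criteria in terms of hitting times\<close>

lemma persistent_hub_clock_tree:
  "persistent_hub (clock_tree x) u \<longleftrightarrow> (\<exists>K\<ge>u. \<forall>k\<ge>K. \<forall>v\<le>k. deg x k v \<le> deg x k u)"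
proof -
  have "u \<le> n \<and> outdeg (clock_tree x) n u = Max (outdeg (clock_tree x) n ` {0..n}) \<longleftrightarrow>
        u \<le> n \<and> (\<forall>v\<le>n. deg x n v \<le> deg x n u)" for n
    unfolding deg_def by (auto intro!: Max_eqI[symmetric] simp: Max_ge)
  then show ?thesis unfolding persistent_hub_def eventually_sequentially
    by simp (metis le_trans linorder_le_cases)
qed

text \<open>Without explosion every crossing in time is seen in the tree: at the birth that gives
  \<open>v\<close> its n-th child, \<open>u\<close> still has fewer than n.\<close>

lemma not_persistent_hub_overtaken:
  assumes unb: "\<And>B. \<exists>k. B < birth x k" and inf: "\<And>m. \<exists>n\<ge>m. hit x v n < hit x u n"
  shows "\<not> persistent_hub (clock_tree x) u"
proof
  assume "persistent_hub (clock_tree x) u"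
  then obtain K where K: "u \<le> K" "\<And>k v. K \<le> k \<Longrightarrow> v \<le> k \<Longrightarrow> deg x k v \<le> deg x k u"
    unfolding persistent_hub_clock_tree by blast
  define K0 where "K0 = max K v"
  \<comment> \<open>Since \<open>n\<close> exceeds the degree of \<open>v\<close> at
    \<open>K0\<close>, the n-th child of \<open>v\<close> is born later, at some step
    \<open>Suc l\<close>, and the birth time of that step is exactly
    \<open>hit x v n\<close>.\<close>
  obtain n where n: "Suc (deg x K0 v) \<le> n" "hit x v n < hit x u n" using inf by blast
  define k where "k = (LEAST k. K0 \<le> k \<and> n \<le> deg x k v)"
  have ex: "\<exists>k. K0 \<le> k \<and> n \<le> deg x k v" using deg_unbounded[OF unb] by blast
  have k: "K0 \<le> k" "n \<le> deg x k v" using LeastI_ex[OF ex] unfolding k_def by auto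
  have "k \<noteq> K0" using k n by auto
  then obtain l where l: "k = Suc l" "K0 \<le> l" using k(1) by (cases k) auto
  have "deg x l v < n" using not_less_Least[of l "\<lambda>k. K0 \<le> k \<and> n \<le> deg x k v"] l
    unfolding k_def[symmetric] by auto
  then have p: "clock_tree x (Suc l) = v" "n = Suc (deg x l v)"
    using k(2) l(1) by (auto simp: deg_Suc split: if_splits)
  have b: "birth x k = hit x v n" using p l by (simp add: birth_Suc)
  have "n \<le> deg x k u" using k K(2)[of k v] unfolding K0_def by auto
  then have "hit x u n \<le> hit x u (deg x k u)" by (rule hit_mono)
  also have "\<dots> \<le> birth x k" using k K unfolding K0_def by (intro hit_deg_le_birth) auto
  finally show False using b n by simp
qed

text \<open>If all births happen before \<open>B\<close>, a divergent row gives its node only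
  boundedly many children, so no single node keeps up with an unbounded maximal degree.\<close>

lemma not_persistent_hub_bounded:
  assumes B: "\<And>k. birth x k \<le> B" and div: "\<And>u C. \<exists>n. C < (\<Sum>d<n. x (u, d))"
    and unb: "\<And>m. \<exists>k v. v \<le> k \<and> m < deg x k v"
  shows "\<not> persistent_hub (clock_tree x) u"
proof
  assume "persistent_hub (clock_tree x) u"
  then obtain K where K: "u \<le> K" "\<And>k v. K \<le> k \<Longrightarrow> v \<le> k \<Longrightarrow> deg x k v \<le> deg x k u"
    unfolding persistent_hub_clock_tree by blast
  obtain n where n: "B - birth x u < (\<Sum>d<n. x (u, d))" using div by blast
  have dn: "deg x k u < n" if "u \<le> k" for k
  proof (rule ccontr)
    assume "\<not> deg x k u < n"
    then have "hit x u n \<le> hit x u (deg x k u)" by (intro hit_mono) simp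
    also have "\<dots> \<le> B" using hit_deg_le_birth[OF that] B[of k] by simp
    finally show False using n by (simp add: hit_def)
  qed
  obtain k v where kv: "v \<le> k" "n < deg x k v" using unb by blast
  have "n < deg x (max k K) v" using kv deg_mono[of k "max k K" x v] by simp
  also have "\<dots> \<le> deg x (max k K) u" using K(2)[of "max k K" v] kv by simp
  finally show False using dn[of "max k K"] K(1) by (auto simp: le_max_iff_disj)
qed

text \<open>Eventual order of the hitting times is a strict total order, and its least element on
  the finite set \<open>insert 0 E\<close> is the hub; a node outside \<open>E\<close> is dominated
  by node 0 at every degree. Any other candidate is overtaken infinitely often, by the hub or by
  node 0.\<close>

lemma unique_persistent_hub_exists:
  assumes unb: "\<And>B. \<exists>k. B < birth x k"
    and fin: "finite E" "\<And>v n. v \<notin> E \<Longrightarrow> v \<noteq> 0 \<Longrightarrow> hit x 0 n < hit x v n"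
    and ord: "\<And>u v. u < v \<Longrightarrow> (\<exists>m. \<forall>n\<ge>m. hit x u n < hit x v n) \<or> (\<exists>m. \<forall>n\<ge>m. hit x v n < hit x u n)"
  shows "\<exists>u. unique_persistent_hub (clock_tree x) u"
proof -
  define R where "R u v \<longleftrightarrow> (\<exists>m. \<forall>n\<ge>m. hit x u n < hit x v n)" for u v
  have tot: "R u v \<or> R v u" if "u \<noteq> v" for u v
    using ord[of u v] ord[of v u] that unfolding R_def by (metis linorder_neqE_nat)
  have trans: "R u w" if uvw: "R u v" "R v w" for u v w
  proof -
    obtain m1 m2 where m: "\<forall>n\<ge>m1. hit x u n < hit x v n" "\<forall>n\<ge>m2. hit x v n < hit x w n"
      using uvw unfolding R_def by blast
    show ?thesis unfolding R_def
    proof (intro exI[of _ "max m1 m2"] allI impI)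
      fix n assume "max m1 m2 \<le> n"
      then have "hit x u n < hit x v n" "hit x v n < hit x w n" using m by auto
      then show "hit x u n < hit x w n" by simp
    qed
  qed
  have "\<exists>u\<in>S. \<forall>v\<in>S. v \<noteq> u \<longrightarrow> R u v" if "finite S" "S \<noteq> {}" for S
    using that
  proof (induction S rule: finite_ne_induct)
    case (insert a S)
    then obtain u where u: "u \<in> S" "\<forall>v\<in>S. v \<noteq> u \<longrightarrow> R u v" by blast
    then have "u \<noteq> a" using insert.hyps by blast
    then consider "R u a" | "R a u" using tot by blast
    then show ?case
    proof cases
      case 1
      then show ?thesis using u by (intro bexI[of _ u]) auto
    next
      case 2
      then have "R a v" if "v \<in> S" for v using u trans that by (cases "v = u") auto
      then show ?thesis by (intro bexI[of _ a]) auto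
    qed
  qed auto
  from this[of "insert 0 E"] fin(1)
  have "\<exists>u\<in>insert 0 E. \<forall>v\<in>insert 0 E. v \<noteq> u \<longrightarrow> R u v" by simp
  then obtain u where u: "u \<in> insert 0 E" "\<And>v. v \<in> insert 0 E \<Longrightarrow> v \<noteq> u \<Longrightarrow> R u v"
    by metis
  have "\<exists>m. \<forall>v\<in>insert 0 E. v \<noteq> u \<longrightarrow> (\<forall>n\<ge>m. hit x u n < hit x v n)"
  proof -
    have "\<forall>v. \<exists>m. v \<in> insert 0 E \<and> v \<noteq> u \<longrightarrow> (\<forall>n\<ge>m. hit x u n < hit x v n)"
      using u(2) unfolding R_def by blast
    then obtain f where f: "\<And>v. v \<in> insert 0 E \<and> v \<noteq> u \<longrightarrow> (\<forall>n\<ge>f v. hit x u n < hit x v n)"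
      by metis
    have "f v \<le> Max (f ` insert 0 E)" if "v \<in> insert 0 E" for v
      using fin(1) that by (intro Max_ge) auto
    then show ?thesis using f by (intro exI[of _ "Max (f ` insert 0 E)"]) (meson order_trans)
  qed
  then obtain m where m: "\<And>v n. v \<in> insert 0 E \<Longrightarrow> v \<noteq> u \<Longrightarrow> m \<le> n \<Longrightarrow> hit x u n < hit x v n"
    by blast
  \<comment> \<open>The order of hitting times is settled from degree \<open>m\<close> on. Once the
    hub itself has degree \<open>m\<close>, rivals of smaller degree are beaten trivially and all
    others by that order.\<close>
  obtain K where K: "u \<le> K" "m \<le> deg x K u" using deg_unbounded[OF unb, of u m u] by auto
  have S: "deg x k v \<le> deg x k u" if "v \<in> insert 0 E" "K \<le> k" "v \<le> k" for k v
  proof (cases "v = u \<or> deg x k v < m")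
    case True
    then show ?thesis using K deg_mono[OF that(2), of x u] by auto
  next
    case False
    then show ?thesis using m[of v "deg x k v"] that K by (intro deg_le_of_hit_less) auto
  qed
  have hub: "persistent_hub (clock_tree x) u"
    unfolding persistent_hub_clock_tree
  proof (intro exI[of _ K] conjI allI impI)
    fix k v assume k: "K \<le> k" "v \<le> k"
    show "deg x k v \<le> deg x k u"
    proof (cases "v \<in> insert 0 E")
      case True
      then show ?thesis using S k by blast
    next
      case False
      then have "deg x k v \<le> deg x k 0" using fin(2) k by (intro deg_le_of_hit_less) auto
      also have "\<dots> \<le> deg x k u" using S k by blast
      finally show ?thesis .
    qed
  qed (use K in auto)
  have "v = u" if "persistent_hub (clock_tree x) v" for v
  proof (rule ccontr)
    assume "v \<noteq> u"
    show False
    proof (cases "v \<in> insert 0 E")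
      case True
      have "\<exists>n\<ge>l. hit x u n < hit x v n" for l
        using m[OF True \<open>v \<noteq> u\<close>, of "max l m"] by (intro exI[of _ "max l m"]) auto
      then show ?thesis using not_persistent_hub_overtaken[OF unb] that by blast
    next
      case False
      then show ?thesis using not_persistent_hub_overtaken[OF unb, of 0 v] fin(2)[of v] that by auto
    qed
  qed
  then show ?thesis using hub unfolding unique_persistent_hub_def by blast
qed

end

section \<open>Competing exponential clocks\<close>

abbreviation exp_law :: "real measure" where
  "exp_law \<equiv> density lborel (exponential_density 1)"

abbreviation exp_clocks :: "(nat \<times> nat \<Rightarrow> real) measure" where
  "exp_clocks \<equiv> PiM UNIV (\<lambda>_. exp_law)"

lemma prob_space_exp_law: "prob_space exp_law"
  by (rule prob_space_exponential_density) simp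

lemma prob_space_exp_clocks: "prob_space exp_clocks"
  by (rule prob_space_PiM) (rule prob_space_exp_law)

lemma nn_integral_exp_law:
  assumes [measurable]: "h \<in> borel_measurable borel"
  shows "(\<integral>\<^sup>+y. h y \<partial>exp_law) = (\<integral>\<^sup>+y. h y * (ennreal (exp (-y)) * indicator {0..} y) \<partial>lborel)"
  by (subst nn_integral_density)
     (auto intro!: nn_integral_cong simp: exponential_density_def indicator_def mult.commute)

text \<open>The flag \<open>b\<close> covers strict and weak comparison at once, since the tie rule
  asks for the strict one from lower-numbered nodes only.\<close>

lemma exp_law_memoryless:
  assumes [measurable]: "B \<in> sets borel" and c: "0 \<le> c"
  shows "emeasure exp_law {z. (if b then c < z else c \<le> z) \<and> z - c \<in> B} = ennreal (exp (-c)) * emeasure exp_law B"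
proof -
  let ?S = "{z. (if b then c < z else c \<le> z) \<and> z - c \<in> B}"
  have [measurable]: "?S \<in> sets borel" by (cases b) simp_all
  have "emeasure exp_law ?S = (\<integral>\<^sup>+z. indicator ?S z \<partial>exp_law)"
    by (subst nn_integral_indicator) simp_all
  also have "\<dots> = (\<integral>\<^sup>+z. indicator ?S z * (ennreal (exp (-z)) * indicator {0..} z) \<partial>lborel)"
    by (rule nn_integral_exp_law) simp
  also have "\<dots> = (\<integral>\<^sup>+z. indicator ?S (c + 1 * z) * (ennreal (exp (-(c + 1 * z))) * indicator {0..} (c + 1 * z)) \<partial>lborel)"
    by (subst nn_integral_real_affine[where c=1 and t=c]) simp_all
  also have "\<dots> = (\<integral>\<^sup>+z. ennreal (exp (-c)) * (indicator B z * (ennreal (exp (-z)) * indicator {0..} z)) \<partial>lborel)"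
  proof (rule nn_integral_cong_AE)
    \<comment> \<open>After the shift by \<open>c\<close> the two comparisons differ only at the
      point 0, which is discarded as a null set.\<close>
    have "AE z in lborel. z \<noteq> (0::real)" by (rule AE_lborel_singleton)
    then show "AE z in lborel. indicator ?S (c + 1 * z) * (ennreal (exp (-(c + 1 * z))) * indicator {0..} (c + 1 * z)) =
         ennreal (exp (-c)) * (indicator B z * (ennreal (exp (-z)) * indicator {0..} z))"
    proof eventually_elim
      case (elim z)
      then show ?case using c
        by (auto simp: indicator_def exp_add[symmetric] exp_diff ennreal_mult[symmetric] mult_exp_exp)
    qed
  qed
  also have "\<dots> = ennreal (exp (-c)) * (\<integral>\<^sup>+z. indicator B z \<partial>exp_law)"
    by (subst nn_integral_exp_law) (simp_all add: nn_integral_cmult)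
  finally show ?thesis by (subst (asm) nn_integral_indicator) simp_all
qed

lemma exp_law_laplace:
  assumes a: "0 \<le> a"
  shows "(\<integral>\<^sup>+y. ennreal (exp (- (a * y))) \<partial>exp_law) = ennreal (1 / (1 + a))"
proof -
  have "(\<integral>\<^sup>+y. ennreal (exp (- (a * y))) \<partial>exp_law) =
    (\<integral>\<^sup>+y. ennreal (1 / (1 + a)) * ennreal (exponential_density (1 + a) y) \<partial>lborel)"
    using a
    by (subst nn_integral_exp_law)
       (auto intro!: nn_integral_cong simp: exponential_density_def indicator_def ennreal_mult[symmetric]
          mult_exp_exp field_simps)
  also have "\<dots> = ennreal (1 / (1 + a)) * (\<integral>\<^sup>+y. ennreal (exponential_density (1 + a) y) \<partial>lborel)"
    by (rule nn_integral_cmult) simp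
  also have "(\<integral>\<^sup>+y. ennreal (exponential_density (1 + a) y) \<partial>lborel) = 1"
  proof -
    interpret prob_space "density lborel (exponential_density (1 + a))"
      using a by (intro prob_space_exponential_density) simp
    show ?thesis using emeasure_space_1 by (simp add: emeasure_density)
  qed
  finally show ?thesis by simp
qed

lemma AE_exp_law_pos: "AE y in exp_law. 0 < y"
proof -
  have "AE z in lborel. z \<noteq> (0::real)" by (rule AE_lborel_singleton)
  then show ?thesis
    by (subst AE_density) (auto simp: exponential_density_def elim!: eventually_mono)
qed

section \<open>One race between exponential clocks\<close>

lemma pred_first_argmin [measurable]:
  assumes [measurable]: "\<And>j. (\<lambda>w. g w j) \<in> borel_measurable M"
  shows "Measurable.pred M (\<lambda>w. first_argmin k (g w) = j)"
proof (cases "j \<le> k")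
  case True
  show ?thesis unfolding first_argmin_eq_iff[OF True] by measurable
next
  case False
  then have "first_argmin k (g w) \<noteq> j" for w using first_argmin_props(1)[of k "g w"] by auto
  then show ?thesis by simp
qed

text \<open>The race ends at time \<open>g (J, 0) / r J\<close>. A loser of rate \<open>r j\<close>
  has by then consumed \<open>r j\<close> times that amount of its unit-rate clock, while the winner
  moves on to the next clock of its row.\<close>

definition clock_step :: "(nat \<Rightarrow> real) \<Rightarrow> nat \<Rightarrow> nat \<Rightarrow> (nat \<times> nat \<Rightarrow> real) \<Rightarrow> nat \<times> nat \<Rightarrow> real" where
  "clock_step r k J g = (\<lambda>(j, d). if j = J then g (J, Suc d)
     else if d = 0 \<and> j \<le> k then g (j, 0) - r j * g (J, 0) / r J else g (j, d))"

lemma measurable_clock_step [measurable]: "clock_step r k J \<in> measurable exp_clocks exp_clocks"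
  unfolding clock_step_def by (rule measurable_PiM_single') (auto simp: split_beta' space_PiM)

text \<open>The winner and the clocks after the race are treated jointly: on the event that
  \<open>J\<close> wins, the whole family is again i.i.d. exponential, so the step can be iterated.
  Given the winning clock y, each loser contributes a factor \<open>exp (- r i * y / r J)\<close> by
  memorylessness, and the integral over y is a Laplace transform.\<close>

lemma clock_step_law:
  assumes r: "\<And>i. 0 < r i" and J: "J \<le> k" and B: "B \<in> sets exp_clocks"
  shows "emeasure exp_clocks {g \<in> space exp_clocks. first_argmin k (\<lambda>i. g (i, 0) / r i) = J \<and> clock_step r k J g \<in> B}
     = ennreal (r J / (\<Sum>i\<le>k. r i)) * emeasure exp_clocks B"
proof -
  interpret E: prob_space exp_law by (rule prob_space_exp_law)
  interpret C: prob_space exp_clocks by (rule prob_space_exp_clocks)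
  define cond where "cond g \<longleftrightarrow> first_argmin k (\<lambda>i. g (i, 0) / r i) = J" for g :: "nat \<times> nat \<Rightarrow> real"
  have cond_iff: "cond g \<longleftrightarrow> (\<forall>i\<in>{..k}-{J}. if i < J then r i * g (J, 0) / r J < g (i, 0) else r i * g (J, 0) / r J \<le> g (i, 0))" for g
    unfolding cond_def first_argmin_eq_iff[OF J] using r
    by (auto simp: field_simps split: if_splits)
  define W where "W = {g \<in> space exp_clocks. cond g}"
  have [measurable]: "W \<in> sets exp_clocks" unfolding W_def cond_def by measurable
  define c where "c = ennreal (r J / (\<Sum>i\<le>k. r i))"
  define P1 where "P1 = distr (density exp_clocks (indicator W)) exp_clocks (clock_step r k J)"
  define P2 where "P2 = scale_measure c exp_clocks"
  have P1_eq: "emeasure P1 A = emeasure exp_clocks {g \<in> space exp_clocks. cond g \<and> clock_step r k J g \<in> A}"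
    if [measurable]: "A \<in> sets exp_clocks" for A
  proof -
    have "emeasure P1 A = emeasure (density exp_clocks (indicator W)) (clock_step r k J -` A \<inter> space exp_clocks)"
      unfolding P1_def using measurable_clock_step by (subst emeasure_distr) simp_all
    also have "\<dots> = (\<integral>\<^sup>+g. indicator W g * indicator (clock_step r k J -` A \<inter> space exp_clocks) g \<partial>exp_clocks)"
      by (rule emeasure_density) simp_all
    also have "\<dots> = (\<integral>\<^sup>+g. indicator {g \<in> space exp_clocks. cond g \<and> clock_step r k J g \<in> A} g \<partial>exp_clocks)"
      by (intro nn_integral_cong) (auto simp: W_def indicator_def)
    also have "\<dots> = emeasure exp_clocks {g \<in> space exp_clocks. cond g \<and> clock_step r k J g \<in> A}"
    proof (rule nn_integral_indicator)
      have "{g \<in> space exp_clocks. cond g \<and> clock_step r k J g \<in> A} = W \<inter> (clock_step r k J -` A \<inter> space exp_clocks)"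
        by (auto simp: W_def)
      also have "\<dots> \<in> sets exp_clocks" by measurable
      finally show "{g \<in> space exp_clocks. cond g \<and> clock_step r k J g \<in> A} \<in> sets exp_clocks" .
    qed
    finally show ?thesis .
  qed
  have "P1 = P2"
  proof (rule measure_eqI_PiM_infinite[where M="\<lambda>_. exp_law" and I=UNIV])
    show "sets P1 = sets exp_clocks" "sets P2 = sets exp_clocks" unfolding P1_def P2_def by simp_all
    show "finite_measure P1"
    proof (rule finite_measureI)
      have "emeasure P1 (space exp_clocks) \<le> emeasure exp_clocks (space exp_clocks)"
        by (subst P1_eq) (auto intro!: emeasure_mono)
      also have "\<dots> = 1" by (rule C.emeasure_space_1)
      finally show "emeasure P1 (space P1) \<noteq> \<infinity>" unfolding P1_def by (auto simp: top_unique)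
    qed
    fix A :: "nat \<times> nat \<Rightarrow> real set" and I :: "(nat \<times> nat) set"
    assume I: "finite I" and A: "\<And>i. i \<in> I \<Longrightarrow> A i \<in> sets exp_law"
    define R where "R = prod_emb UNIV (\<lambda>_. exp_law) I (Pi\<^sub>E I A)"
    have R[measurable]: "R \<in> sets exp_clocks" unfolding R_def using I A by (intro sets_PiM_I) auto
    have R_iff: "g \<in> R \<longleftrightarrow> (\<forall>i\<in>I. g i \<in> A i)" for g
      unfolding R_def by (auto simp: prod_emb_def space_PiM PiE_iff)
    have ER: "emeasure exp_clocks R = (\<Prod>i\<in>I. emeasure exp_law (A i))"
      unfolding R_def using I A by (intro emeasure_PiM_emb) (auto intro: prob_space_exp_law)
    \<comment> \<open>\<open>comp\<close> holds the running clocks of the losers. They are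
      constrained by the race even when the cylinder does not mention them, so \<open>I\<close> is
      enlarged to \<open>I'\<close> with trivial sets \<open>A'\<close> on the new
      coordinates.\<close>
    define comp where "comp = (\<lambda>i::nat. (i, 0::nat)) ` ({..k} - {J})"
    define I' where "I' = I \<union> comp"
    define A' where "A' t = (if t \<in> I then A t else UNIV)" for t
    have A'[measurable]: "A' t \<in> sets borel" for t using A[of t] by (auto simp: A'_def)
    have I': "finite I'" using I by (simp add: I'_def comp_def)
    \<comment> \<open>Coordinate \<open>t\<close> after the step is read from coordinate
      \<open>src t\<close> before it. The image of \<open>src\<close> avoids \<open>(J, 0)\<close>,
      so everything else is independent of the winning clock.\<close>
    define src where "src t = (if fst t = J then (J, Suc (snd t)) else t)" for t :: "nat \<times> nat"
    define trg where "trg s = (if fst s = J then (J, snd s - 1) else s)" for s :: "nat \<times> nat"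
    have ts: "trg (src t) = t" for t by (cases t) (simp add: trg_def src_def)
    have inj: "inj_on src S" for S by (rule inj_on_inverseI[of _ trg]) (rule ts)
    have src0: "src t \<noteq> (J, 0)" for t by (cases t) (auto simp: src_def)
    \<comment> \<open>The constraint on one coordinate when the winning clock is \<open>y\<close>:
      with \<open>y\<close> fixed the event factorises over \<open>I'\<close>.\<close>
    define H where "H t y = (if t \<in> comp
       then {z. (if fst t < J then r (fst t) * y / r J < z else r (fst t) * y / r J \<le> z) \<and> z - r (fst t) * y / r J \<in> A' t}
       else A' t)" for t y
    have H[measurable]: "H t y \<in> sets borel" for t y
      unfolding H_def by (cases "fst t < J") simp_all
    define K where "K = UNIV - {(J, 0::nat)}"
    have iff: "cond g \<and> clock_step r k J g \<in> R \<longleftrightarrow> (\<forall>t\<in>I'. g (src t) \<in> H t (g (J, 0)))" for g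
    proof -
      define cmp where "cmp t \<longleftrightarrow> (if fst t < J then r (fst t) * g (J, 0) / r J < g t else r (fst t) * g (J, 0) / r J \<le> g t)" for t
      have 1: "clock_step r k J g \<in> R \<longleftrightarrow> (\<forall>t\<in>I'. clock_step r k J g t \<in> A' t)"
        unfolding R_iff I'_def A'_def by auto
      have 2: "cond g \<longleftrightarrow> (\<forall>t\<in>I'. t \<in> comp \<longrightarrow> cmp t)"
        unfolding cond_iff comp_def I'_def cmp_def by auto
      have "cond g \<and> clock_step r k J g \<in> R \<longleftrightarrow> (\<forall>t\<in>I'. (t \<in> comp \<longrightarrow> cmp t) \<and> clock_step r k J g t \<in> A' t)"
        unfolding 1 2 by blast
      also have "\<dots> \<longleftrightarrow> (\<forall>t\<in>I'. g (src t) \<in> H t (g (J, 0)))"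
      proof (rule ball_cong[OF refl])
        fix t
        show "(t \<in> comp \<longrightarrow> cmp t) \<and> clock_step r k J g t \<in> A' t \<longleftrightarrow> g (src t) \<in> H t (g (J, 0))"
        proof (cases "t \<in> comp")
          case True
          then have "clock_step r k J g t = g t - r (fst t) * g (J, 0) / r J" "src t = t"
            by (auto simp: clock_step_def src_def comp_def split: if_splits)
          then show ?thesis using True by (simp add: H_def cmp_def)
        next
          case False
          then have "clock_step r k J g t = g (src t)"
            by (cases t) (auto simp: clock_step_def src_def comp_def)
          then show ?thesis using False by (simp add: H_def)
        qed
      qed
      finally show ?thesis .
    qed
    interpret KK: prob_space "PiM K (\<lambda>_. exp_law)" by (rule prob_space_PiM) (rule prob_space_exp_law)
    have UK: "UNIV = insert (J, 0) K" by (auto simp: K_def)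
    let ?S = "{g \<in> space exp_clocks. cond g \<and> clock_step r k J g \<in> R}"
    let ?K = "PiM K (\<lambda>_. exp_law)"
    let ?T = "(\<lambda>(y, g). g((J, 0) := y)) -` ?S \<inter> space (exp_law \<Otimes>\<^sub>M ?K)"
    have S: "?S \<in> sets exp_clocks"
    proof -
      have "?S = W \<inter> (clock_step r k J -` R \<inter> space exp_clocks)" by (auto simp: W_def)
      also have "\<dots> \<in> sets exp_clocks" by measurable
      finally show ?thesis .
    qed
    have upd: "(\<lambda>(y, g). g((J, 0) := y)) \<in> measurable (exp_law \<Otimes>\<^sub>M ?K) exp_clocks"
      unfolding UK by measurable
    have law: "distr (exp_law \<Otimes>\<^sub>M ?K) exp_clocks (\<lambda>(y, g). g((J, 0) := y)) = exp_clocks"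
      unfolding UK by (rule distr_pair_PiM_eq_PiM) (rule prob_space_exp_law)+
    have "emeasure P1 R = emeasure exp_clocks ?S" by (rule P1_eq) simp
    also have "\<dots> = emeasure (distr (exp_law \<Otimes>\<^sub>M ?K) exp_clocks (\<lambda>(y, g). g((J, 0) := y))) ?S"
      unfolding law ..
    also have "\<dots> = emeasure (exp_law \<Otimes>\<^sub>M ?K)
        ?T"
      by (rule emeasure_distr[OF upd S])
    also have "\<dots> = (\<integral>\<^sup>+y. emeasure ?K
        (Pair y -` ?T) \<partial>exp_law)"
      by (rule KK.emeasure_pair_measure_alt) (rule measurable_sets[OF upd S])
    also have "\<dots> = (\<integral>\<^sup>+y. (\<Prod>t\<in>I'. emeasure exp_law (H t y)) \<partial>exp_law)"
    proof (rule nn_integral_cong)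
      fix y
      have "Pair y -` ?T
         = prod_emb K (\<lambda>_. exp_law) (src ` I') (Pi\<^sub>E (src ` I') (\<lambda>s. H (trg s) y))"
      proof (intro set_eqI)
        fix g
        have "g \<in> Pair y -` ?T
          \<longleftrightarrow> g \<in> extensional K \<and> (\<forall>t\<in>I'. g (src t) \<in> H t y)"
          using src0 by (simp add: iff space_pair_measure space_PiM PiE_def conj_commute)
        also have "\<dots> \<longleftrightarrow> g \<in> prod_emb K (\<lambda>_. exp_law) (src ` I') (Pi\<^sub>E (src ` I') (\<lambda>s. H (trg s) y))"
          by (simp add: space_PiM prod_emb_def PiE_iff ts extensional_def) blast
        finally show "g \<in> Pair y -` ?T
          \<longleftrightarrow> g \<in> prod_emb K (\<lambda>_. exp_law) (src ` I') (Pi\<^sub>E (src ` I') (\<lambda>s. H (trg s) y))" .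
      qed
      then have "emeasure ?K (Pair y -` ?T)
        = emeasure ?K (prod_emb K (\<lambda>_. exp_law) (src ` I') (Pi\<^sub>E (src ` I') (\<lambda>s. H (trg s) y)))"
        by simp
      also have "\<dots> = (\<Prod>s\<in>src ` I'. emeasure exp_law (H (trg s) y))"
      proof (rule emeasure_PiM_emb)
        show "src ` I' \<subseteq> K" unfolding K_def image_subset_iff using src0 by simp
      qed (use I' in \<open>auto intro: prob_space_exp_law\<close>)
      also have "\<dots> = (\<Prod>t\<in>I'. emeasure exp_law (H t y))"
        by (subst prod.reindex[OF inj]) (simp add: ts)
      finally show "emeasure ?K (Pair y -` ?T)
        = (\<Prod>t\<in>I'. emeasure exp_law (H t y))" .
    qed
    also have "\<dots> = (\<integral>\<^sup>+y. ennreal (exp (- ((\<Sum>i\<in>{..k}-{J}. r i / r J) * y))) * (\<Prod>t\<in>I'. emeasure exp_law (A' t)) \<partial>exp_law)"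
    proof (rule nn_integral_cong_AE)
      show "AE y in exp_law. (\<Prod>t\<in>I'. emeasure exp_law (H t y)) =
         ennreal (exp (- ((\<Sum>i\<in>{..k}-{J}. r i / r J) * y))) * (\<Prod>t\<in>I'. emeasure exp_law (A' t))"
        using AE_exp_law_pos
      proof eventually_elim
        case (elim y)
        have "emeasure exp_law (H t y) = ennreal (if t \<in> comp then exp (- (r (fst t) / r J * y)) else 1) * emeasure exp_law (A' t)" for t
          unfolding H_def using elim r[of "fst t"] r[of J]
          by (auto simp: exp_law_memoryless)
        then have "(\<Prod>t\<in>I'. emeasure exp_law (H t y)) =
            (\<Prod>t\<in>I'. ennreal (if t \<in> comp then exp (- (r (fst t) / r J * y)) else 1)) * (\<Prod>t\<in>I'. emeasure exp_law (A' t))"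
          by (simp only: prod.distrib)
        also have "(\<Prod>t\<in>I'. ennreal (if t \<in> comp then exp (- (r (fst t) / r J * y)) else 1))
           = ennreal (\<Prod>t\<in>I'. (if t \<in> comp then exp (- (r (fst t) / r J * y)) else 1))"
          by (rule prod_ennreal) simp
        also have "(\<Prod>t\<in>I'. (if t \<in> comp then exp (- (r (fst t) / r J * y)) else 1)) = (\<Prod>t\<in>comp. exp (- (r (fst t) / r J * y)))"
          using I' by (subst prod.inter_filter[symmetric]) (auto simp: I'_def intro!: prod.cong)
        also have "\<dots> = (\<Prod>i\<in>{..k}-{J}. exp (- (r i / r J * y)))"
          unfolding comp_def by (subst prod.reindex) (auto simp: inj_on_def)
        also have "\<dots> = exp (- ((\<Sum>i\<in>{..k}-{J}. r i / r J) * y))"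
          by (subst exp_sum[symmetric]) (simp_all add: sum_negf sum_distrib_right)
        finally show ?case .
      qed
    qed
    also have "\<dots> = (\<integral>\<^sup>+y. ennreal (exp (- ((\<Sum>i\<in>{..k}-{J}. r i / r J) * y))) \<partial>exp_law) * (\<Prod>t\<in>I'. emeasure exp_law (A' t))"
      by (rule nn_integral_multc) simp
    also have "(\<integral>\<^sup>+y. ennreal (exp (- ((\<Sum>i\<in>{..k}-{J}. r i / r J) * y))) \<partial>exp_law) = c"
    proof -
      have nn: "0 \<le> (\<Sum>i\<in>{..k}-{J}. r i / r J)" using r by (intro sum_nonneg) (simp add: less_imp_le)
      \<comment> \<open>The Laplace transform at a is 1 / (1 + a); the leading 1 supplies the share
        of \<open>J\<close> itself in the total rate.\<close>
      have "1 + (\<Sum>i\<in>{..k}-{J}. r i / r J) = (\<Sum>i\<le>k. r i / r J)"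
        using J r[of J] by (subst (2) sum.remove[of _ J]) simp_all
      also have "\<dots> = (\<Sum>i\<le>k. r i) / r J" by (simp add: sum_divide_distrib)
      finally show ?thesis unfolding c_def exp_law_laplace[OF nn] by simp
    qed
    also have "(\<Prod>t\<in>I'. emeasure exp_law (A' t)) = (\<Prod>t\<in>I. emeasure exp_law (A t))"
    proof -
      have "(\<Prod>t\<in>I'. emeasure exp_law (A' t)) = (\<Prod>t\<in>I. emeasure exp_law (A' t))"
        using I' E.emeasure_space_1 by (intro prod.mono_neutral_right) (auto simp: I'_def A'_def)
      then show ?thesis by (simp add: A'_def)
    qed
    finally show "emeasure P1 (prod_emb UNIV (\<lambda>_. exp_law) I (Pi\<^sub>E I A)) = emeasure P2 (prod_emb UNIV (\<lambda>_. exp_law) I (Pi\<^sub>E I A))"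
      unfolding R_def[symmetric] P2_def by (simp add: ER)
  qed
  then show ?thesis using P1_eq[OF B] B unfolding P2_def cond_def c_def by simp
qed

text \<open>The clocks still to run after \<open>k\<close> births, renumbered to start at \<open>0\<close>: the unused ones, and the
  remainders of the running ones, rescaled to rate 1.\<close>

definition residual :: "(nat \<times> nat \<Rightarrow> real) \<Rightarrow> (nat \<Rightarrow> nat) \<Rightarrow> nat \<Rightarrow> (nat \<times> nat \<Rightarrow> real) \<Rightarrow> nat \<times> nat \<Rightarrow> real" where
  "residual f p k e = (\<lambda>(j, d). if d = 0 \<and> j \<le> k
     then f (j, outdeg p k j) * (next_birth p (\<lambda>i. e i / f i) k j - birth_time p (\<lambda>i. e i / f i) k)
     else e (j, outdeg p k j + d))"

text \<open>The conditional probability, given the weights \<open>f\<close>, that the first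
  \<open>k\<close> attachments follow \<open>p\<close>.\<close>

definition path_weight :: "(nat \<times> nat \<Rightarrow> real) \<Rightarrow> (nat \<Rightarrow> nat) \<Rightarrow> nat \<Rightarrow> real" where
  "path_weight f p k = (\<Prod>i<k. f (p (Suc i), outdeg p i (p (Suc i))) / (\<Sum>j\<le>i. f (j, outdeg p i j)))"

lemma residual_0: "f (0, 0) \<noteq> 0 \<Longrightarrow> residual f p 0 e = e"
  by (auto simp: residual_def fun_eq_iff next_birth_def arrival_def)

text \<open>A birth acts on the remaining clocks as one race whose rates are the current weights of
  the nodes present. This reduces the whole path to repeated use of
  \<open>clock_step_law\<close>.\<close>

lemma residual_Suc:
  assumes f: "\<And>i. 0 < f i" and p: "\<And>i. p (Suc i) \<le> i"
  shows "residual f p (Suc k) e = clock_step (\<lambda>j. f (j, outdeg p k j)) k (p (Suc k)) (residual f p k e)"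
proof -
  define J where "J = p (Suc k)"
  let ?x = "\<lambda>i. e i / f i"
  have J: "J \<le> k" using p by (simp add: J_def)
  have f0: "f i \<noteq> 0" for i using f[of i] by simp
  have bt: "birth_time p ?x (Suc k) = next_birth p ?x k J"
    using J by (simp add: J_def next_birth_def arrival_def lessThan_Suc_atMost)
  have o: "outdeg p n j = 0" if "n \<le> j" for n j using outdeg_eq_0[OF p that] .
  have "residual f p (Suc k) e (j, d) = clock_step (\<lambda>j. f (j, outdeg p k j)) k J (residual f p k e) (j, d)" for j d
  proof -
    \<comment> \<open>In order: the next clock of the parent and its later ones, later and running
      clocks of the other nodes, the first clock of the newborn, and nodes not yet born.\<close>
    consider "j = J" "d = 0" | "j = J" "d > 0" | "j \<noteq> J" "d > 0" | "j \<noteq> J" "d = 0" "j \<le> k"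
      | "j = Suc k" "d = 0" | "j > Suc k" by linarith
    then show ?thesis
    proof cases
      case 1
      have "next_birth p ?x (Suc k) J - next_birth p ?x k J = ?x (J, Suc (outdeg p k J))"
        unfolding next_birth_def arrival_def outdeg_Suc J_def[symmetric] by simp
      then show ?thesis using 1 J f0 unfolding residual_def clock_step_def
        by (simp add: bt outdeg_Suc J_def[symmetric] del: birth_time.simps)
    next
      case 2
      then show ?thesis using J unfolding residual_def clock_step_def
        by (simp add: outdeg_Suc J_def[symmetric])
    next
      case 3
      then show ?thesis unfolding residual_def clock_step_def
        by (simp add: outdeg_Suc J_def[symmetric])
    next
      case 4
      have "next_birth p ?x (Suc k) j = next_birth p ?x k j"
        using 4 unfolding next_birth_def outdeg_Suc J_def[symmetric] by simp
      then show ?thesis using 4 J f0[of "(J, outdeg p k J)"] unfolding residual_def clock_step_def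
        by (simp add: bt outdeg_Suc J_def[symmetric] right_diff_distrib diff_divide_distrib del: birth_time.simps)
    next
      case 5
      have "next_birth p ?x (Suc k) (Suc k) - birth_time p ?x (Suc k) = ?x (Suc k, 0)"
        unfolding next_birth_def arrival_def o[OF order_refl] by simp
      then show ?thesis using 5 J f0[of "(Suc k, 0)"] o[of k "Suc k"] o[of "Suc k" "Suc k"]
        unfolding residual_def clock_step_def by (simp del: birth_time.simps)
    next
      case 6
      then show ?thesis using J o[of k j] o[of "Suc k" j] unfolding residual_def clock_step_def by simp
    qed
  qed
  then show ?thesis by (auto simp: J_def)
qed

section \<open>The probability of a given path\<close>

lemma measurable_birth_time [measurable]:
  assumes [measurable]: "\<And>i. (\<lambda>w. x w i) \<in> borel_measurable M"
  shows "(\<lambda>w. birth_time p (x w) k) \<in> borel_measurable M"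
proof (induction k rule: less_induct)
  case (less k)
  show ?case
  proof (cases k)
    case (Suc m)
    show ?thesis
    proof (cases "p (Suc m) \<le> m")
      case True
      then have [measurable]: "(\<lambda>w. birth_time p (x w) (p (Suc m))) \<in> borel_measurable M"
        using less Suc by simp
      show ?thesis using Suc True by simp
    qed (simp add: Suc)
  qed simp
qed

lemma measurable_next_birth [measurable]:
  assumes [measurable]: "\<And>i. (\<lambda>w. x w i) \<in> borel_measurable M"
  shows "(\<lambda>w. next_birth p (x w) k j) \<in> borel_measurable M"
  unfolding next_birth_def arrival_def by measurable

definition follows :: "(nat \<times> nat \<Rightarrow> real) \<Rightarrow> (nat \<Rightarrow> nat) \<Rightarrow> nat \<Rightarrow> bool" where
  "follows x p k \<longleftrightarrow> (\<forall>i\<in>{1..k}. clock_tree x i = p i)"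

text \<open>On the event that the tree has followed \<open>p\<close> so far, the next race can be
  evaluated with the fixed \<open>p\<close> in place of the random tree.\<close>

lemma follows_Suc:
  "follows x p (Suc k) \<longleftrightarrow> follows x p k \<and> first_argmin k (next_birth p x k) = p (Suc k)"
proof -
  have "first_argmin k (next_birth (clock_tree x) x k) = first_argmin k (next_birth p x k)" if "follows x p k"
    using that unfolding follows_def by (intro first_argmin_cong next_birth_cong) auto
  moreover have "follows x p (Suc k) \<longleftrightarrow> follows x p k \<and> clock_tree x (Suc k) = p (Suc k)"
    unfolding follows_def by (auto simp: le_Suc_eq)
  ultimately show ?thesis by (auto simp: clock_tree_Suc)
qed

lemma pred_follows [measurable]:
  assumes [measurable]: "\<And>i. (\<lambda>w. x w i) \<in> borel_measurable M"
  shows "Measurable.pred M (\<lambda>w. follows (x w) p k)"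
proof (induction k)
  case 0
  then show ?case by (simp add: follows_def)
next
  case (Suc k)
  note [measurable] = Suc
  show ?case unfolding follows_Suc by measurable
qed

lemma first_argmin_shift: "first_argmin k (\<lambda>j. g j - c) = first_argmin k g" for c :: real
  by (simp add: first_argmin_def)

text \<open>This is the Markov property at the k-th birth: on the event that the path is
  \<open>p\<close>, the residual clocks are fresh. They are carried along because the next step of
  the path is an event in terms of them.\<close>

lemma emeasure_follows_residual:
  assumes f: "\<And>i. 0 < f i" and p: "\<And>i. p (Suc i) \<le> i"
  shows "B \<in> sets exp_clocks \<Longrightarrow>
    emeasure exp_clocks {e \<in> space exp_clocks. follows (\<lambda>i. e i / f i) p k \<and> residual f p k e \<in> B}
    = ennreal (path_weight f p k) * emeasure exp_clocks B"
proof (induction k arbitrary: B)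
  case 0
  have "{e \<in> space exp_clocks. e \<in> B} = B" using sets.sets_into_space[OF 0] by auto
  then show ?case using f[of "(0,0)"] by (simp add: follows_def residual_0 path_weight_def)
next
  case (Suc k)
  let ?x = "\<lambda>e i. e i / f i"
  define r where "r j = f (j, outdeg p k j)" for j
  define J where "J = p (Suc k)"
  have r: "0 < r i" for i using f by (simp add: r_def)
  define B' where "B' = {g \<in> space exp_clocks. first_argmin k (\<lambda>i. g (i, 0) / r i) = J \<and> clock_step r k J g \<in> B}"
  note Suc.prems[measurable]
  have B': "B' \<in> sets exp_clocks"
    unfolding B'_def by measurable
  have eq: "follows (?x e) p (Suc k) \<and> residual f p (Suc k) e \<in> B \<longleftrightarrow> follows (?x e) p k \<and> residual f p k e \<in> B'" for e
  proof -
    \<comment> \<open>Dividing by the rate turns a rescaled residual clock back into remaining time,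
      and subtracting the common birth time does not change the winner.\<close>
    have "first_argmin k (\<lambda>i. residual f p k e (i, 0) / r i) = first_argmin k (\<lambda>i. next_birth p (?x e) k i - birth_time p (?x e) k)"
      by (rule first_argmin_cong) (use r in \<open>auto simp: residual_def r_def less_imp_neq[symmetric]\<close>)
    then have "first_argmin k (\<lambda>i. residual f p k e (i, 0) / r i) = first_argmin k (next_birth p (?x e) k)"
      by (simp add: first_argmin_shift)
    then show ?thesis unfolding follows_Suc B'_def residual_Suc[OF f p] r_def J_def
      by (auto simp: space_PiM)
  qed
  have "emeasure exp_clocks {e \<in> space exp_clocks. follows (?x e) p (Suc k) \<and> residual f p (Suc k) e \<in> B}
     = ennreal (path_weight f p k) * emeasure exp_clocks B'"
    unfolding eq by (rule Suc.IH[OF B'])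
  also have "emeasure exp_clocks B' = ennreal (r J / (\<Sum>i\<le>k. r i)) * emeasure exp_clocks B"
    unfolding B'_def using p by (intro clock_step_law r Suc.prems) (simp add: J_def)
  also have "ennreal (path_weight f p k) * (ennreal (r J / (\<Sum>i\<le>k. r i)) * emeasure exp_clocks B) =
     ennreal (path_weight f p k * (r J / (\<Sum>i\<le>k. r i))) * emeasure exp_clocks B"
  proof -
    have "0 \<le> path_weight f p k" unfolding path_weight_def using f
      by (intro prod_nonneg ballI divide_nonneg_nonneg sum_nonneg) (auto intro: less_imp_le)
    moreover have "0 \<le> r J / (\<Sum>i\<le>k. r i)" using r
      by (intro divide_nonneg_nonneg sum_nonneg) (auto intro: less_imp_le)
    ultimately show ?thesis by (simp only: ennreal_mult mult.assoc)
  qed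
  also have "path_weight f p k * (r J / (\<Sum>i\<le>k. r i)) = path_weight f p (Suc k)"
    by (simp add: path_weight_def r_def J_def)
  finally show ?case .
qed

lemma emeasure_follows:
  assumes f: "\<And>i. 0 < f i" and p: "\<And>i. p (Suc i) \<le> i"
  shows "emeasure exp_clocks {e \<in> space exp_clocks. follows (\<lambda>i. e i / f i) p k} = ennreal (path_weight f p k)"
proof -
  interpret C: prob_space exp_clocks by (rule prob_space_exp_clocks)
  show ?thesis using emeasure_follows_residual[OF f p sets.top, where k=k] C.emeasure_space_1
    by (simp add: space_PiM)
qed

section \<open>The law of the attachment tree\<close>

abbreviation tree_space :: "(nat \<Rightarrow> nat) measure" where
  "tree_space \<equiv> PiM UNIV (\<lambda>_. count_space UNIV)"

definition recursive_trees :: "(nat \<Rightarrow> nat) set" where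
  "recursive_trees = {q. q 0 = 0 \<and> (\<forall>i. q (Suc i) \<le> i)}"

definition tree_prefixes :: "nat \<Rightarrow> (nat \<Rightarrow> nat) set" where
  "tree_prefixes k = {q \<in> recursive_trees. \<forall>i>k. q i = 0}"

definition truncate_tree :: "nat \<Rightarrow> (nat \<Rightarrow> nat) \<Rightarrow> nat \<Rightarrow> nat" where
  "truncate_tree k q i = (if i \<le> k then q i else 0)"

lemma finite_tree_prefixes: "finite (tree_prefixes k)"
proof (rule finite_subset)
  show "tree_prefixes k \<subseteq> {f. \<forall>i. (i \<in> {..k} \<longrightarrow> f i \<in> {..k}) \<and> (i \<notin> {..k} \<longrightarrow> f i = 0)}"
  proof (intro subsetI CollectI allI conjI impI)
    fix q i assume q: "q \<in> tree_prefixes k" and "i \<in> {..k}"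
    then show "q i \<in> {..k}"
      by (cases i) (auto simp: tree_prefixes_def recursive_trees_def intro: order_trans Suc_leD)
  qed (auto simp: tree_prefixes_def)
  show "finite {f. \<forall>i. (i \<in> {..k} \<longrightarrow> f i \<in> {..k}) \<and> (i \<notin> {..k} \<longrightarrow> f i = (0::nat))}"
    by (rule finite_set_of_finite_funs) auto
qed

lemma truncate_tree_prefix: "q \<in> recursive_trees \<Longrightarrow> truncate_tree k q \<in> tree_prefixes k"
  by (auto simp: tree_prefixes_def truncate_tree_def recursive_trees_def)

lemma clock_tree_recursive: "clock_tree x \<in> recursive_trees"
  by (auto simp: recursive_trees_def clock_tree_0 clock_tree_Suc_le)

text \<open>A quantity that depends on the random tree through its first \<open>k\<close> parents is
  split over the finitely many prefixes; on each of them the tree is frozen to \<open>p\<close> and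
  only \<open>G p\<close> has to be measurable.\<close>

lemma measurable_clock_tree_prefix:
  assumes x: "\<And>i. (\<lambda>w. x w i) \<in> borel_measurable M"
    and G: "\<And>p. G p \<in> measurable M N"
    and eq: "\<And>w p. follows (x w) p k \<Longrightarrow> G (clock_tree (x w)) w = G p w"
  shows "(\<lambda>w. G (clock_tree (x w)) w) \<in> measurable M N"
proof (rule measurableI)
  fix w assume "w \<in> space M"
  then show "G (clock_tree (x w)) w \<in> space N" using G[of "clock_tree (x w)"] by (rule measurable_space[rotated])
next
  fix A assume A: "A \<in> sets N"
  have "(\<lambda>w. G (clock_tree (x w)) w) -` A \<inter> space M
     = (\<Union>p\<in>tree_prefixes k. {w \<in> space M. follows (x w) p k} \<inter> (G p -` A \<inter> space M))"
  proof safe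
    fix w assume w: "w \<in> space M" "G (clock_tree (x w)) w \<in> A"
    have "follows (x w) (truncate_tree k (clock_tree (x w))) k"
      by (simp add: follows_def truncate_tree_def)
    then show "w \<in> (\<Union>p\<in>tree_prefixes k. {w \<in> space M. follows (x w) p k} \<inter> (G p -` A \<inter> space M))"
      using w eq[of w "truncate_tree k (clock_tree (x w))"] truncate_tree_prefix[OF clock_tree_recursive, of k "x w"]
      by auto
  qed (auto simp: eq)
  also have "\<dots> \<in> sets M"
  proof (rule sets.finite_UN[OF finite_tree_prefixes])
    fix p
    have "{w \<in> space M. follows (x w) p k} \<in> sets M" using pred_follows[OF x] by (simp add: pred_def)
    moreover have "G p -` A \<inter> space M \<in> sets M" using G A by (rule measurable_sets)
    ultimately show "{w \<in> space M. follows (x w) p k} \<inter> (G p -` A \<inter> space M) \<in> sets M" by (rule sets.Int)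
  qed
  finally show "(\<lambda>w. G (clock_tree (x w)) w) -` A \<inter> space M \<in> sets M" .
qed

lemma measurable_clock_tree [measurable]:
  assumes x: "\<And>i. (\<lambda>w. x w i) \<in> borel_measurable M"
  shows "(\<lambda>w. clock_tree (x w)) \<in> measurable M tree_space"
proof (rule measurable_PiM_single')
  fix i
  show "(\<lambda>w. clock_tree (x w) i) \<in> measurable M (count_space UNIV)"
    by (rule measurable_clock_tree_prefix[OF x, where G="\<lambda>p w. if i = 0 then 0 else p i" and k=i,
        THEN measurable_cong[THEN iffD1, rotated]])
       (auto simp: follows_def clock_tree_0)
qed (auto simp: space_PiM)

lemma measurable_birth [measurable]:
  assumes x: "\<And>i. (\<lambda>w. x w i) \<in> borel_measurable M"
  shows "(\<lambda>w. birth (x w) k) \<in> borel_measurable M"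
  unfolding birth_def
  by (rule measurable_clock_tree_prefix[OF x, where G="\<lambda>p w. birth_time p (x w) k" and k=k])
     (auto intro!: measurable_birth_time x birth_time_cong simp: follows_def)

lemma measurable_deg [measurable]:
  assumes x: "\<And>i. (\<lambda>w. x w i) \<in> borel_measurable M"
  shows "(\<lambda>w. deg (x w) k j) \<in> measurable M (count_space UNIV)"
  unfolding deg_def
  by (rule measurable_clock_tree_prefix[OF x, where G="\<lambda>p w. outdeg p k j" and k=k])
     (auto intro!: outdeg_cong simp: follows_def)

lemma pred_outdeg_eq [measurable]: "Measurable.pred tree_space (\<lambda>q. outdeg q n u = m)"
proof (induction n arbitrary: m)
  case (Suc n)
  have "outdeg q (Suc n) u = m \<longleftrightarrow>
     (q (Suc n) = u \<and> m > 0 \<and> outdeg q n u = m - 1) \<or> (q (Suc n) \<noteq> u \<and> outdeg q n u = m)" for q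
    by (auto simp: outdeg_Suc)
  moreover note [measurable] = Suc
  ultimately show ?case by simp
qed simp

lemma pred_persistent_hub [measurable]: "Measurable.pred tree_space (\<lambda>q. persistent_hub q u)"
proof -
  \<comment> \<open>The maximum is unfolded into finite quantifiers over possible degrees, so that
    only events of the form \<open>outdeg q n u = m\<close> remain.\<close>
  have "u \<le> n \<and> outdeg q n u = Max (outdeg q n ` {0..n}) \<longleftrightarrow>
        u \<le> n \<and> (\<forall>v\<in>{..n}. \<exists>b\<in>{..n}. \<exists>a\<in>{..b}. outdeg q n v = a \<and> outdeg q n u = b)" for q n
  proof -
    have "outdeg q n u = Max (outdeg q n ` {0..n}) \<longleftrightarrow> (\<forall>v\<le>n. outdeg q n v \<le> outdeg q n u)" if "u \<le> n"
      using that by (auto intro!: Max_eqI[symmetric] simp: Max_ge)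
    then show ?thesis using outdeg_le[of q n u] by auto
  qed
  then have eq: "persistent_hub q u \<longleftrightarrow> (\<exists>N. \<forall>n\<in>{N..}. u \<le> n \<and> (\<forall>v\<in>{..n}. \<exists>b\<in>{..n}. \<exists>a\<in>{..b}. outdeg q n v = a \<and> outdeg q n u = b))" for q
    unfolding persistent_hub_def eventually_sequentially by (simp only: Ball_def atLeast_iff)
  show ?thesis unfolding eq by measurable
qed

lemma pred_unique_persistent_hub [measurable]: "Measurable.pred tree_space (\<lambda>q. unique_persistent_hub q u)"
  unfolding unique_persistent_hub_def by measurable

lemma cylinder_measurable: "{q. \<forall>i\<in>{1..k}. q i = p i} \<in> sets tree_space"
proof -
  have "{q \<in> space tree_space. \<forall>i\<in>{1..k}. q i = p i} \<in> sets tree_space" by measurable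
  then show ?thesis by (simp add: space_PiM)
qed

text \<open>Almost every tree has finitely many possible prefixes of each length, so a
  finite-dimensional event is, up to a null set, a finite disjoint union of prefix cylinders. Entry
  0 is fixed to 0 and is therefore absent from the cylinders.\<close>

lemma tree_law_eqI:
  assumes mu: "prob_space mu" "sets mu = sets tree_space" "AE q in mu. q \<in> recursive_trees"
    and nu: "prob_space nu" "sets nu = sets tree_space" "AE q in nu. q \<in> recursive_trees"
    and eq: "\<And>p k. p \<in> recursive_trees \<Longrightarrow> emeasure mu {q. \<forall>i\<in>{1..k}. q i = p i} = emeasure nu {q. \<forall>i\<in>{1..k}. q i = p i}"
  shows "mu = nu"
proof -
  note cyl = cylinder_measurable
  have decomp: "emeasure la R = (\<Sum>p\<in>tree_prefixes k \<inter> R. emeasure la {q. \<forall>i\<in>{1..k}. q i = p i})"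
    if la: "prob_space la" "sets la = sets tree_space" "AE q in la. q \<in> recursive_trees"
      and R: "R \<in> sets tree_space" "\<And>q q'. (\<And>i. i \<le> k \<Longrightarrow> q i = q' i) \<Longrightarrow> q \<in> R \<Longrightarrow> q' \<in> R"
    for la R k
  proof -
    have m: "(\<Union>p\<in>tree_prefixes k \<inter> R. {q. \<forall>i\<in>{1..k}. q i = p i}) \<in> sets la"
      unfolding la(2) using finite_tree_prefixes[of k] cyl by (intro sets.finite_UN) auto
    have "emeasure la R = emeasure la (\<Union>p\<in>tree_prefixes k \<inter> R. {q. \<forall>i\<in>{1..k}. q i = p i})"
    proof (rule emeasure_eq_AE)
      show "AE q in la. q \<in> R \<longleftrightarrow> q \<in> (\<Union>p\<in>tree_prefixes k \<inter> R. {q. \<forall>i\<in>{1..k}. q i = p i})"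
        using la(3)
      proof eventually_elim
        case (elim q)
        have 1: "truncate_tree k q \<in> R" if "q \<in> R"
          by (rule R(2)[OF _ that]) (simp add: truncate_tree_def)
        have "\<forall>i\<in>{1..k}. q i = truncate_tree k q i" by (simp add: truncate_tree_def)
        then have "q \<in> (\<Union>p\<in>tree_prefixes k \<inter> R. {q. \<forall>i\<in>{1..k}. q i = p i})" if "q \<in> R"
          using 1[OF that] truncate_tree_prefix[OF elim, of k] by blast
        moreover have "q \<in> R" if p: "p \<in> tree_prefixes k" "p \<in> R" "\<forall>i\<in>{1..k}. q i = p i" for p
        proof (rule R(2)[OF _ p(2)])
          fix i assume "i \<le> k"
          then show "p i = q i" using p elim
            by (cases i) (auto simp: tree_prefixes_def recursive_trees_def)
        qed
        ultimately show ?case by blast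
      qed
    qed (use m R la in auto)
    also have "\<dots> = (\<Sum>p\<in>tree_prefixes k \<inter> R. emeasure la {q. \<forall>i\<in>{1..k}. q i = p i})"
    proof (rule sum_emeasure[symmetric])
      show "disjoint_family_on (\<lambda>p. {q. \<forall>i\<in>{1..k}. q i = p i}) (tree_prefixes k \<inter> R)"
        unfolding disjoint_family_on_def
      proof (intro ballI impI, rule ccontr)
        fix p p' assume p: "p \<in> tree_prefixes k \<inter> R" "p' \<in> tree_prefixes k \<inter> R" "p \<noteq> p'"
          and "{q. \<forall>i\<in>{1..k}. q i = p i} \<inter> {q. \<forall>i\<in>{1..k}. q i = p' i} \<noteq> {}"
        then have "p i = p' i" if "i \<in> {1..k}" for i using that by auto
        then have "p i = p' i" for i
          using p by (cases "i = 0"; cases "i \<le> k") (auto simp: tree_prefixes_def recursive_trees_def)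
        then show False using p(3) by auto
      qed
    qed (use finite_tree_prefixes[of k] cyl la in auto)
    finally show ?thesis .
  qed
  show ?thesis
  proof (rule measure_eqI_PiM_infinite[where M="\<lambda>_. count_space UNIV" and I=UNIV])
    show "finite_measure mu" using mu(1) by (rule prob_space.finite_measure)
    fix A :: "nat \<Rightarrow> nat set" and J :: "nat set"
    assume J: "finite J" "J \<subseteq> UNIV" "\<And>i. i \<in> J \<Longrightarrow> A i \<in> sets (count_space UNIV)"
    obtain k where k: "J \<subseteq> {..k}" using J(1) finite_nat_iff_bounded_le by blast
    define R where "R = prod_emb UNIV (\<lambda>_. count_space UNIV) J (Pi\<^sub>E J A)"
    have R: "R \<in> sets tree_space" unfolding R_def using J by (intro sets_PiM_I) auto
    have R_iff: "g \<in> R \<longleftrightarrow> (\<forall>i\<in>J. g i \<in> A i)" for g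
      unfolding R_def by (auto simp: prod_emb_def space_PiM PiE_iff)
    have R': "q' \<in> R" if "\<And>i. i \<le> k \<Longrightarrow> q i = q' i" "q \<in> R" for q q'
      using that k unfolding R_iff by (metis subsetD atMost_iff)
    have "emeasure mu R = (\<Sum>p\<in>tree_prefixes k \<inter> R. emeasure mu {q. \<forall>i\<in>{1..k}. q i = p i})"
      by (rule decomp[OF mu R R'])
    also have "\<dots> = (\<Sum>p\<in>tree_prefixes k \<inter> R. emeasure nu {q. \<forall>i\<in>{1..k}. q i = p i})"
      by (intro sum.cong eq) (auto simp: tree_prefixes_def)
    also have "\<dots> = emeasure nu R" by (rule decomp[OF nu R R', symmetric])
    finally show "emeasure mu (prod_emb UNIV (\<lambda>_. count_space UNIV) J (Pi\<^sub>E J A)) =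
      emeasure nu (prod_emb UNIV (\<lambda>_. count_space UNIV) J (Pi\<^sub>E J A))" unfolding R_def .
  qed (use mu nu in auto)
qed


section \<open>The attachment process and its representation by clocks\<close>

definition weights :: "(nat \<Rightarrow> nat \<Rightarrow> 'a \<Rightarrow> real) \<Rightarrow> 'a \<Rightarrow> nat \<times> nat \<Rightarrow> real" where
  "weights F w = (\<lambda>(j, d). F j d w)"

definition clock_space :: "'a measure \<Rightarrow> ('a \<times> (nat \<times> nat \<Rightarrow> real)) measure" where
  "clock_space M = M \<Otimes>\<^sub>M exp_clocks"

definition clock :: "(nat \<Rightarrow> nat \<Rightarrow> 'a \<Rightarrow> real) \<Rightarrow> 'a \<times> (nat \<times> nat \<Rightarrow> real) \<Rightarrow> nat \<times> nat \<Rightarrow> real" where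
  "clock F = (\<lambda>(w, e) i. e i / weights F w i)"

locale gpa_process =
  fixes M :: "'a measure" and F :: "nat \<Rightarrow> nat \<Rightarrow> 'a \<Rightarrow> real" and P :: "nat \<Rightarrow> 'a \<Rightarrow> nat"
  assumes gpa: "gpa_tree M F P"
begin

lemma gpa_prob_space: "prob_space M"
  using gpa by (simp add: gpa_tree_def)

lemma gpa_measurable [measurable]:
  "F j d \<in> borel_measurable M" "P i \<in> measurable M (count_space UNIV)"
  using gpa by (auto simp: gpa_tree_def)

lemma gpa_pos: "AE w in M. \<forall>i. 0 < weights F w i"
  using gpa by (simp add: gpa_tree_def weights_def split_paired_all AE_all_countable)

lemma measurable_weights_component [measurable]: "(\<lambda>w. weights F w i) \<in> borel_measurable M"
  by (cases i) (simp add: weights_def)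

lemma measurable_weights [measurable]: "weights F \<in> measurable M (PiM UNIV (\<lambda>_. borel))"
  by (rule measurable_PiM_single') (auto simp: space_PiM)

lemma measurable_gpa_outdeg [measurable]: "(\<lambda>w. outdeg (\<lambda>i. P i w) k j) \<in> measurable M (count_space UNIV)"
proof -
  have "(\<lambda>w i. P i w) \<in> measurable M tree_space"
    by (rule measurable_PiM_single') (auto simp: space_PiM)
  from measurable_compose[OF this] pred_outdeg_eq
  have [measurable]: "Measurable.pred M (\<lambda>w. outdeg (\<lambda>i. P i w) k j = m)" for m by blast
  show ?thesis
  proof (rule measurable_count_space_eq2_countable[THEN iffD2])
    show "(\<lambda>w. outdeg (\<lambda>i. P i w) k j) \<in> space M \<rightarrow> UNIV \<and>
      (\<forall>a\<in>UNIV. (\<lambda>w. outdeg (\<lambda>i. P i w) k j) -` {a} \<inter> space M \<in> sets M)"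
    proof (intro conjI ballI)
      fix a
      have "(\<lambda>w. outdeg (\<lambda>i. P i w) k j) -` {a} \<inter> space M = {w \<in> space M. outdeg (\<lambda>i. P i w) k j = a}" by auto
      also have "\<dots> \<in> sets M" by measurable
      finally show "(\<lambda>w. outdeg (\<lambda>i. P i w) k j) -` {a} \<inter> space M \<in> sets M" .
    qed simp
  qed
qed

lemma measurable_gpa_weight [measurable]: "(\<lambda>w. F j (outdeg (\<lambda>i. P i w) k j) w) \<in> borel_measurable M"
  by (rule measurable_compose_countable[OF _ measurable_gpa_outdeg]) simp

lemma measurable_gpa_Z [measurable]: "gpa_Z F P k \<in> borel_measurable M"
  unfolding gpa_Z_def by measurable

lemma gpa_step:
  assumes "j \<le> k" "B \<in> sets gpa_hist_space"
  shows "emeasure M {w \<in> space M. gpa_hist F P k w \<in> B \<and> P (Suc k) w = j} =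
    (\<integral>\<^sup>+w. indicator {w \<in> space M. gpa_hist F P k w \<in> B} w *
       ennreal (F j (outdeg (\<lambda>i. P i w) k j) w / gpa_Z F P k w) \<partial>M)"
proof -
  interpret prob_space M by (rule gpa_prob_space)
  let ?C = "{w \<in> space M. gpa_hist F P k w \<in> B}"
  let ?f = "\<lambda>w. indicator ?C w * (F j (outdeg (\<lambda>i. P i w) k j) w / gpa_Z F P k w)"
  have pos: "AE w in M. 0 \<le> ?f w \<and> ?f w \<le> 1"
    using gpa_pos
  proof eventually_elim
    case (elim w)
    then have F0: "0 < F j d w" for j d by (auto simp: weights_def)
    have "F j (outdeg (\<lambda>i. P i w) k j) w \<le> gpa_Z F P k w"
      unfolding gpa_Z_def using F0 assms(1) by (intro member_le_sum) (auto intro: less_imp_le)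
    moreover have "0 < F j (outdeg (\<lambda>i. P i w) k j) w" by (rule F0)
    ultimately show ?case by (auto simp: indicator_def divide_simps)
  qed
  have hist[measurable]: "gpa_hist F P k \<in> measurable M gpa_hist_space"
    unfolding gpa_hist_def gpa_hist_space_def weights_def[symmetric]
    by (intro measurable_Pair measurable_weights measurable_PiM_single') (auto simp: space_PiM)
  note assms(2)[measurable]
  have m: "?f \<in> borel_measurable M" by measurable
  have "emeasure M {w \<in> space M. gpa_hist F P k w \<in> B \<and> P (Suc k) w = j} =
      ennreal (measure M {w \<in> space M. gpa_hist F P k w \<in> B \<and> P (Suc k) w = j})"
    by (rule emeasure_eq_measure)
  also have "\<dots> = ennreal (\<integral>w. ?f w \<partial>M)"
  proof (rule arg_cong[where f=ennreal])
    show "measure M {w \<in> space M. gpa_hist F P k w \<in> B \<and> P (Suc k) w = j} = (\<integral>w. ?f w \<partial>M)"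
      using gpa assms unfolding gpa_tree_def by (elim conjE) blast
  qed
  also have "\<dots> = (\<integral>\<^sup>+w. ennreal (?f w) \<partial>M)"
  proof (rule nn_integral_eq_integral[symmetric])
    show "integrable M ?f"
      by (rule integrable_const_bound[where B=1]) (use m pos in \<open>auto elim: eventually_mono\<close>)
    show "AE w in M. 0 \<le> ?f w" using pos by eventually_elim simp
  qed
  also have "\<dots> = (\<integral>\<^sup>+w. indicator ?C w * ennreal (F j (outdeg (\<lambda>i. P i w) k j) w / gpa_Z F P k w) \<partial>M)"
    by (intro nn_integral_cong) (simp add: indicator_def)
  finally show ?thesis .
qed

text \<open>\<open>gpa_tree\<close> prescribes the probabilities of attaching to
  \<open>j \<le> k\<close>; they sum to 1, which leaves probability 0 for every other value.\<close>

lemma AE_gpa_recursive: "AE w in M. \<forall>k. P (Suc k) w \<le> k"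
  unfolding AE_all_countable
proof
  fix k
  interpret prob_space M by (rule gpa_prob_space)
  have top: "space gpa_hist_space \<in> sets gpa_hist_space" by simp
  have in_space: "gpa_hist F P k w \<in> space gpa_hist_space" for w
    by (simp add: gpa_hist_space_def space_pair_measure space_PiM gpa_hist_def)
  let ?f = "\<lambda>j w. F j (outdeg (\<lambda>i. P i w) k j) w / gpa_Z F P k w"
  have "emeasure M {w \<in> space M. P (Suc k) w \<le> k} = emeasure M (\<Union>j\<in>{..k}. {w \<in> space M. P (Suc k) w = j})"
    by (rule arg_cong[where f="emeasure M"]) auto
  also have "\<dots> = (\<Sum>j\<le>k. emeasure M {w \<in> space M. P (Suc k) w = j})"
    by (rule sum_emeasure[symmetric]) (auto simp: disjoint_family_on_def)
  also have "\<dots> = (\<Sum>j\<le>k. \<integral>\<^sup>+w. ennreal (?f j w) \<partial>M)"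
  proof (intro sum.cong refl)
    fix j assume "j \<in> {..k}"
    show "emeasure M {w \<in> space M. P (Suc k) w = j} = (\<integral>\<^sup>+w. ennreal (?f j w) \<partial>M)"
    proof -
      have "(\<integral>\<^sup>+w. indicator {w \<in> space M. gpa_hist F P k w \<in> space gpa_hist_space} w * ennreal (?f j w) \<partial>M)
          = (\<integral>\<^sup>+w. ennreal (?f j w) \<partial>M)"
        by (rule nn_integral_cong) (simp add: in_space)
      then show ?thesis using gpa_step[OF _ top, of j k] \<open>j \<in> {..k}\<close> by (simp add: in_space)
    qed
  qed
  also have "\<dots> = (\<integral>\<^sup>+w. (\<Sum>j\<le>k. ennreal (?f j w)) \<partial>M)"
    by (rule nn_integral_sum[symmetric]) simp
  also have "\<dots> = (\<integral>\<^sup>+w. 1 \<partial>M)"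
  proof (rule nn_integral_cong_AE)
    show "AE w in M. (\<Sum>j\<le>k. ennreal (?f j w)) = 1"
      using gpa_pos
    proof eventually_elim
      case (elim w)
      then have F0: "0 < F j d w" for j d by (auto simp: weights_def)
      have Z: "0 < gpa_Z F P k w" unfolding gpa_Z_def using F0 by (intro sum_pos) auto
      have "(\<Sum>j\<le>k. ennreal (?f j w)) = ennreal (\<Sum>j\<le>k. ?f j w)"
        using F0 Z by (intro sum_ennreal) (auto intro!: divide_nonneg_nonneg less_imp_le)
      also have "(\<Sum>j\<le>k. ?f j w) = 1" using Z by (simp add: sum_divide_distrib[symmetric] gpa_Z_def)
      finally show ?case by simp
    qed
  qed
  also have "\<dots> = 1" by (simp add: emeasure_space_1)
  finally have "prob {w \<in> space M. P (Suc k) w \<le> k} = 1" by (simp add: emeasure_eq_measure)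
  then show "AE w in M. P (Suc k) w \<le> k" by (subst (asm) prob_Collect_eq_1) simp_all
qed

text \<open>The weight event \<open>B\<close> is carried along because the next attachment
  probability is itself a function of the weights and has to be integrated jointly with the past
  path.\<close>

lemma gpa_path_law:
  assumes p: "\<And>i. p (Suc i) \<le> i"
  shows "B \<in> sets (PiM UNIV (\<lambda>_. borel)) \<Longrightarrow>
    emeasure M {w \<in> space M. (\<forall>i\<in>{1..k}. P i w = p i) \<and> weights F w \<in> B} =
    (\<integral>\<^sup>+w. ennreal (path_weight (weights F w) p k) * indicator B (weights F w) \<partial>M)"
proof (induction k arbitrary: B)
  case 0
  note [measurable] = 0
  have "(\<integral>\<^sup>+w. ennreal (path_weight (weights F w) p 0) * indicator B (weights F w) \<partial>M) =
     (\<integral>\<^sup>+w. indicator {w \<in> space M. weights F w \<in> B} w \<partial>M)"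
    by (intro nn_integral_cong) (simp add: path_weight_def indicator_def)
  also have "\<dots> = emeasure M {w \<in> space M. weights F w \<in> B}" by (rule nn_integral_indicator) simp
  finally show ?case by simp
next
  case (Suc k)
  interpret prob_space M by (rule gpa_prob_space)
  note [measurable] = Suc.prems
  let ?W = "PiM UNIV (\<lambda>_::nat \<times> nat. borel :: real measure)"
  define C where "C = {w \<in> space M. \<forall>i\<in>{1..k}. P i w = p i}"
  have [measurable]: "C \<in> sets M" unfolding C_def by measurable
  define J where "J = p (Suc k)"
  have J: "J \<le> k" using p by (simp add: J_def)
  have pw[measurable]: "(\<lambda>f. path_weight f p k) \<in> borel_measurable ?W" for k
    unfolding path_weight_def by measurable
  \<comment> \<open>Read for all weight events, the induction hypothesis says that two image
    measures agree; \<open>trans\<close> then holds for every measurable function of the weights, in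
    particular for the next attachment probability.\<close>
  have "distr (density M (indicator C)) ?W (weights F) = distr (density M (\<lambda>w. ennreal (path_weight (weights F w) p k))) ?W (weights F)"
    (is "?L = ?R")
  proof (rule measure_eqI)
    fix A assume "A \<in> sets ?L"
    then have [measurable]: "A \<in> sets ?W" by simp
    have "emeasure ?L A = (\<integral>\<^sup>+w. indicator C w * indicator (weights F -` A \<inter> space M) w \<partial>M)"
      by (subst emeasure_distr) (simp_all add: emeasure_density)
    also have "\<dots> = (\<integral>\<^sup>+w. indicator {w \<in> space M. (\<forall>i\<in>{1..k}. P i w = p i) \<and> weights F w \<in> A} w \<partial>M)"
      by (intro nn_integral_cong) (auto simp: C_def indicator_def)
    also have "\<dots> = emeasure M {w \<in> space M. (\<forall>i\<in>{1..k}. P i w = p i) \<and> weights F w \<in> A}"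
      by (rule nn_integral_indicator) measurable
    also have "\<dots> = (\<integral>\<^sup>+w. ennreal (path_weight (weights F w) p k) * indicator A (weights F w) \<partial>M)"
      by (rule Suc.IH) simp
    also have "\<dots> = (\<integral>\<^sup>+w. ennreal (path_weight (weights F w) p k) * indicator (weights F -` A \<inter> space M) w \<partial>M)"
      by (intro nn_integral_cong) (simp add: indicator_def)
    also have "\<dots> = emeasure ?R A"
      by (subst emeasure_distr) (simp_all add: emeasure_density)
    finally show "emeasure ?L A = emeasure ?R A" .
  qed simp
  then have trans: "(\<integral>\<^sup>+w. indicator C w * h (weights F w) \<partial>M) = (\<integral>\<^sup>+w. ennreal (path_weight (weights F w) p k) * h (weights F w) \<partial>M)"
    if [measurable]: "h \<in> borel_measurable ?W" for h
    using nn_integral_distr[of "weights F" "density M (indicator C)" ?W h]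
      nn_integral_distr[of "weights F" "density M (\<lambda>w. ennreal (path_weight (weights F w) p k))" ?W h]
    by (simp add: nn_integral_density)
  define v where "v f = f (J, outdeg p k J) / (\<Sum>j\<le>k. f (j, outdeg p k j))" for f :: "nat \<times> nat \<Rightarrow> real"
  have [measurable]: "v \<in> borel_measurable ?W" unfolding v_def by measurable
  define B' where "B' = B \<times> {q. \<forall>i\<in>{1..k}. q i = p i}"
  have B': "B' \<in> sets gpa_hist_space"
    unfolding B'_def gpa_hist_space_def using cylinder_measurable Suc.prems by (intro pair_measureI)
  have hist: "gpa_hist F P k w \<in> B' \<longleftrightarrow> weights F w \<in> B \<and> (\<forall>i\<in>{1..k}. P i w = p i)" for w
    unfolding gpa_hist_def B'_def weights_def by auto
  have "{w \<in> space M. (\<forall>i\<in>{1..Suc k}. P i w = p i) \<and> weights F w \<in> B} =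
    {w \<in> space M. gpa_hist F P k w \<in> B' \<and> P (Suc k) w = J}"
    unfolding hist J_def by (auto simp: le_Suc_eq)
  then have "emeasure M {w \<in> space M. (\<forall>i\<in>{1..Suc k}. P i w = p i) \<and> weights F w \<in> B} =
    (\<integral>\<^sup>+w. indicator {w \<in> space M. gpa_hist F P k w \<in> B'} w *
       ennreal (F J (outdeg (\<lambda>i. P i w) k J) w / gpa_Z F P k w) \<partial>M)"
    using gpa_step[OF J B'] by simp
  also have "\<dots> = (\<integral>\<^sup>+w. indicator C w * (indicator B (weights F w) * ennreal (v (weights F w))) \<partial>M)"
  proof (rule nn_integral_cong)
    fix w assume w: "w \<in> space M"
    show "indicator {w \<in> space M. gpa_hist F P k w \<in> B'} w * ennreal (F J (outdeg (\<lambda>i. P i w) k J) w / gpa_Z F P k w)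
       = indicator C w * (indicator B (weights F w) * ennreal (v (weights F w)))"
    proof (cases "w \<in> C \<and> weights F w \<in> B")
      case True
      then have "outdeg (\<lambda>i. P i w) k j = outdeg p k j" for j
        by (intro outdeg_cong) (auto simp: C_def)
      then have "F J (outdeg (\<lambda>i. P i w) k J) w / gpa_Z F P k w = v (weights F w)"
        by (simp add: v_def gpa_Z_def weights_def)
      then show ?thesis using True w by (auto simp: hist C_def)
    next
      case False
      then show ?thesis using w by (auto simp: hist C_def indicator_def)
    qed
  qed
  also have "\<dots> = (\<integral>\<^sup>+w. ennreal (path_weight (weights F w) p k) * (indicator B (weights F w) * ennreal (v (weights F w))) \<partial>M)"
    by (rule trans[of "\<lambda>f. indicator B f * ennreal (v f)"]) simp
  also have "\<dots> = (\<integral>\<^sup>+w. ennreal (path_weight (weights F w) p (Suc k)) * indicator B (weights F w) \<partial>M)"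
  proof (rule nn_integral_cong_AE)
    show "AE w in M. ennreal (path_weight (weights F w) p k) * (indicator B (weights F w) * ennreal (v (weights F w)))
      = ennreal (path_weight (weights F w) p (Suc k)) * indicator B (weights F w)"
      using gpa_pos
    proof eventually_elim
      case (elim w)
      have "0 \<le> path_weight (weights F w) p k" "0 \<le> v (weights F w)" unfolding path_weight_def v_def using elim
        by (auto intro!: prod_nonneg divide_nonneg_nonneg sum_nonneg intro: less_imp_le)
      moreover have "path_weight (weights F w) p (Suc k) = path_weight (weights F w) p k * v (weights F w)"
        by (simp add: path_weight_def v_def J_def)
      ultimately show ?case by (simp add: ennreal_mult mult_ac)
    qed
  qed
  finally show ?case .
qed

lemma measurable_clock [measurable]: "(\<lambda>z. clock F z i) \<in> borel_measurable (clock_space M)"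
  unfolding clock_def clock_space_def split_beta' by measurable

lemma prob_space_clock_space: "prob_space (clock_space M)"
proof -
  interpret A: prob_space M by (rule gpa_prob_space)
  interpret C: prob_space exp_clocks by (rule prob_space_exp_clocks)
  interpret pair_prob_space M exp_clocks ..
  show ?thesis unfolding clock_space_def by unfold_locales
qed

text \<open>\<^term>\<open>P 0\<close> is not constrained by \<^const>\<open>gpa_tree\<close>, while \<open>clock_tree x 0 = 0\<close>.\<close>

definition parents :: "'a \<Rightarrow> nat \<Rightarrow> nat" where
  "parents w i = (if i = 0 then 0 else P i w)"

lemma measurable_parents: "parents \<in> measurable M tree_space"
  by (rule measurable_PiM_single') (auto simp: space_PiM parents_def)

text \<open>On both sides the probability of a prefix is the mean of \<open>path_weight\<close>: by
  \<open>gpa_path_law\<close> for the attachment tree, by \<open>emeasure_follows\<close> and Fubini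
  for the clock tree.\<close>

lemma gpa_tree_law:
  "distr M tree_space parents = distr (clock_space M) tree_space (\<lambda>z. clock_tree (clock F z))"
proof (rule tree_law_eqI)
  interpret A: prob_space M by (rule gpa_prob_space)
  interpret N: prob_space "clock_space M" by (rule prob_space_clock_space)
  interpret C: prob_space exp_clocks by (rule prob_space_exp_clocks)
  note m1 = measurable_parents
  have m2[measurable]: "(\<lambda>z. clock_tree (clock F z)) \<in> measurable (clock_space M) tree_space"
    by (rule measurable_clock_tree) simp
  show "prob_space (distr M tree_space parents)" by (rule A.prob_space_distr[OF m1])
  show "prob_space (distr (clock_space M) tree_space (\<lambda>z. clock_tree (clock F z)))" by (rule N.prob_space_distr) simp
  have rt: "{q \<in> space tree_space. q \<in> recursive_trees} \<in> sets tree_space"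
    unfolding recursive_trees_def by simp
  show "AE q in distr M tree_space parents. q \<in> recursive_trees"
    using AE_gpa_recursive by (subst AE_distr_iff[OF m1 rt]) (simp add: recursive_trees_def parents_def)
  show "AE q in distr (clock_space M) tree_space (\<lambda>z. clock_tree (clock F z)). q \<in> recursive_trees"
    by (subst AE_distr_iff[OF m2 rt]) (simp add: clock_tree_recursive)
  fix p :: "nat \<Rightarrow> nat" and k assume "p \<in> recursive_trees"
  then have p: "p (Suc i) \<le> i" for i by (simp add: recursive_trees_def)
  let ?S = "{q. \<forall>i\<in>{1..k}. q i = p i}"
  note S = cylinder_measurable[of k p]
  have "emeasure (distr M tree_space parents) ?S = emeasure M {w \<in> space M. (\<forall>i\<in>{1..k}. P i w = p i) \<and> weights F w \<in> UNIV}"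
    by (subst emeasure_distr[OF m1 S]) (auto intro!: arg_cong[where f="emeasure M"] simp: parents_def)
  also have "\<dots> = (\<integral>\<^sup>+w. ennreal (path_weight (weights F w) p k) * indicator UNIV (weights F w) \<partial>M)"
    by (rule gpa_path_law[OF p]) (use sets.top[of "PiM UNIV (\<lambda>_::nat \<times> nat. borel :: real measure)"] in \<open>simp add: space_PiM\<close>)
  also have "\<dots> = (\<integral>\<^sup>+w. emeasure exp_clocks {e \<in> space exp_clocks. follows (\<lambda>i. e i / weights F w i) p k} \<partial>M)"
  proof (rule nn_integral_cong_AE)
    show "AE w in M. ennreal (path_weight (weights F w) p k) * indicator UNIV (weights F w) =
       emeasure exp_clocks {e \<in> space exp_clocks. follows (\<lambda>i. e i / weights F w i) p k}"
      using gpa_pos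
    proof eventually_elim
      case (elim w)
      show ?case using emeasure_follows[OF spec[OF elim] p, where k=k] by simp
    qed
  qed
  also have "\<dots> = emeasure (clock_space M) {z \<in> space (clock_space M). follows (clock F z) p k}"
  proof -
    have m: "{z \<in> space (clock_space M). follows (clock F z) p k} \<in> sets (clock_space M)" by measurable
    have "(\<integral>\<^sup>+w. emeasure exp_clocks {e \<in> space exp_clocks. follows (\<lambda>i. e i / weights F w i) p k} \<partial>M)
       = (\<integral>\<^sup>+w. emeasure exp_clocks (Pair w -` {z \<in> space (clock_space M). follows (clock F z) p k}) \<partial>M)"
      by (intro nn_integral_cong arg_cong[where f="emeasure exp_clocks"])
         (auto simp: clock_space_def space_pair_measure clock_def)
    also have "\<dots> = emeasure (clock_space M) {z \<in> space (clock_space M). follows (clock F z) p k}"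
      using C.emeasure_pair_measure_alt[of _ M] m unfolding clock_space_def by simp
    finally show ?thesis .
  qed
  also have "\<dots> = emeasure (distr (clock_space M) tree_space (\<lambda>z. clock_tree (clock F z))) ?S"
    by (subst emeasure_distr[OF m2 S]) (auto simp: follows_def intro!: arg_cong[where f="emeasure (clock_space M)"])
  finally show "emeasure (distr M tree_space parents) ?S =
    emeasure (distr (clock_space M) tree_space (\<lambda>z. clock_tree (clock F z))) ?S" .
qed simp_all

text \<open>The transfer principle: hub events have to be decided for \<open>clock_tree\<close>
  only. Insensitivity to entry 0 bridges the gap between \<open>P\<close> and
  \<open>parents\<close>.\<close>

lemma AE_gpa_iff:
  assumes [measurable]: "Measurable.pred tree_space \<Phi>" and \<Phi>: "\<And>q q'. (\<And>i. 1 \<le> i \<Longrightarrow> q i = q' i) \<Longrightarrow> \<Phi> q \<longleftrightarrow> \<Phi> q'"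
  shows "(AE w in M. \<Phi> (\<lambda>i. P i w)) \<longleftrightarrow> (AE z in clock_space M. \<Phi> (clock_tree (clock F z)))"
proof -
  note m1 = measurable_parents
  have m2: "(\<lambda>z. clock_tree (clock F z)) \<in> measurable (clock_space M) tree_space"
    by (rule measurable_clock_tree) simp
  have s: "{q \<in> space tree_space. \<Phi> q} \<in> sets tree_space" by measurable
  have "\<Phi> (\<lambda>i. P i w) \<longleftrightarrow> \<Phi> (parents w)" for w by (rule \<Phi>) (simp add: parents_def)
  then have "(AE w in M. \<Phi> (\<lambda>i. P i w)) \<longleftrightarrow> (AE w in M. \<Phi> (parents w))" by simp
  also have "\<dots> \<longleftrightarrow> (AE q in distr M tree_space parents. \<Phi> q)"
    by (rule AE_distr_iff[OF m1 s, symmetric])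
  also have "\<dots> \<longleftrightarrow> (AE z in clock_space M. \<Phi> (clock_tree (clock F z)))"
    unfolding gpa_tree_law by (rule AE_distr_iff[OF m2 s])
  finally show ?thesis .
qed

end

section \<open>Sums of independent random variables\<close>

lemma (in prob_space) indep_vars_reindex:
  assumes "indep_vars M' X I" "inj_on f J" "f ` J \<subseteq> I"
  shows "indep_vars (\<lambda>j. M' (f j)) (\<lambda>j. X (f j)) J"
proof -
  have "indep_vars (\<lambda>j. PiM {f j} M') (\<lambda>j w. restrict (\<lambda>i. X i w) {f j}) J"
    using assms by (intro indep_vars_restrict[OF assms(1)]) (auto simp: disjoint_family_on_def inj_on_def)
  then have "indep_vars (\<lambda>j. M' (f j)) (\<lambda>j w. (restrict (\<lambda>i. X i w) {f j}) (f j)) J"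
    by (rule indep_vars_compose2) auto
  then show ?thesis by simp
qed

text \<open>\<open>Y 0\<close> plays the role of a random starting point.\<close>

lemma (in prob_space) convex_maximal_inequality:
  fixes Y :: "nat \<Rightarrow> 'a \<Rightarrow> real" and \<phi> \<psi> :: "real \<Rightarrow> real"
  defines "S \<equiv> \<lambda>n w. \<Sum>i\<le>n. Y i w"
  assumes indep: "indep_vars (\<lambda>_. borel) Y {..N}"
    and mean: "\<And>i. 0 < i \<Longrightarrow> i \<le> N \<Longrightarrow> integrable M (Y i)" "\<And>i. 0 < i \<Longrightarrow> i \<le> N \<Longrightarrow> expectation (Y i) = 0"
    and [measurable]: "\<phi> \<in> borel_measurable borel" "\<psi> \<in> borel_measurable borel"
    and nonneg: "\<And>s. 0 \<le> \<phi> s" and sub: "\<And>s r. \<phi> s + \<psi> s * r \<le> \<phi> (s + r)"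
    and int: "\<And>n. n \<le> N \<Longrightarrow> integrable M (\<lambda>w. \<phi> (S n w))" "\<And>n. n \<le> N \<Longrightarrow> integrable M (\<lambda>w. \<psi> (S n w))"
    and a: "0 < a"
  shows "prob {w \<in> space M. \<exists>n\<le>N. a \<le> \<phi> (S n w)} \<le> expectation (\<lambda>w. \<phi> (S N w)) / a"
proof -
  have Y: "Y i \<in> borel_measurable M" if "i \<le> N" for i
    using indep that by (auto simp: indep_vars_def)
  have Sm: "S n \<in> borel_measurable M" if "n \<le> N" for n
    unfolding S_def using that by (intro borel_measurable_sum Y) auto
  \<comment> \<open>Decomposition by first passage: on \<open>A n\<close> the level \<open>a\<close>
    is reached at time \<open>n\<close> and not before.\<close>
  define A where "A n = {w \<in> space M. a \<le> \<phi> (S n w) \<and> (\<forall>m\<in>{..<n}. \<phi> (S m w) < a)}" for n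
  have A: "A n \<in> events" if "n \<le> N" for n
  proof -
    have \<phi>m: "(\<lambda>w. \<phi> (S m w)) \<in> borel_measurable M" if "m \<le> n" for m
      using Sm[of m] that \<open>n \<le> N\<close> by (intro measurable_compose[OF _ \<open>\<phi> \<in> borel_measurable borel\<close>]) auto
    note [measurable] = \<phi>m[OF order_refl]
    have "Measurable.pred M (\<lambda>w. \<phi> (S m w) < a)" if "m \<in> {..<n}" for m
      using borel_measurable_less[OF \<phi>m[of m], of "\<lambda>_. a"] that by (simp add: pred_def)
    then have [measurable]: "Measurable.pred M (\<lambda>w. \<forall>m\<in>{..<n}. \<phi> (S m w) < a)"
      by (intro pred_intros_finite) auto
    show ?thesis unfolding A_def by measurable
  qed
  have key: "a * prob (A n) \<le> expectation (\<lambda>w. \<phi> (S N w) * indicator (A n) w)" if n: "n \<le> N" for n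
  proof -
    \<comment> \<open>\<open>\<psi>\<close> is a subgradient of \<open>\<phi>\<close>, so
      \<open>\<phi> (S N)\<close> is at least \<open>\<phi> (S n) + \<psi> (S n) * R\<close>. The
      later increment \<open>R\<close> is centred and independent of the past, so the cross term has
      mean 0 on \<open>A n\<close>. Since \<open>R\<close> omits \<open>Y 0\<close>, the starting
      point need not be centred.\<close>
    define R where "R w = (\<Sum>i\<in>{n<..N}. Y i w)" for w
    have SN: "S N w = S n w + R w" for w
    proof -
      have "{..N} = {..n} \<union> {n<..N}" using n by auto
      then show ?thesis unfolding S_def R_def by (simp add: sum.union_disjoint ivl_disj_int)
    qed
    have Rint: "integrable M R" unfolding R_def using mean(1) by (intro Bochner_Integration.integrable_sum) auto
    have R0: "expectation R = 0"
      unfolding R_def using mean by (subst Bochner_Integration.integral_sum) auto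
    \<comment> \<open>\<open>\<psi> (S n)\<close> times the indicator of \<open>A n\<close>, written
      as a function of the first block of variables so that independence of blocks applies.\<close>
    define G where "G y = \<psi> (\<Sum>i\<le>n. y i) * (if a \<le> \<phi> (\<Sum>i\<le>n. y i) \<and> (\<forall>m\<in>{..<n}. \<phi> (\<Sum>i\<le>m. y i) < a) then 1 else 0)" for y :: "nat \<Rightarrow> real"
    have sm: "(\<lambda>y :: nat \<Rightarrow> real. \<Sum>i\<le>m. y i) \<in> borel_measurable (PiM {..n} (\<lambda>_. borel))" if "m \<le> n" for m
    proof -
      have "(\<lambda>y :: nat \<Rightarrow> real. y i) \<in> borel_measurable (PiM {..n} (\<lambda>_. borel))" if "i \<in> {..m}" for i
        using that \<open>m \<le> n\<close> by (intro measurable_component_singleton) auto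
      then show ?thesis using borel_measurable_sum[of "{..m}" "\<lambda>i (y :: nat \<Rightarrow> real). y i"] by simp
    qed
    have \<phi>m: "(\<lambda>y. \<phi> (\<Sum>i\<le>m. y i)) \<in> borel_measurable (PiM {..n} (\<lambda>_. borel))" if "m \<le> n" for m
      using measurable_compose[OF sm[OF that] \<open>\<phi> \<in> borel_measurable borel\<close>] .
    have G: "G \<in> borel_measurable (PiM {..n} (\<lambda>_. borel))"
    proof -
      note [measurable] = \<phi>m[OF order_refl] measurable_compose[OF sm[OF order_refl] \<open>\<psi> \<in> borel_measurable borel\<close>]
      have "Measurable.pred (PiM {..n} (\<lambda>_. borel)) (\<lambda>y. \<phi> (\<Sum>i\<le>m. y i) < a)" if "m \<in> {..<n}" for m
        using borel_measurable_less[OF \<phi>m[of m], of "\<lambda>_. a"] that by (simp add: pred_def)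
      then have [measurable]: "Measurable.pred (PiM {..n} (\<lambda>_. borel)) (\<lambda>y. \<forall>m\<in>{..<n}. \<phi> (\<Sum>i\<le>m. y i) < a)"
        by (intro pred_intros_finite) auto
      show ?thesis unfolding G_def by measurable
    qed
    have "indep_var borel (G \<circ> (\<lambda>w. restrict (\<lambda>i. Y i w) {..n})) borel ((\<lambda>y. \<Sum>i\<in>{n<..N}. y i) \<circ> (\<lambda>w. restrict (\<lambda>i. Y i w) {n<..N}))"
      using n by (intro indep_var_compose[OF indep_var_restrict[OF indep]] G) auto
    also have "(\<lambda>y. \<Sum>i\<in>{n<..N}. y i) \<circ> (\<lambda>w. restrict (\<lambda>i. Y i w) {n<..N}) = R"
      by (auto simp: R_def fun_eq_iff)
    finally have ind: "indep_var borel (G \<circ> (\<lambda>w. restrict (\<lambda>i. Y i w) {..n})) borel R" .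
    have Geq: "(G \<circ> (\<lambda>w. restrict (\<lambda>i. Y i w) {..n})) w = \<psi> (S n w) * indicator (A n) w" if "w \<in> space M" for w
    proof -
      have "(\<Sum>i\<le>m. restrict (\<lambda>i. Y i w) {..n} i) = S m w" if "m \<le> n" for m
        unfolding S_def using that by (intro sum.cong) auto
      then show ?thesis using that by (auto simp: G_def A_def indicator_def)
    qed
    have Gint: "integrable M (\<lambda>w. \<psi> (S n w) * indicator (A n) w)"
      using int(2)[OF n] A[OF n] by (rule integrable_real_mult_indicator[rotated])
    then have Gint': "integrable M (G \<circ> (\<lambda>w. restrict (\<lambda>i. Y i w) {..n}))"
      by (subst Bochner_Integration.integrable_cong[OF refl Geq]) auto
    have prod_int: "integrable M (\<lambda>w. \<psi> (S n w) * indicator (A n) w * R w)"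
      using indep_var_integrable[OF ind Gint' Rint]
      by (subst (asm) Bochner_Integration.integrable_cong[OF refl]) (auto simp: Geq[unfolded o_apply])
    have "expectation (\<lambda>w. \<psi> (S n w) * indicator (A n) w * R w) = expectation (\<lambda>w. (G \<circ> (\<lambda>w. restrict (\<lambda>i. Y i w) {..n})) w * R w)"
      by (intro Bochner_Integration.integral_cong) (auto simp: Geq[unfolded o_apply])
    also have "\<dots> = 0" using indep_var_lebesgue_integral[OF ind Gint' Rint] R0 by simp
    finally have zero: "expectation (\<lambda>w. \<psi> (S n w) * indicator (A n) w * R w) = 0" .
    have \<phi>int: "integrable M (\<lambda>w. \<phi> (S n w) * indicator (A n) w)"
      using int(1)[OF n] A[OF n] by (rule integrable_real_mult_indicator[rotated])
    have "a * prob (A n) = expectation (\<lambda>w. a * indicator (A n) w)" using A[OF n] by simp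
    also have "\<dots> \<le> expectation (\<lambda>w. \<phi> (S n w) * indicator (A n) w)"
    proof (intro integral_mono \<phi>int)
      show "integrable M (\<lambda>w. a * indicator (A n) w)"
        using A[OF n] by (intro integrable_mult_right integrable_real_indicator) (simp_all add: emeasure_eq_measure)
    qed (auto simp: indicator_def A_def)
    also have "\<dots> = expectation (\<lambda>w. \<phi> (S n w) * indicator (A n) w + \<psi> (S n w) * indicator (A n) w * R w)"
      using \<phi>int prod_int zero by simp
    also have "\<dots> \<le> expectation (\<lambda>w. \<phi> (S N w) * indicator (A n) w)"
    proof (intro integral_mono)
      show "integrable M (\<lambda>w. \<phi> (S N w) * indicator (A n) w)"
        using int(1)[OF order_refl] A[OF n] by (rule integrable_real_mult_indicator[rotated])
    qed (use \<phi>int prod_int sub SN in \<open>auto simp: indicator_def\<close>)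
    finally show ?thesis .
  qed
  have disj: "disjoint_family_on A {..N}"
    unfolding disjoint_family_on_def
  proof (intro ballI impI)
    fix m n :: nat assume "m \<noteq> n"
    then consider "m < n" | "n < m" by linarith
    then show "A m \<inter> A n = {}" by cases (force simp: A_def)+
  qed
  have un: "{w \<in> space M. \<exists>n\<le>N. a \<le> \<phi> (S n w)} = (\<Union>n\<in>{..N}. A n)"
  proof safe
    fix w n assume w: "w \<in> space M" "n \<le> N" "a \<le> \<phi> (S n w)"
    define k where "k = (LEAST k. a \<le> \<phi> (S k w))"
    have "a \<le> \<phi> (S k w)" unfolding k_def using w by (rule_tac LeastI)
    moreover have "k \<le> n" unfolding k_def using w by (intro Least_le)
    moreover have "\<phi> (S m w) < a" if "m < k" for m
      using not_less_Least[of m "\<lambda>k. a \<le> \<phi> (S k w)"] that unfolding k_def by auto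
    ultimately show "w \<in> (\<Union>n\<in>{..N}. A n)" using w by (auto simp: A_def intro!: bexI[of _ k])
  qed (auto simp: A_def)
  have "a * prob {w \<in> space M. \<exists>n\<le>N. a \<le> \<phi> (S n w)} = (\<Sum>n\<le>N. a * prob (A n))"
  proof -
    have "prob (\<Union>n\<in>{..N}. A n) = (\<Sum>n\<le>N. prob (A n))"
      by (rule finite_measure_finite_Union) (use disj A in auto)
    then show ?thesis unfolding un by (simp only: sum_distrib_left)
  qed
  also have "\<dots> \<le> (\<Sum>n\<le>N. expectation (\<lambda>w. \<phi> (S N w) * indicator (A n) w))"
    using key by (intro sum_mono) auto
  also have "\<dots> = expectation (\<lambda>w. \<Sum>n\<le>N. \<phi> (S N w) * indicator (A n) w)"
    using int(1)[OF order_refl] A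
    by (subst Bochner_Integration.integral_sum) (auto intro!: integrable_real_mult_indicator)
  also have "\<dots> \<le> expectation (\<lambda>w. \<phi> (S N w))"
  proof (rule integral_mono)
    show "integrable M (\<lambda>w. \<Sum>n\<le>N. \<phi> (S N w) * indicator (A n) w)"
      using int(1)[OF order_refl] A
      by (intro Bochner_Integration.integrable_sum integrable_real_mult_indicator) auto
    fix w
    have "(\<Sum>n\<le>N. indicator (A n) w) = (indicator (\<Union>n\<in>{..N}. A n) w :: real)"
      using disj by (intro indicator_UN_disjoint[symmetric]) auto
    then show "(\<Sum>n\<le>N. \<phi> (S N w) * indicator (A n) w) \<le> \<phi> (S N w)"
      using nonneg[of "S N w"] by (simp add: sum_distrib_left[symmetric] indicator_def)
  qed (rule int(1)[OF order_refl])
  finally show ?thesis using a by (simp add: pos_le_divide_eq mult.commute)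
qed

lemma (in prob_space) prob_ex_le:
  fixes Q :: "nat \<Rightarrow> 'a \<Rightarrow> bool"
  assumes [measurable]: "\<And>n. Measurable.pred M (Q n)"
    and le: "\<And>N. prob {w \<in> space M. \<exists>n\<le>N. Q n w} \<le> c"
  shows "prob {w \<in> space M. \<exists>n. Q n w} \<le> c"
proof -
  define C where "C N = {w \<in> space M. \<exists>n\<le>N. Q n w}" for N
  have [measurable]: "C N \<in> events" for N unfolding C_def by measurable
  have "(\<lambda>N. prob (C N)) \<longlonglongrightarrow> prob (\<Union>N. C N)"
    by (rule finite_Lim_measure_incseq) (auto simp: incseq_def C_def intro: order_trans)
  moreover have "(\<Union>N. C N) = {w \<in> space M. \<exists>n. Q n w}" by (auto simp: C_def)
  ultimately show ?thesis using le unfolding C_def by (intro LIMSEQ_le_const2) auto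
qed

lemma (in prob_space) expectation_square_sum:
  fixes Y :: "nat \<Rightarrow> 'a \<Rightarrow> real"
  assumes "finite I" "indep_vars (\<lambda>_. borel) Y I"
    and "\<And>i. i \<in> I \<Longrightarrow> integrable M (Y i)" "\<And>i. i \<in> I \<Longrightarrow> expectation (Y i) = 0"
    and "\<And>i. i \<in> I \<Longrightarrow> integrable M (\<lambda>w. (Y i w)\<^sup>2)"
  shows "integrable M (\<lambda>w. (\<Sum>i\<in>I. Y i w)\<^sup>2) \<and>
    expectation (\<lambda>w. (\<Sum>i\<in>I. Y i w)\<^sup>2) = (\<Sum>i\<in>I. expectation (\<lambda>w. (Y i w)\<^sup>2))"
  using assms
proof (induction I rule: finite_induct)
  case (insert j I)
  let ?S = "\<lambda>w. \<Sum>i\<in>I. Y i w"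
  have IH: "integrable M (\<lambda>w. (?S w)\<^sup>2)" "expectation (\<lambda>w. (?S w)\<^sup>2) = (\<Sum>i\<in>I. expectation (\<lambda>w. (Y i w)\<^sup>2))"
    using insert.IH insert.prems indep_vars_subset[OF insert.prems(1), of I] by auto
  have ind: "indep_var borel (Y j) borel ?S" using insert by (intro indep_vars_sum) auto
  have Yj: "integrable M (Y j)" "expectation (Y j) = 0" "integrable M (\<lambda>w. (Y j w)\<^sup>2)" using insert.prems by auto
  have Si: "integrable M ?S" using insert.prems by (intro Bochner_Integration.integrable_sum) auto
  note i = indep_var_integrable[OF ind Yj(1) Si] and e = indep_var_lebesgue_integral[OF ind Yj(1) Si]
  have eq: "(\<Sum>i\<in>insert j I. Y i w)\<^sup>2 = (Y j w)\<^sup>2 + 2 * (Y j w * ?S w) + (?S w)\<^sup>2" for w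
    using insert.hyps by (simp add: power2_sum algebra_simps)
  show ?case unfolding eq using Yj IH i e insert.hyps by simp
qed simp

text \<open>Kolmogorov's criterion. The maximal inequality with the square function bounds the
  oscillation after \<open>m\<close> by the tail of the variances, which tends to 0; hence the
  partial sums are almost surely Cauchy.\<close>

lemma (in prob_space) AE_convergent_sum:
  fixes Y :: "nat \<Rightarrow> 'a \<Rightarrow> real"
  assumes indep: "indep_vars (\<lambda>_. borel) Y UNIV"
    and Y: "\<And>i. integrable M (Y i)" "\<And>i. expectation (Y i) = 0" "\<And>i. integrable M (\<lambda>w. (Y i w)\<^sup>2)"
    and summ: "summable (\<lambda>i. expectation (\<lambda>w. (Y i w)\<^sup>2))"
  shows "AE w in M. convergent (\<lambda>n. \<Sum>i<n. Y i w)"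
proof -
  have [measurable]: "Y i \<in> borel_measurable M" for i using Y by blast
  define v where "v i = expectation (\<lambda>w. (Y i w)\<^sup>2)" for i
  have v0: "0 \<le> v i" for i unfolding v_def by (intro integral_nonneg_AE) auto
  have sv: "summable v" using summ unfolding v_def .
  define B where "B e m = {w \<in> space M. \<exists>n. e\<^sup>2 \<le> (\<Sum>i\<le>n. Y (m + i) w)\<^sup>2}" for e :: real and m
  have Bm[measurable]: "B e m \<in> events" for e m unfolding B_def by measurable
  have bound: "prob (B e m) \<le> (\<Sum>i. v (m + i)) / e\<^sup>2" if e: "0 < e" for e m
  proof -
    define C where "C N = {w \<in> space M. \<exists>n\<le>N. e\<^sup>2 \<le> (\<Sum>i\<le>n. Y (m + i) w)\<^sup>2}" for N
    have ind: "indep_vars (\<lambda>_. borel) (\<lambda>i. Y (m + i)) I" for I :: "nat set"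
      using indep_vars_reindex[OF indep, of "(+) m" I] by simp
    have sv': "summable (\<lambda>i. v (m + i))" using summable_ignore_initial_segment[OF sv, of m] by (simp add: add.commute)
    have C: "prob (C N) \<le> (\<Sum>i. v (m + i)) / e\<^sup>2" for N
    proof -
      have sq: "integrable M (\<lambda>w. (\<Sum>i\<le>n. Y (m + i) w)\<^sup>2) \<and>
          expectation (\<lambda>w. (\<Sum>i\<le>n. Y (m + i) w)\<^sup>2) = (\<Sum>i\<le>n. v (m + i))" for n
        unfolding v_def using ind Y by (intro expectation_square_sum) auto
      have "prob (C N) \<le> expectation (\<lambda>w. (\<Sum>i\<le>N. Y (m + i) w)\<^sup>2) / e\<^sup>2"
        unfolding C_def
      proof (rule convex_maximal_inequality[where \<phi>="\<lambda>s. s\<^sup>2" and \<psi>="\<lambda>s. 2 * s"])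
        fix s r :: real
        have "(s + r)\<^sup>2 - (s\<^sup>2 + 2 * s * r) = r\<^sup>2" by (simp add: power2_eq_square algebra_simps)
        then show "s\<^sup>2 + 2 * s * r \<le> (s + r)\<^sup>2" using zero_le_power2[of r] by linarith
      qed (use ind Y sq e in auto)
      also have "expectation (\<lambda>w. (\<Sum>i\<le>N. Y (m + i) w)\<^sup>2) = (\<Sum>i\<le>N. v (m + i))" using sq by blast
      also have "(\<Sum>i\<le>N. v (m + i)) / e\<^sup>2 \<le> (\<Sum>i. v (m + i)) / e\<^sup>2"
        using v0 sv' by (intro divide_right_mono sum_le_suminf) auto
      finally show ?thesis .
    qed
    then show ?thesis unfolding B_def C_def by (rule prob_ex_le[rotated]) measurable
  qed
  have tail: "(\<lambda>m. \<Sum>i. v (m + i)) \<longlonglongrightarrow> 0"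
    using suminf_exist_split2[OF sv] by (simp add: add.commute)
  have "AE w in M. \<exists>m. w \<notin> B (1 / Suc j) m" for j
  proof -
    have "prob (\<Inter>m. B (1 / Suc j) m) \<le> (\<Sum>i. v (m + i)) / (1 / Suc j)\<^sup>2" for m
    proof -
      have "prob (\<Inter>m. B (1 / Suc j) m) \<le> prob (B (1 / Suc j) m)" by (intro finite_measure_mono) auto
      also have "\<dots> \<le> (\<Sum>i. v (m + i)) / (1 / Suc j)\<^sup>2" by (rule bound) simp
      finally show ?thesis .
    qed
    moreover have "(\<lambda>m. (\<Sum>i. v (m + i)) / (1 / Suc j)\<^sup>2) \<longlonglongrightarrow> 0 / (1 / Suc j)\<^sup>2"
      by (intro tendsto_divide tail tendsto_const) simp
    ultimately have "prob (\<Inter>m. B (1 / Suc j) m) \<le> 0 / (1 / Suc j)\<^sup>2"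
      by (rule_tac LIMSEQ_le_const) blast+
    then have "prob (\<Inter>m. B (1 / Suc j) m) = 0" by (simp add: measure_le_0_iff)
    then have "AE w in M. w \<notin> (\<Inter>m. B (1 / Suc j) m)"
      by (intro AE_not_in) (simp add: null_sets_def emeasure_eq_measure)
    then show ?thesis by simp
  qed
  then have "AE w in M. \<forall>j. \<exists>m. w \<notin> B (1 / Suc j) m" by (simp add: AE_all_countable)
  then show ?thesis
  proof (rule AE_mp, intro AE_I2 impI)
    fix w assume w: "w \<in> space M" and "\<forall>j. \<exists>m. w \<notin> B (1 / Suc j) m"
    then have *: "\<exists>m. \<forall>n. \<bar>\<Sum>i\<le>n. Y (m + i) w\<bar> < 1 / Suc j" for j
    proof -
      obtain m where "w \<notin> B (1 / Suc j) m" using \<open>\<forall>j. \<exists>m. w \<notin> B (1 / Suc j) m\<close> by blast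
      then have "\<bar>\<Sum>i\<le>n. Y (m + i) w\<bar>\<^sup>2 < (1 / Suc j)\<^sup>2" for n
        using w unfolding B_def power2_abs by (auto simp: not_le)
      then have "\<bar>\<Sum>i\<le>n. Y (m + i) w\<bar> < 1 / Suc j" for n
        by (rule power2_less_imp_less) simp
      then show ?thesis by blast
    qed
    have "Cauchy (\<lambda>n. \<Sum>i<n. Y i w)"
    proof (rule metric_CauchyI)
      fix e :: real assume "0 < e"
      then obtain j where j: "1 / real (Suc j) < e / 2" using nat_approx_posE half_gt_zero by blast
      obtain m where m: "\<And>n. \<bar>\<Sum>i\<le>n. Y (m + i) w\<bar> < 1 / Suc j" using * by blast
      \<comment> \<open>Both ends of a late block are compared with the partial sum at
        \<open>m\<close>, which is why each is allowed half of \<open>e\<close>.\<close>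
      have d: "\<bar>(\<Sum>i<n. Y i w) - (\<Sum>i<m. Y i w)\<bar> < e / 2" if "m < n" for n
      proof -
        have "(\<Sum>i<n. Y i w) - (\<Sum>i<m. Y i w) = (\<Sum>i\<in>{m..<n}. Y i w)"
          using that sum_diff_nat_ivl[of 0 m n "\<lambda>i. Y i w"] by (simp add: lessThan_atLeast0)
        also have "\<dots> = (\<Sum>i\<in>{0..<n-m}. Y (i + m) w)"
          using sum.shift_bounds_nat_ivl[of "\<lambda>i. Y i w" 0 m "n - m"] that by simp
        also have "\<dots> = (\<Sum>i\<le>n-m-1. Y (m + i) w)" using that by (intro sum.cong) (auto simp: add.commute)
        finally show ?thesis using m[of "n-m-1"] j by simp
      qed
      show "\<exists>M. \<forall>k\<ge>M. \<forall>n\<ge>M. dist (\<Sum>i<k. Y i w) (\<Sum>i<n. Y i w) < e"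
      proof (intro exI[of _ "Suc m"] allI impI)
        fix k n assume "Suc m \<le> k" "Suc m \<le> n"
        then show "dist (\<Sum>i<k. Y i w) (\<Sum>i<n. Y i w) < e" using d[of k] d[of n] unfolding dist_real_def by linarith
      qed
    qed
    then show "convergent (\<lambda>n. \<Sum>i<n. Y i w)" by (rule Cauchy_convergent)
  qed
qed


lemma cos_ge_one_minus_square: "1 - x\<^sup>2 / 2 \<le> cos x" for x :: real
proof -
  have "\<bar>sin (x / 2)\<bar>\<^sup>2 \<le> \<bar>x / 2\<bar>\<^sup>2" by (intro power_mono abs_sin_x_le_abs_x) simp
  then show ?thesis using cos_double_sin[of "x / 2"] by (simp add: power_divide)
qed

text \<open>Unboundedness above is a tail event and, by symmetry, as likely as unboundedness below.
  If its probability were 0 the sums would be almost surely bounded, and their characteristic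
  functions near 0 would stay away from 0.\<close>

lemma (in prob_space) AE_symmetric_sum_unbounded:
  fixes Y :: "nat \<Rightarrow> 'a \<Rightarrow> real"
  assumes indep: "indep_vars (\<lambda>_. borel) Y UNIV"
    and symm: "\<And>i. distr M borel (\<lambda>w. - Y i w) = distr M borel (Y i)"
    and char0: "\<And>t. t \<noteq> 0 \<Longrightarrow> (\<lambda>n. \<Prod>i<n. cmod (char (distr M borel (Y i)) t)) \<longlonglongrightarrow> 0"
  shows "AE w in M. \<forall>K. \<exists>n. K < (\<Sum>i<n. Y i w)"
proof -
  let ?W = "PiM UNIV (\<lambda>_::nat. borel :: real measure)"
  have Y[measurable]: "Y i \<in> borel_measurable M" for i using indep by (auto simp: indep_vars_def)
  define S where "S n w = (\<Sum>i<n. Y i w)" for n w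
  have [measurable]: "S n \<in> borel_measurable M" for n unfolding S_def by measurable
  define G where "G = {y \<in> space ?W. \<forall>K::nat. \<exists>n. real K < (\<Sum>i<n. y i)}"
  have G[measurable]: "G \<in> sets ?W" unfolding G_def by measurable
  define U where "U = {w \<in> space M. \<forall>K::nat. \<exists>n. real K < S n w}"
  define V where "V = {w \<in> space M. \<forall>K::nat. \<exists>n. real K < - S n w}"
  have [measurable]: "U \<in> events" "V \<in> events" unfolding U_def V_def by measurable
  have law: "distr M ?W (\<lambda>w i. Z i w) = PiM UNIV (\<lambda>i. distr M borel (Z i))"
    if "indep_vars (\<lambda>_. borel) Z UNIV" for Z :: "nat \<Rightarrow> 'a \<Rightarrow> real"
  proof -
    have "Z i \<in> borel_measurable M" for i using that by (auto simp: indep_vars_def)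
    from indep_vars_iff_distr_eq_PiM[THEN iffD1, OF _ this that] show ?thesis by (simp add: restrict_def)
  qed
  have "prob U = prob V"
  proof -
    have "indep_vars (\<lambda>_. borel) (\<lambda>i w. - Y i w) UNIV"
      using indep by (rule indep_vars_compose2) simp
    from law[OF this] law[OF indep] have eq: "distr M ?W (\<lambda>w i. - Y i w) = distr M ?W (\<lambda>w i. Y i w)"
      by (simp add: symm)
    have m: "(\<lambda>w i. Z i w) \<in> measurable M ?W" if "\<And>i. Z i \<in> borel_measurable M" for Z :: "nat \<Rightarrow> 'a \<Rightarrow> real"
      using that by (intro measurable_PiM_single') (auto simp: space_PiM)
    have "prob U = prob ((\<lambda>w i. Y i w) -` G \<inter> space M)"
      by (rule arg_cong[where f=prob]) (auto simp: U_def G_def S_def space_PiM)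
    also have "\<dots> = measure (distr M ?W (\<lambda>w i. Y i w)) G"
      by (rule measure_distr[OF m[OF Y] G, symmetric])
    also have "\<dots> = measure (distr M ?W (\<lambda>w i. - Y i w)) G" unfolding eq ..
    also have "\<dots> = prob ((\<lambda>w i. - Y i w) -` G \<inter> space M)"
      by (rule measure_distr[OF m G]) simp
    also have "\<dots> = prob V"
      by (rule arg_cong[where f=prob]) (auto simp: V_def G_def S_def space_PiM sum_negf)
    finally show ?thesis .
  qed
  have "prob U = 0 \<or> prob U = 1"
  proof (rule kolmogorov_0_1_law)
    let ?A = "\<lambda>i. sigma_sets (space M) {Y i -` A \<inter> space M |A. A \<in> sets borel}"
    show "sigma_algebra (space M) (?A i)" for i by (rule sigma_algebra_sigma_sets) auto
    show "indep_sets ?A UNIV" using indep by (simp add: indep_vars_def)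
    show "U \<in> tail_events ?A"
      unfolding tail_events_def
    proof
      fix m
      \<comment> \<open>The sigma-algebra generated by the variables from \<open>m\<close> on,
        packaged as a measure so that measurability of countable conditions can be derived in
        it.\<close>
      define T where "T = sigma (space M) (\<Union>(?A ` {m..}))"
      have sub: "\<Union>(?A ` {m..}) \<subseteq> Pow (space M)"
        by (auto dest: sigma_sets_into_sp[rotated])
      have sT: "space T = space M" "sets T = sigma_sets (space M) (\<Union>(?A ` {m..}))"
        unfolding T_def using sub by (simp_all add: space_measure_of sets_measure_of)
      have [measurable]: "Y (m + i) \<in> borel_measurable T" for i
      proof (rule measurableI)
        fix A :: "real set" assume "A \<in> sets borel"
        then have "Y (m + i) -` A \<inter> space M \<in> ?A (m + i)" by auto
        then show "Y (m + i) -` A \<inter> space T \<in> sets T" unfolding sT by (intro sigma_sets.Basic) auto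
      qed simp
      have "U = {w \<in> space T. \<forall>K::nat. \<exists>n. real K < (\<Sum>i<n. Y (m + i) w)}"
      proof -
        have split: "S (m + n) w = S m w + (\<Sum>i<n. Y (m + i) w)" for n w
          unfolding S_def by (induction n) auto
        have "(\<forall>K::nat. \<exists>n. real K < S n w) \<longleftrightarrow> (\<forall>K::nat. \<exists>n. real K < (\<Sum>i<n. Y (m + i) w))" for w
        proof safe
          fix K :: nat assume h: "\<forall>K::nat. \<exists>n. real K < S n w"
          \<comment> \<open>The first \<open>m\<close> sums must not be responsible for exceeding
            the level: \<open>C\<close> bounds them, and the level above \<open>C + C + K\<close>
            also leaves room for subtracting \<open>S m w\<close>.\<close>
          define C where "C = (\<Sum>i\<le>m. \<bar>S i w\<bar>)"
          have C: "\<bar>S i w\<bar> \<le> C" if "i \<le> m" for i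
            unfolding C_def using that by (intro member_le_sum) auto
          obtain L :: nat where L: "C + C + real K < real L" using reals_Archimedean2 by blast
          obtain n where n: "real L < S n w" using h by blast
          have "\<not> n \<le> m" using C[of n] C[of 0] n L by (auto simp: abs_le_iff)
          then have "S n w = S m w + (\<Sum>i<n-m. Y (m + i) w)" using split[of "n - m" w] by simp
          then have "real K < (\<Sum>i<n-m. Y (m + i) w)" using n L C[of m] C[of 0] by (auto simp: abs_le_iff)
          then show "\<exists>n. real K < (\<Sum>i<n. Y (m + i) w)" by blast
        next
          fix K :: nat assume h: "\<forall>K::nat. \<exists>n. real K < (\<Sum>i<n. Y (m + i) w)"
          obtain L :: nat where L: "\<bar>S m w\<bar> + real K < real L" using reals_Archimedean2 by blast
          obtain n where n: "real L < (\<Sum>i<n. Y (m + i) w)" using h by blast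
          then have "real K < S (m + n) w" unfolding split using L by linarith
          then show "\<exists>n. real K < S n w" by blast
        qed
        then show ?thesis unfolding U_def sT by simp
      qed
      also have "\<dots> \<in> sets T" by measurable
      finally show "U \<in> sigma_sets (space M) (\<Union>(?A ` {m..}))" unfolding sT .
    qed
  qed
  moreover have "prob U \<noteq> 0"
  proof
    assume U0: "prob U = 0"
    then have V0: "prob V = 0" using \<open>prob U = prob V\<close> by simp
    define B where "B K = {w \<in> space M. \<forall>n. \<bar>S n w\<bar> \<le> real K}" for K :: nat
    have [measurable]: "B K \<in> events" for K unfolding B_def by measurable
    have "AE w in M. w \<notin> U" "AE w in M. w \<notin> V"
      using U0 V0 by (auto intro!: AE_not_in simp: null_sets_def emeasure_eq_measure)
    with AE_space have "AE w in M. w \<in> (\<Union>K. B K)"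
    proof eventually_elim
      case (elim w)
      then obtain K L :: nat where "\<forall>n. S n w \<le> real K" "\<forall>n. - S n w \<le> real L"
        unfolding U_def V_def by (auto simp: not_less)
      then have "\<bar>S n w\<bar> \<le> real (max K L)" for n by (smt (verit, best) max.cobounded1 max.cobounded2 of_nat_mono)
      then show ?case using elim unfolding B_def by blast
    qed
    then have "prob (\<Union>K. B K) = 1" by (subst prob_eq_1) auto
    moreover have "(\<lambda>K. prob (B K)) \<longlonglongrightarrow> prob (\<Union>K. B K)"
      by (rule finite_Lim_measure_incseq) (auto simp: incseq_def B_def intro: order_trans)
    \<comment> \<open>With cosine at least 1/2 on \<open>B K\<close> and at least -1 elsewhere, the
      real part is at least \<open>3 / 2 * prob (B K) - 1\<close>; the threshold 3/4 turns this into
      1/8.\<close>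
    ultimately have "eventually (\<lambda>K. 3 / 4 < prob (B K)) sequentially"
      by (intro order_tendstoD) auto
    then obtain K where K: "3 / 4 < prob (B K)" by (auto simp: eventually_sequentially)
    \<comment> \<open>This scale gives \<open>\<bar>t * S n w\<bar> \<le> 1\<close> on
      \<open>B K\<close> for all n at once, hence cosine at least 1/2.\<close>
    define t where "t = 1 / (real K + 1)"
    have t: "t \<noteq> 0" "0 < t" by (auto simp: t_def)
    have low: "1 / 8 \<le> cmod (char (distr M borel (S n)) t)" for n
    proof -
      have ci: "integrable M (\<lambda>w. cos (t * S n w))"
        by (rule integrable_const_bound[where B=1]) auto
      have ii: "integrable M (\<lambda>w. 3 / 2 * indicator (B K) w :: real)"
        by (intro integrable_mult_right integrable_real_indicator) (simp_all add: emeasure_eq_measure)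
      have "3 / 2 * prob (B K) - 1 = expectation (\<lambda>w. 3 / 2 * indicator (B K) w) - expectation (\<lambda>w. 1)"
        by (subst integral_mult_right_zero) (simp add: prob_space)
      also have "\<dots> = expectation (\<lambda>w. 3 / 2 * indicator (B K) w - 1)"
        by (rule Bochner_Integration.integral_diff[OF ii, symmetric]) simp
      also have "\<dots> \<le> expectation (\<lambda>w. cos (t * S n w))"
      proof (intro integral_mono ci)
        fix w
        show "3 / 2 * indicator (B K) w - 1 \<le> cos (t * S n w)"
        proof (cases "w \<in> B K")
          case True
          then have "\<bar>S n w\<bar> \<le> real K + 1" unfolding B_def by (auto intro: order_trans)
          then have "\<bar>t * S n w\<bar> \<le> 1" unfolding t_def abs_mult by (simp add: field_simps)
          then have "(t * S n w)\<^sup>2 \<le> 1" by (simp add: abs_square_le_1)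
          moreover have "1 - (t * S n w)\<^sup>2 / 2 \<le> cos (t * S n w)" by (rule cos_ge_one_minus_square)
          ultimately show ?thesis using True by simp
        qed simp
        show "integrable M (\<lambda>w. 3 / 2 * indicator (B K) w - 1 :: real)"
          by (intro Bochner_Integration.integrable_diff ii) simp
      qed
      also have "\<dots> = Re (char (distr M borel (S n)) t)"
      proof -
        have ie: "integrable M (\<lambda>w. iexp (t * S n w))"
          by (rule integrable_const_bound[where B=1]) auto
        have "Re (char (distr M borel (S n)) t) = Re (expectation (\<lambda>w. iexp (t * S n w)))"
          unfolding char_def by (subst integral_distr) auto
        also have "\<dots> = expectation (\<lambda>w. Re (iexp (t * S n w)))"
          by (rule integral_Re[OF ie, symmetric])
        also have "\<dots> = expectation (\<lambda>w. cos (t * S n w))"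
          by (simp add: Re_exp)
        finally show ?thesis by simp
      qed
      also have "\<dots> \<le> cmod (char (distr M borel (S n)) t)" by (rule complex_Re_le_cmod)
      finally show ?thesis using K by simp
    qed
    have "char (distr M borel (S n)) t = (\<Prod>i<n. char (distr M borel (Y i)) t)" for n
      unfolding S_def using indep_vars_subset[OF indep, of "{..<n}"] by (intro char_distr_sum) auto
    then have "(\<lambda>n. cmod (char (distr M borel (S n)) t)) \<longlonglongrightarrow> 0"
      using char0[OF t(1)] by (simp add: prod_norm)
    then have "1 / 8 \<le> (0::real)" using low by (intro LIMSEQ_le_const) auto
    then show False by simp
  qed
  ultimately have "prob U = 1" by blast
  then have "AE w in M. w \<in> U" by (subst (asm) prob_eq_1) auto
  then show ?thesis
  proof eventually_elim
    case (elim w)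
    show ?case
    proof
      fix K :: real
      obtain L :: nat where "K < real L" using reals_Archimedean2 by blast
      moreover obtain n where "real L < S n w" using elim unfolding U_def by blast
      ultimately show "\<exists>n. K < (\<Sum>i<n. Y i w)" unfolding S_def by (meson order_less_trans)
    qed
  qed
qed

lemma AE_summable:
  fixes f :: "nat \<Rightarrow> 'a \<Rightarrow> real"
  assumes f: "\<And>j. integrable M (f j)" "\<And>j w. 0 \<le> f j w" and summ: "summable (\<lambda>j. \<integral>w. f j w \<partial>M)"
  shows "AE w in M. summable (\<lambda>j. f j w)"
proof -
  have [measurable]: "f j \<in> borel_measurable M" for j using f(1) by blast
  have "(\<integral>\<^sup>+w. (\<Sum>j. ennreal (f j w)) \<partial>M) = (\<Sum>j. \<integral>\<^sup>+w. ennreal (f j w) \<partial>M)"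
    by (rule nn_integral_suminf) simp
  also have "\<dots> = (\<Sum>j. ennreal (\<integral>w. f j w \<partial>M))"
    using f by (intro suminf_cong nn_integral_eq_integral) auto
  also have "\<dots> \<noteq> \<infinity>" using summ f by (subst suminf_ennreal2) (auto intro!: integral_nonneg_AE)
  finally have "AE w in M. (\<Sum>j. ennreal (f j w)) \<noteq> \<infinity>" by (intro nn_integral_PInf_AE) auto
  then show ?thesis by eventually_elim (rule summable_suminf_not_top, use f in auto)
qed

lemma unbounded_of_exp_tendsto_0:
  fixes b :: "nat \<Rightarrow> real"
  assumes "(\<lambda>j. exp (- (s * b j))) \<longlonglongrightarrow> 0" "0 < s"
  shows "\<exists>k. B < b k"
proof -
  have "eventually (\<lambda>j. exp (- (s * b j)) < exp (- (s * B))) sequentially"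
    using assms(1) by (rule order_tendstoD) simp
  then obtain j where "exp (- (s * b j)) < exp (- (s * B))" by (auto simp: eventually_sequentially)
  then show ?thesis using assms(2) by auto
qed

section \<open>Independent clocks: no persistent hub\<close>

text \<open>Functions of the past are defined on full clock families; filling the missing
  coordinates with 0 lets them be applied to a restricted block.\<close>

lemma measurable_extend_zero:
  "(\<lambda>f k. if k \<in> A then f k else 0) \<in> measurable (PiM A (\<lambda>_. borel)) (PiM UNIV (\<lambda>_. borel :: real measure))"
proof (rule measurable_PiM_single')
  fix k show "(\<lambda>f. if k \<in> A then f k else 0) \<in> borel_measurable (PiM A (\<lambda>_. borel :: real measure))"
    by (cases "k \<in> A") simp_all
qed (simp add: space_PiM)

text \<open>The clocks with the weights averaged out. That the law depends on the degree index alone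
  makes any two rows equal in law, which is the source of the symmetry of their differences.\<close>

locale clock_process = prob_space N for N :: "'b measure" +
  fixes X :: "'b \<Rightarrow> nat \<times> nat \<Rightarrow> real" and L :: "nat \<Rightarrow> real measure"
  assumes indep: "indep_vars (\<lambda>_. borel) (\<lambda>i z. X z i) UNIV"
    and law: "\<And>j d. distr N borel (\<lambda>z. X z (j, d)) = L d"
    and pos: "AE z in N. \<forall>i. 0 < X z i"
begin

lemma measurable_X [measurable]: "(\<lambda>z. X z i) \<in> borel_measurable N"
  using indep unfolding indep_vars_def by blast

lemma AE_X_pos: "AE z in N. 0 < X z i"
  using pos by eventually_elim blast

lemma integral_X:
  fixes h :: "real \<Rightarrow> real"
  assumes [measurable]: "h \<in> borel_measurable borel"
  shows "expectation (\<lambda>z. h (X z (j, d))) = (\<integral>x. h x \<partial>L d)"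
  unfolding law[of j d, symmetric] by (rule integral_distr[symmetric]) simp_all

lemma integrable_X:
  fixes h :: "real \<Rightarrow> real"
  assumes [measurable]: "h \<in> borel_measurable borel"
  shows "integrable N (\<lambda>z. h (X z (j, d))) \<longleftrightarrow> integrable (L d) h"
  unfolding law[of j d, symmetric] by (rule integrable_distr_eq[symmetric]) simp_all

text \<open>A function of the rows below \<open>j\<close> is put in front of row \<open>j\<close> as
  entry 0 of one independent sequence, the form with a random starting point used by
  \<open>convex_maximal_inequality\<close>.\<close>

lemma indep_past_row:
  assumes h: "h \<in> borel_measurable (PiM UNIV (\<lambda>_. borel))"
    and dep: "\<And>x y. (\<And>i d. i < j \<Longrightarrow> x (i, d) = y (i, d)) \<Longrightarrow> h x = h y"
  shows "indep_vars (\<lambda>_. borel) (\<lambda>i z. case i of 0 \<Rightarrow> h (X z) | Suc d \<Rightarrow> X z (j, d)) (UNIV :: nat set)"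
proof -
  define K :: "nat \<Rightarrow> (nat \<times> nat) set" where "K i = (case i of 0 \<Rightarrow> {..<j} \<times> UNIV | Suc d \<Rightarrow> {(j, d)})" for i
  define Y where "Y i f = (case i of 0 \<Rightarrow> h (\<lambda>k. if k \<in> K 0 then f k else 0) | Suc d \<Rightarrow> f (j, d))" for i f
  have "indep_vars (\<lambda>i. PiM (K i) (\<lambda>_. borel)) (\<lambda>i z. restrict (\<lambda>k. X z k) (K i)) UNIV"
    by (rule indep_vars_restrict[OF indep])
       (auto simp: disjoint_family_on_def K_def split: nat.split)
  then have "indep_vars (\<lambda>_. borel) (\<lambda>i z. Y i (restrict (\<lambda>k. X z k) (K i))) UNIV"
  proof (rule indep_vars_compose2)
    fix i
    show "Y i \<in> borel_measurable (PiM (K i) (\<lambda>_. borel))"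
    proof (cases i)
      case 0
      from measurable_compose[OF measurable_extend_zero h] show ?thesis by (simp add: 0 Y_def[abs_def])
    next
      case (Suc d)
      have "(\<lambda>f. f (j, d)) \<in> borel_measurable (PiM {(j, d)} (\<lambda>_. borel :: real measure))"
        by (rule measurable_component_singleton) simp
      then show ?thesis by (simp add: Suc Y_def[abs_def] K_def)
    qed
  qed
  moreover have "Y i (restrict (\<lambda>k. X z k) (K i)) = (case i of 0 \<Rightarrow> h (X z) | Suc d \<Rightarrow> X z (j, d))" for i z
    by (auto simp: Y_def K_def split: nat.split intro!: dep)
  ultimately show ?thesis by simp
qed

definition laplace :: "nat \<Rightarrow> real \<Rightarrow> real" where
  "laplace d s = (\<integral>x. exp (- (s * x)) \<partial>L d)"

lemma laplace_eq: "laplace d s = expectation (\<lambda>z. exp (- (s * X z (j, d))))"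
  unfolding laplace_def by (rule integral_X[symmetric]) simp

lemma integrable_exp: "0 \<le> s \<Longrightarrow> integrable N (\<lambda>z. exp (- (s * X z i)))"
  by (rule integrable_const_bound[where B=1]) (use AE_X_pos[of i] in \<open>auto elim!: eventually_mono\<close>)

lemma laplace_nonneg: "0 \<le> laplace d s"
  unfolding laplace_def by (rule integral_nonneg_AE) simp

lemma laplace_pos: "0 \<le> s \<Longrightarrow> 0 < laplace d s"
  unfolding laplace_eq[of d s 0] by (rule expectation_greater[OF integrable_exp]) simp_all

lemma laplace_antimono: "0 \<le> s \<Longrightarrow> s \<le> t \<Longrightarrow> laplace d t \<le> laplace d s"
  unfolding laplace_eq[of d _ 0]
proof (rule integral_mono_AE)
  assume st: "0 \<le> s" "s \<le> t"
  show "AE z in N. exp (- (t * X z (0, d))) \<le> exp (- (s * X z (0, d)))"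
    using AE_X_pos[of "(0, d)"] by eventually_elim (use st in \<open>auto intro!: mult_right_mono\<close>)
qed (auto intro!: integrable_exp)

lemma laplace_le_1: "0 \<le> s \<Longrightarrow> laplace d s \<le> 1"
  using laplace_antimono[of 0 s d] prob_space by (simp add: laplace_eq[of d 0 0])

lemma laplace_tendsto_0: "(\<lambda>n. laplace d (real n)) \<longlonglongrightarrow> 0"
proof -
  have "(\<lambda>n. expectation (\<lambda>z. exp (- (real n * X z (0, d))))) \<longlonglongrightarrow> expectation (\<lambda>z. 0)"
  proof (rule integral_dominated_convergence[where w="\<lambda>_. 1"])
    show "AE z in N. (\<lambda>n. exp (- (real n * X z (0, d)))) \<longlonglongrightarrow> 0"
      using AE_X_pos[of "(0, d)"]
    proof eventually_elim
      case (elim z)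
      have "(\<lambda>n. exp (- X z (0, d)) ^ n) \<longlonglongrightarrow> 0" using elim by (intro LIMSEQ_power_zero) simp
      then show ?case by (simp add: exp_of_nat_mult[symmetric])
    qed
    show "AE z in N. norm (exp (- (real n * X z (0, d)))) \<le> 1" for n
      using AE_X_pos[of "(0, d)"] by eventually_elim simp
  qed auto
  then show ?thesis by (simp add: laplace_eq[of d _ 0])
qed

end

text \<open>Dropping the trees in which some degree exceeds \<open>m\<close> keeps the mean finite without any
  integrability of the weights.\<close>

definition discount :: "nat \<Rightarrow> real \<Rightarrow> (nat \<times> nat \<Rightarrow> real) \<Rightarrow> nat \<Rightarrow> real" where
  "discount m s x j = (if \<forall>v\<in>{..j}. deg x j v \<le> m then exp (- (s * birth x j)) else 0)"

lemma discount_cong: "(\<And>i d. i < j \<Longrightarrow> x (i, d) = y (i, d)) \<Longrightarrow> discount m s x j = discount m s y j"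
  unfolding discount_def using birth_cong[of j x y] deg_cong[of j x y] by simp

lemma measurable_discount [measurable]:
  assumes x: "\<And>i. (\<lambda>w. x w i) \<in> borel_measurable M"
  shows "(\<lambda>w. discount m s (x w) j) \<in> borel_measurable M"
proof -
  note [measurable] = measurable_birth[OF x] measurable_deg[OF x]
  show ?thesis unfolding discount_def by measurable
qed

lemma discount_nonneg: "0 \<le> discount m s x j"
  by (simp add: discount_def)

lemma discount_le_1: "(\<And>i. 0 < x i) \<Longrightarrow> 0 \<le> s \<Longrightarrow> discount m s x j \<le> 1"
  using birth_nonneg[of x j] by (simp add: discount_def)

text \<open>Each node is charged to its parent, which gives a recursive inequality for the expected sum.\<close>

lemma sum_discount_le:
  assumes pos: "\<And>i. 0 < x i" and s: "0 \<le> s"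
  shows "(\<Sum>i\<le>k. discount m s x i) \<le> 1 + (\<Sum>j\<le>k. \<Sum>n\<in>{1..m}. discount m s x j * exp (- (s * (\<Sum>d<n. x (j, d)))))"
proof -
  define T where "T j n = discount m s x j * exp (- (s * (\<Sum>d<n. x (j, d))))" for j n
  have T0: "0 \<le> T j n" for j n by (simp add: T_def discount_nonneg)
  \<comment> \<open>For the induction only children already born, \<open>n \<le> deg x k j\<close>,
    are counted on the right, so the birth of \<open>Suc k\<close> is paid for by one new term of
    its parent. The 1 stands for the root.\<close>
  have "(\<Sum>i\<le>k. discount m s x i) \<le> 1 + (\<Sum>j\<le>k. \<Sum>n\<in>{1..min m (deg x k j)}. T j n)"
  proof (induction k)
    case 0
    then show ?case by (simp add: discount_def)
  next
    case (Suc k)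
    define q where "q = clock_tree x (Suc k)"
    have q: "q \<le> k" by (simp add: q_def clock_tree_Suc_le)
    define e where "e = deg x k q"
    have step: "discount m s x (Suc k) \<le> (if Suc e \<le> m then T q (Suc e) else 0)"
    proof (cases "\<forall>v\<in>{..Suc k}. deg x (Suc k) v \<le> m")
      case True
      have "deg x (Suc k) q \<le> m" using True q by simp
      then have e: "Suc e \<le> m" by (simp add: deg_Suc q_def[symmetric] e_def)
      \<comment> \<open>Degrees only grow, so the bound at \<open>Suc k\<close> already held when
        the parent \<open>q\<close> was born, and the discount of \<open>q\<close> is not cut to
        0.\<close>
      have "\<forall>v\<in>{..q}. deg x q v \<le> m"
      proof
        fix v assume "v \<in> {..q}"
        then have "deg x q v \<le> deg x (Suc k) v" "v \<le> Suc k" using q by (auto intro: deg_mono)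
        then show "deg x q v \<le> m" using True by (meson atMost_iff order_trans)
      qed
      then have "T q (Suc e) = exp (- (s * birth x q)) * exp (- (s * (\<Sum>d<Suc e. x (q, d))))"
        by (simp add: T_def discount_def)
      also have "\<dots> = exp (- (s * birth x (Suc k)))"
        by (simp add: birth_Suc q_def[symmetric] e_def hit_def mult_exp_exp algebra_simps)
      finally show ?thesis using e by (simp add: discount_def)
    qed (use T0 in \<open>auto simp: discount_def\<close>)
    have "(\<Sum>j\<le>Suc k. \<Sum>n\<in>{1..min m (deg x (Suc k) j)}. T j n) = (\<Sum>j\<le>k. \<Sum>n\<in>{1..min m (deg x (Suc k) j)}. T j n)"
      by simp
    also have "\<dots> = (\<Sum>j\<le>k. (\<Sum>n\<in>{1..min m (deg x k j)}. T j n) + (if j = q then if Suc e \<le> m then T q (Suc e) else 0 else 0))"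
    proof (intro sum.cong refl)
      fix j
      show "(\<Sum>n\<in>{1..min m (deg x (Suc k) j)}. T j n) = (\<Sum>n\<in>{1..min m (deg x k j)}. T j n) + (if j = q then if Suc e \<le> m then T q (Suc e) else 0 else 0)"
      proof (cases "j = q")
        case True
        then have d: "deg x (Suc k) j = Suc e" "deg x k j = e" by (auto simp: deg_Suc q_def e_def)
        show ?thesis
        proof (cases "Suc e \<le> m")
          case True
          then show ?thesis using d \<open>j = q\<close> by (simp add: min_absorb2)
        next
          case False
          then show ?thesis using d \<open>j = q\<close> by (simp add: min_absorb1)
        qed
      next
        case False
        then show ?thesis by (auto simp: deg_Suc q_def)
      qed
    qed
    also have "\<dots> = (\<Sum>j\<le>k. \<Sum>n\<in>{1..min m (deg x k j)}. T j n) + (if Suc e \<le> m then T q (Suc e) else 0)"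
      using q by (simp add: sum.distrib)
    finally show ?case using Suc.IH step by simp
  qed
  also have "(\<Sum>j\<le>k. \<Sum>n\<in>{1..min m (deg x k j)}. T j n) \<le> (\<Sum>j\<le>k. \<Sum>n\<in>{1..m}. T j n)"
    by (intro sum_mono sum_mono2) (auto simp: T0)
  finally show ?thesis by (simp add: T_def)
qed

context clock_process
begin

lemma integrable_discount: "0 \<le> s \<Longrightarrow> integrable N (\<lambda>z. discount m s (X z) j)"
  by (rule integrable_const_bound[where B=1])
     (use pos in \<open>auto elim!: eventually_mono intro: discount_le_1 simp: discount_nonneg\<close>)

lemma expectation_discount_row:
  assumes s: "0 \<le> s"
  shows "integrable N (\<lambda>z. discount m s (X z) j * exp (- (s * (\<Sum>d<n. X z (j, d)))))"
    and "expectation (\<lambda>z. discount m s (X z) j * exp (- (s * (\<Sum>d<n. X z (j, d))))) =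
      expectation (\<lambda>z. discount m s (X z) j) * (\<Prod>d<n. laplace d s)"
proof -
  define Y where "Y i z = (case i of 0 \<Rightarrow> discount m s (X z) j | Suc d \<Rightarrow> exp (- (s * X z (j, d))))" for i z
  have "indep_vars (\<lambda>_. borel) (\<lambda>i z. case i of 0 \<Rightarrow> discount m s (X z) j | Suc d \<Rightarrow> X z (j, d)) (UNIV :: nat set)"
    by (rule indep_past_row) (auto intro: discount_cong)
  then have "indep_vars (\<lambda>_. borel) (\<lambda>i z. (case i of 0 \<Rightarrow> (\<lambda>y. y) | Suc d \<Rightarrow> (\<lambda>y. exp (- (s * y))))
     (case i of 0 \<Rightarrow> discount m s (X z) j | Suc d \<Rightarrow> X z (j, d))) UNIV"
    by (rule indep_vars_compose2) (auto split: nat.split)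
  also have "(\<lambda>i z. (case i of 0 \<Rightarrow> (\<lambda>y. y) | Suc d \<Rightarrow> (\<lambda>y. exp (- (s * y))))
     (case i of 0 \<Rightarrow> discount m s (X z) j | Suc d \<Rightarrow> X z (j, d))) = Y"
    by (auto simp: Y_def fun_eq_iff split: nat.split)
  finally have ind: "indep_vars (\<lambda>_. borel) Y {..n}" by (rule indep_vars_subset) auto
  have Yi: "integrable N (Y i)" for i
    using s by (cases i) (simp_all add: Y_def[abs_def] integrable_discount integrable_exp)
  have prod: "(\<Prod>i\<le>n. Y i z) = discount m s (X z) j * exp (- (s * (\<Sum>d<n. X z (j, d))))" for z
    by (simp add: prod.atMost_shift Y_def exp_sum sum_distrib_left sum_negf[symmetric])
  show "integrable N (\<lambda>z. discount m s (X z) j * exp (- (s * (\<Sum>d<n. X z (j, d)))))"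
    using indep_vars_integrable[OF _ ind Yi] by (simp add: prod)
  have "expectation (\<lambda>z. \<Prod>i\<le>n. Y i z) = (\<Prod>i\<le>n. expectation (Y i))"
    by (rule indep_vars_lebesgue_integral[OF _ ind Yi]) simp
  also have "\<dots> = expectation (\<lambda>z. discount m s (X z) j) * (\<Prod>d<n. laplace d s)"
    by (simp add: prod.atMost_shift Y_def[abs_def] laplace_eq[of _ _ j])
  finally show "expectation (\<lambda>z. discount m s (X z) j * exp (- (s * (\<Sum>d<n. X z (j, d))))) =
      expectation (\<lambda>z. discount m s (X z) j) * (\<Prod>d<n. laplace d s)" by (simp add: prod)
qed

text \<open>The finite sum A of the means satisfies A \<le> 1 + A / 2, because the birth of a node
  is independent of its row. The resulting bound does not depend on \<open>k\<close> or
  \<open>m\<close>.\<close>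

lemma sum_expectation_discount_le:
  assumes s: "0 \<le> s" and half: "(\<Sum>n\<in>{1..m}. \<Prod>d<n. laplace d s) \<le> 1 / 2"
  shows "(\<Sum>j\<le>k. expectation (\<lambda>z. discount m s (X z) j)) \<le> 2"
proof -
  let ?A = "\<Sum>j\<le>k. expectation (\<lambda>z. discount m s (X z) j)"
  have "?A = expectation (\<lambda>z. \<Sum>j\<le>k. discount m s (X z) j)"
    using s by (subst Bochner_Integration.integral_sum) (auto intro: integrable_discount)
  also have "\<dots> \<le> expectation (\<lambda>z. 1 + (\<Sum>j\<le>k. \<Sum>n\<in>{1..m}. discount m s (X z) j * exp (- (s * (\<Sum>d<n. X z (j, d))))))"
  proof (rule integral_mono_AE)
    show "AE z in N. (\<Sum>j\<le>k. discount m s (X z) j) \<le> 1 + (\<Sum>j\<le>k. \<Sum>n\<in>{1..m}. discount m s (X z) j * exp (- (s * (\<Sum>d<n. X z (j, d)))))"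
      using pos by eventually_elim (rule sum_discount_le[OF _ s], blast)
  qed (use s in \<open>auto intro!: Bochner_Integration.integrable_add Bochner_Integration.integrable_sum integrable_discount expectation_discount_row\<close>)
  also have "\<dots> = 1 + (\<Sum>j\<le>k. \<Sum>n\<in>{1..m}. expectation (\<lambda>z. discount m s (X z) j) * (\<Prod>d<n. laplace d s))"
    using s expectation_discount_row[OF s]
    by (subst Bochner_Integration.integral_add)
       (auto simp: Bochner_Integration.integral_sum Bochner_Integration.integrable_sum prob_space)
  also have "\<dots> = 1 + ?A * (\<Sum>n\<in>{1..m}. \<Prod>d<n. laplace d s)"
    by (simp add: sum_distrib_left[symmetric] sum_distrib_right)
  also have "\<dots> \<le> 1 + ?A * (1 / 2)"
    using half by (intro add_left_mono mult_left_mono sum_nonneg integral_nonneg_AE) (auto simp: discount_nonneg)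
  finally show ?thesis by simp
qed

lemma AE_discount_tendsto_0:
  assumes s: "0 \<le> s" and half: "(\<Sum>n\<in>{1..m}. \<Prod>d<n. laplace d s) \<le> 1 / 2"
  shows "AE z in N. (\<lambda>j. discount m s (X z) j) \<longlonglongrightarrow> 0"
proof -
  have "summable (\<lambda>j. expectation (\<lambda>z. discount m s (X z) j))"
    by (rule bounded_imp_summable[OF _ sum_expectation_discount_le[OF s half]])
       (auto intro!: integral_nonneg_AE simp: discount_nonneg)
  from AE_summable[OF integrable_discount[OF s] discount_nonneg this] show ?thesis
    by eventually_elim (rule summable_LIMSEQ_zero)
qed

text \<open>Each product of transforms contains that of the first clock, which drops below 1 / (2 (m
  + 1)) for large s; the \<open>m\<close> products then sum to at most 1/2. If no degree ever
  exceeds \<open>m\<close>, the discounts are never cut, and their convergence to 0 drives the birth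
  times to infinity.\<close>

lemma AE_bounded_degree_imp_no_explosion:
  "AE z in N. \<forall>m. (\<forall>k. \<forall>v\<le>k. deg (X z) k v \<le> m) \<longrightarrow> (\<forall>B. \<exists>k. B < birth (X z) k)"
  unfolding AE_all_countable
proof
  fix m :: nat
  have "eventually (\<lambda>n. laplace 0 (real n) < 1 / (2 * real (Suc m))) sequentially"
    using laplace_tendsto_0[of 0] by (rule order_tendstoD) simp
  then obtain n0 where n0: "\<And>n. n0 \<le> n \<Longrightarrow> laplace 0 (real n) < 1 / (2 * real (Suc m))"
    by (auto simp: eventually_sequentially)
  define s where "s = real (Suc n0)"
  have s: "0 < s" "laplace 0 s < 1 / (2 * real (Suc m))" using n0[of "Suc n0"] by (auto simp: s_def)
  have "(\<Sum>n\<in>{1..m}. \<Prod>d<n. laplace d s) \<le> (\<Sum>n\<in>{1..m}. 1 / (2 * real (Suc m)))"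
  proof (rule sum_mono)
    fix n assume "n \<in> {1..m}"
    then have "(\<Prod>d<n. laplace d s) = laplace 0 s * (\<Prod>d\<in>{..<n}-{0}. laplace d s)"
      by (subst prod.remove[of _ 0]) auto
    also have "\<dots> \<le> laplace 0 s * 1"
      using s laplace_nonneg laplace_le_1 by (intro mult_left_mono prod_le_1) auto
    finally show "(\<Prod>d<n. laplace d s) \<le> 1 / (2 * real (Suc m))" using s by simp
  qed
  also have "\<dots> \<le> 1 / 2" by (simp add: field_simps)
  finally have "AE z in N. (\<lambda>j. discount m s (X z) j) \<longlonglongrightarrow> 0" using s by (intro AE_discount_tendsto_0) auto
  then show "AE z in N. (\<forall>k. \<forall>v\<le>k. deg (X z) k v \<le> m) \<longrightarrow> (\<forall>B. \<exists>k. B < birth (X z) k)"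
  proof eventually_elim
    case (elim z)
    show ?case
    proof (intro impI allI)
      fix B assume "\<forall>k. \<forall>v\<le>k. deg (X z) k v \<le> m"
      then have "discount m s (X z) j = exp (- (s * birth (X z) j))" for j by (simp add: discount_def)
      then have "(\<lambda>j. exp (- (s * birth (X z) j))) \<longlonglongrightarrow> 0" using elim by simp
      then show "\<exists>k. B < birth (X z) k" using s(1) by (rule unbounded_of_exp_tendsto_0)
    qed
  qed
qed


section \<open>Oscillation of the difference of two rows\<close>

lemma indep_var_X: "i \<noteq> j \<Longrightarrow> indep_var borel (\<lambda>z. X z i) borel (\<lambda>z. X z j)"
proof -
  assume ij: "i \<noteq> j"
  have "indep_var borel ((\<lambda>f. f i) \<circ> (\<lambda>z. restrict (\<lambda>k. X z k) {i})) borel ((\<lambda>f. f j) \<circ> (\<lambda>z. restrict (\<lambda>k. X z k) {j}))"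
    using ij by (intro indep_var_compose[OF indep_var_restrict[OF indep]]) auto
  then show ?thesis by (simp add: comp_def)
qed

text \<open>The right-hand side does not mention \<open>u\<close> and \<open>v\<close>; exchanging
  them yields the symmetry of the difference.\<close>

lemma difference_law:
  assumes "u \<noteq> v"
  shows "distr N borel (\<lambda>z. X z (u, d) - X z (v, d)) = distr (L d \<Otimes>\<^sub>M L d) borel (\<lambda>(a, b). a - b)"
proof -
  have "distr N borel (\<lambda>z. X z (u, d) - X z (v, d)) =
    distr (distr N (borel \<Otimes>\<^sub>M borel) (\<lambda>z. (X z (u, d), X z (v, d)))) borel (\<lambda>(a, b). a - b)"
    by (subst distr_distr) (auto simp: comp_def)
  also have "distr N (borel \<Otimes>\<^sub>M borel) (\<lambda>z. (X z (u, d), X z (v, d))) = L d \<Otimes>\<^sub>M L d"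
    using indep_var_X[of "(u, d)" "(v, d)"] assms by (simp add: indep_var_distribution_eq law)
  finally show ?thesis .
qed

lemma char_difference:
  assumes "u \<noteq> v"
  shows "char (distr N borel (\<lambda>z. X z (u, d) - X z (v, d))) t = char (L d) t * char (L d) (- t)"
proof -
  have "indep_var borel ((\<lambda>x. x) \<circ> (\<lambda>z. X z (u, d))) borel (uminus \<circ> (\<lambda>z. X z (v, d)))"
    using assms by (intro indep_var_compose[OF indep_var_X]) auto
  then have ind: "indep_var borel (\<lambda>z. X z (u, d)) borel (\<lambda>z. - X z (v, d))" by (simp add: comp_def)
  have "char (distr N borel (\<lambda>z. - X z (v, d))) t = char (distr N borel (\<lambda>z. X z (v, d))) (- t)"
    unfolding char_def by (subst (1 2) integral_distr) auto
  then show ?thesis using char_distr_add[OF ind, of t] by (simp add: law)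
qed

lemma AE_row_difference_unbounded:
  assumes char0: "\<And>t. t \<noteq> 0 \<Longrightarrow> (\<lambda>n. \<Prod>i<n. cmod (char (L i) t) * cmod (char (L i) (- t))) \<longlonglongrightarrow> 0"
    and uv: "u \<noteq> v"
  shows "AE z in N. \<forall>K. \<exists>n. K < (\<Sum>i<n. X z (u, i) - X z (v, i))"
proof (rule AE_symmetric_sum_unbounded)
  have "indep_vars (\<lambda>i. PiM {(u, i), (v, i)} (\<lambda>_. borel)) (\<lambda>i z. restrict (\<lambda>k. X z k) {(u, i), (v, i)}) UNIV"
    using uv by (intro indep_vars_restrict[OF indep]) (auto simp: disjoint_family_on_def)
  then have "indep_vars (\<lambda>_. borel) (\<lambda>i z. (\<lambda>f. f (u, i) - f (v, i)) (restrict (\<lambda>k. X z k) {(u, i), (v, i)})) UNIV"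
    by (rule indep_vars_compose2) auto
  then show "indep_vars (\<lambda>_. borel) (\<lambda>i z. X z (u, i) - X z (v, i)) UNIV" by simp
  show "distr N borel (\<lambda>z. - (X z (u, i) - X z (v, i))) = distr N borel (\<lambda>z. X z (u, i) - X z (v, i))" for i
    using difference_law[OF uv, of i] difference_law[of v u i] uv by simp
  show "(\<lambda>n. \<Prod>i<n. cmod (char (distr N borel (\<lambda>z. X z (u, i) - X z (v, i))) t)) \<longlonglongrightarrow> 0" if "t \<noteq> 0" for t
    using char0[OF that] by (simp add: char_difference[OF uv] norm_mult)
qed

theorem AE_no_persistent_hub:
  assumes char0: "\<And>t. t \<noteq> 0 \<Longrightarrow> (\<lambda>n. \<Prod>i<n. cmod (char (L i) t) * cmod (char (L i) (- t))) \<longlonglongrightarrow> 0"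
  shows "AE z in N. \<not> (\<exists>u. persistent_hub (clock_tree (X z)) u)"
proof -
  have "AE z in N. \<forall>u v. u \<noteq> v \<longrightarrow> (\<forall>K. \<exists>n. K < (\<Sum>i<n. X z (u, i) - X z (v, i)))"
    unfolding AE_all_countable
  proof (intro allI)
    fix u v :: nat
    show "AE z in N. u \<noteq> v \<longrightarrow> (\<forall>K. \<exists>n. K < (\<Sum>i<n. X z (u, i) - X z (v, i)))"
      using AE_row_difference_unbounded[OF char0, of u v] by (cases "u = v") auto
  qed
  then show ?thesis using pos AE_bounded_degree_imp_no_explosion
  proof eventually_elim
    case (elim z)
    define x where "x = X z"
    have x: "\<And>i. 0 < x i" using elim(2) unfolding x_def by blast
    have osc: "\<exists>n. K < (\<Sum>i<n. x (u, i) - x (v, i))" if "u \<noteq> v" for u v K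
      using elim(1) that unfolding x_def by blast
    \<comment> \<open>Unboundedness cannot be caused by the first \<open>m\<close> sums, which are
      bounded by \<open>C\<close>, so every level is exceeded at arbitrarily late indices.\<close>
    have osc': "\<exists>n\<ge>m. K < (\<Sum>i<n. x (u, i) - x (v, i))" if uv: "u \<noteq> v" for u v K m
    proof -
      define C where "C = (\<Sum>n\<le>m. \<bar>\<Sum>i<n. x (u, i) - x (v, i)\<bar>)"
      obtain n where n: "max C K < (\<Sum>i<n. x (u, i) - x (v, i))" using osc[OF uv] by blast
      have "\<bar>\<Sum>i<n. x (u, i) - x (v, i)\<bar> \<le> C" if "n \<le> m"
        unfolding C_def using that by (intro member_le_sum) auto
      then have "m \<le> n" using n by (cases "n \<le> m") auto
      then show ?thesis using n by auto
    qed
    have "\<not> persistent_hub (clock_tree x) u" for u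
    proof (cases "\<forall>B. \<exists>k. B < birth x k")
      case True
      \<comment> \<open>Any node other than \<open>u\<close> would serve as the rival; the level to
        exceed is the difference of the two birth times.\<close>
      have "\<exists>n\<ge>m. hit x (Suc u) n < hit x u n" for m
      proof -
        obtain n where "m \<le> n" "birth x (Suc u) - birth x u < (\<Sum>i<n. x (u, i) - x (Suc u, i))"
          using osc'[of u "Suc u" m] by auto
        then show ?thesis by (intro exI[of _ n]) (simp add: hit_def sum_subtractf)
      qed
      then show ?thesis using not_persistent_hub_overtaken[where x=x and v="Suc u" and u=u, OF x] True by blast
    next
      case False
      then obtain B where B: "\<And>k. birth x k \<le> B" by (auto simp: not_less)
      \<comment> \<open>A row dominates its difference with another positive row, so oscillation
        already forces every row to diverge.\<close>
      have "\<exists>n. C < (\<Sum>d<n. x (v, d))" for v C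
      proof -
        obtain n where "C < (\<Sum>i<n. x (v, i) - x (Suc v, i))" using osc[of v "Suc v"] by auto
        also have "\<dots> \<le> (\<Sum>i<n. x (v, i))" using x by (intro sum_mono) (auto intro: less_imp_le)
        finally show ?thesis by blast
      qed
      moreover have "\<exists>k v. v \<le> k \<and> m < deg x k v" for m
        using elim(3) False unfolding x_def by (meson not_less)
      ultimately show ?thesis using not_persistent_hub_bounded[where x=x, OF x B] by blast
    qed
    then show ?case by (simp add: x_def)
  qed
qed

end

section \<open>Independent clocks: a unique persistent hub\<close>

text \<open>By Fubini each section of the diagonal is a single point, which has measure 0 under the
  law of \<open>B\<close>.\<close>

lemma (in prob_space) AE_indep_neq:
  fixes A B :: "'a \<Rightarrow> real"
  assumes ind: "indep_var borel A borel B" and atom: "\<And>c. emeasure (distr M borel B) {c} = 0"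
  shows "AE w in M. A w \<noteq> B w"
proof -
  have [measurable]: "A \<in> borel_measurable M" "B \<in> borel_measurable M"
    using indep_var_rv1[OF ind] indep_var_rv2[OF ind] by auto
  interpret DB: prob_space "distr M borel B" by (rule prob_space_distr) simp
  have D: "{p. fst p = snd p} \<in> sets (borel \<Otimes>\<^sub>M (borel :: real measure))"
  proof -
    have "{p \<in> space (borel \<Otimes>\<^sub>M (borel :: real measure)). fst p = snd p} \<in> sets (borel \<Otimes>\<^sub>M borel)" by measurable
    then show ?thesis by (simp add: space_pair_measure)
  qed
  have "emeasure M {w \<in> space M. A w = B w} = emeasure (distr M (borel \<Otimes>\<^sub>M borel) (\<lambda>w. (A w, B w))) {p. fst p = snd p}"
    using D by (subst emeasure_distr) (auto intro!: arg_cong[where f="emeasure M"])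
  also have "distr M (borel \<Otimes>\<^sub>M borel) (\<lambda>w. (A w, B w)) = distr M borel A \<Otimes>\<^sub>M distr M borel B"
    using ind by (simp add: indep_var_distribution_eq)
  also have "emeasure \<dots> {p. fst p = snd p} = (\<integral>\<^sup>+a. emeasure (distr M borel B) (Pair a -` {p. fst p = snd p}) \<partial>distr M borel A)"
    using D by (intro DB.emeasure_pair_measure_alt) simp
  also have "\<dots> = (\<integral>\<^sup>+a. 0 \<partial>distr M borel A)"
  proof (rule nn_integral_cong)
    fix a :: real
    have "Pair a -` {p. fst p = snd p} = {a}" by auto
    then show "emeasure (distr M borel B) (Pair a -` {p. fst p = snd p}) = 0" using atom by simp
  qed
  finally have "emeasure M {w \<in> space M. A w = B w} = 0" by simp
  then have "AE w in M. w \<notin> {w \<in> space M. A w = B w}" by (intro AE_not_in) (simp add: null_sets_def)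
  then show ?thesis using AE_space by eventually_elim auto
qed

context clock_process
begin

text \<open>Summability at \<open>s\<close> bounds the discounted offspring but not by 1/2. Raising
  the argument to \<open>t\<close> makes the factor of the first clock small, while the product of
  the others stays below its value \<open>c i\<close> at \<open>s\<close>.\<close>

lemma exists_malthusian:
  assumes lam: "0 < s" and summ: "summable (\<lambda>i. \<Prod>j\<le>i. laplace j s)"
  shows "\<exists>t>0. \<forall>k. (\<Sum>j\<le>k. expectation (\<lambda>z. exp (- (t * birth (X z) j)))) \<le> 2"
proof -
  define c where "c i = (\<Prod>j\<in>{1..i}. laplace j s)" for i
  have c0: "0 \<le> c i" for i unfolding c_def by (intro prod_nonneg) (auto simp: laplace_nonneg)
  have split: "(\<Prod>j\<le>i. laplace j t) = laplace 0 t * (\<Prod>j\<in>{1..i}. laplace j t)" for i t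
  proof -
    have "{..i} = insert 0 {1..i}" by auto
    then show ?thesis by simp
  qed
  have "summable (\<lambda>i. (\<Prod>j\<le>i. laplace j s) / laplace 0 s)" by (rule summable_divide[OF summ])
  then have sc: "summable c" using laplace_pos[of s 0] lam by (simp add: split c_def[abs_def])
  define C where "C = suminf c"
  have C0: "0 \<le> C" unfolding C_def by (rule suminf_nonneg[OF sc c0])
  \<comment> \<open>The goal is \<open>laplace 0 t * C \<le> 1 / 2\<close>; using
    \<open>C + 1\<close> keeps the denominator positive.\<close>
  have "eventually (\<lambda>n. laplace 0 (real n) < 1 / (2 * (C + 1))) sequentially"
    using laplace_tendsto_0[of 0] C0 by (intro order_tendstoD) auto
  then obtain n0 where n0: "\<And>n. n0 \<le> n \<Longrightarrow> laplace 0 (real n) < 1 / (2 * (C + 1))"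
    by (auto simp: eventually_sequentially)
  obtain n1 :: nat where n1: "s < real n1" using reals_Archimedean2 by blast
  define t where "t = real (max n0 n1)"
  have t: "s \<le> t" "0 < t" "laplace 0 t < 1 / (2 * (C + 1))" using n0[of "max n0 n1"] n1 lam by (auto simp: t_def)
  have half: "(\<Sum>n\<in>{1..m}. \<Prod>d<n. laplace d t) \<le> 1 / 2" for m
  proof -
    have "(\<Sum>n\<in>{1..m}. \<Prod>d<n. laplace d t) = (\<Sum>i<m. \<Prod>d\<le>i. laplace d t)"
      by (rule sum.reindex_bij_witness[of _ Suc "\<lambda>n. n - 1"]) (auto simp: lessThan_Suc_atMost[symmetric])
    also have "\<dots> \<le> (\<Sum>i<m. laplace 0 t * c i)"
    proof (rule sum_mono)
      fix i
      have "(\<Prod>j\<in>{1..i}. laplace j t) \<le> c i"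
        unfolding c_def using t lam by (intro prod_mono conjI laplace_nonneg laplace_antimono) auto
      then show "(\<Prod>d\<le>i. laplace d t) \<le> laplace 0 t * c i"
        unfolding split by (intro mult_left_mono laplace_nonneg)
    qed
    also have "\<dots> = laplace 0 t * (\<Sum>i<m. c i)" by (simp add: sum_distrib_left)
    also have "\<dots> \<le> laplace 0 t * (C + 1)"
    proof -
      have "(\<Sum>i<m. c i) \<le> C" unfolding C_def by (rule sum_le_suminf[OF sc]) (auto simp: c0)
      then show ?thesis by (intro mult_left_mono laplace_nonneg) simp
    qed
    also have "\<dots> \<le> 1 / (2 * (C + 1)) * (C + 1)" using t C0 by (intro mult_right_mono) auto
    also have "\<dots> = 1 / 2" using C0 by simp
    finally show ?thesis .
  qed
  have "(\<Sum>j\<le>k. expectation (\<lambda>z. exp (- (t * birth (X z) j)))) \<le> 2" for k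
  proof -
    \<comment> \<open>A tree with nodes up to \<open>k\<close> has no degree above \<open>k\<close>,
      so truncation at \<open>k\<close> changes nothing and the uniform bound 2 carries
      over.\<close>
    have "discount k t x j = exp (- (t * birth x j))" if "j \<le> k" for j x
      using that deg_le[of x j] by (auto simp: discount_def intro: order_trans)
    then have "(\<Sum>j\<le>k. expectation (\<lambda>z. exp (- (t * birth (X z) j)))) = (\<Sum>j\<le>k. expectation (\<lambda>z. discount k t (X z) j))"
      by (intro sum.cong) auto
    also have "\<dots> \<le> 2" using t half by (intro sum_expectation_discount_le) auto
    finally show ?thesis .
  qed
  then show ?thesis using t by blast
qed

end

text \<open>The bound \<open>malthusian\<close> is supplied by \<open>exists_malthusian\<close>.
  Atomlessness concerns the first clock alone, since one such clock suffices to separate the limits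
  of two nodes.\<close>

locale square_integrable_clocks = clock_process +
  fixes t :: real
  assumes sq: "\<And>d. integrable (L d) (\<lambda>x. x\<^sup>2)"
    and sq_summable: "summable (\<lambda>d. \<integral>x. x\<^sup>2 \<partial>L d)"
    and t: "0 < t"
    and malthusian: "\<And>k. (\<Sum>j\<le>k. expectation (\<lambda>z. exp (- (t * birth (X z) j)))) \<le> 2"
    and atomless: "\<And>c. emeasure (L 0) {c} = 0"
begin

abbreviation square :: "nat \<Rightarrow> real" where
  "square d \<equiv> \<integral>x. x\<^sup>2 \<partial>L d"

abbreviation growth :: "nat \<Rightarrow> real" where
  "growth j \<equiv> expectation (\<lambda>z. exp (- (t * birth (X z) j)))"

definition mean :: "nat \<Rightarrow> real" where
  "mean d = (\<integral>x. x \<partial>L d)"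

lemma integrable_square: "integrable N (\<lambda>z. (X z (j, d))\<^sup>2)"
  using integrable_X[of "\<lambda>x. x\<^sup>2"] sq by simp

lemma integrable_clock: "integrable N (\<lambda>z. X z (j, d))"
  by (rule square_integrable_imp_integrable[OF _ integrable_square]) simp

lemma expectation_clock: "expectation (\<lambda>z. X z (j, d)) = mean d"
  unfolding mean_def by (rule integral_X) simp

lemma row_indep: "indep_vars (\<lambda>_. borel) (\<lambda>d z. X z (j, d)) UNIV"
  using indep_vars_reindex[OF indep, of "Pair j" UNIV] by (simp add: inj_on_def)

lemma AE_row_convergent: "AE z in N. convergent (\<lambda>n. \<Sum>d<n. X z (j, d) - mean d)"
proof (rule AE_convergent_sum)
  show "indep_vars (\<lambda>_. borel) (\<lambda>d z. X z (j, d) - mean d) UNIV"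
    by (rule indep_vars_compose2[OF row_indep]) simp
  have i2: "integrable N (\<lambda>z. (X z (j, d) - mean d)\<^sup>2)" for d
    unfolding power2_diff using integrable_square integrable_clock by auto
  show "integrable N (\<lambda>z. (X z (j, d) - mean d)\<^sup>2)" for d by (rule i2)
  show "integrable N (\<lambda>z. X z (j, d) - mean d)" for d using integrable_clock by auto
  show "expectation (\<lambda>z. X z (j, d) - mean d) = 0" for d
    using integrable_clock expectation_clock prob_space by simp
  show "summable (\<lambda>d. expectation (\<lambda>z. (X z (j, d) - mean d)\<^sup>2))"
  proof (rule summable_comparison_test[OF _ sq_summable], intro exI allI impI)
    fix d
    have "expectation (\<lambda>z. (X z (j, d) - mean d)\<^sup>2) = expectation (\<lambda>z. (X z (j, d))\<^sup>2) - (mean d)\<^sup>2"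
      using variance_eq[OF integrable_clock integrable_square, of j d] by (simp add: expectation_clock)
    also have "\<dots> \<le> expectation (\<lambda>z. (X z (j, d))\<^sup>2)" by simp
    also have "\<dots> = square d" by (rule integral_X) simp
    finally show "norm (expectation (\<lambda>z. (X z (j, d) - mean d)\<^sup>2)) \<le> square d"
      by (simp add: integral_nonneg_AE)
  qed
qed

definition total_square :: real where
  "total_square = (\<Sum>d. square d)"

text \<open>Positive variables have Gaussian-type lower deviations governed by the second moment:
  for y \<ge> 0 one has exp (- y) \<le> 1 - y + y^2 / 2, and 1 + a \<le> exp a after taking
  means.\<close>

lemma exp_moment: "expectation (\<lambda>z. exp (t * (mean d - X z (j, d)))) \<le> exp (t\<^sup>2 / 2 * square d)"
proof -
  have "expectation (\<lambda>z. exp (t * (mean d - X z (j, d)))) = exp (t * mean d) * expectation (\<lambda>z. exp (- (t * X z (j, d))))"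
    by (simp add: right_diff_distrib exp_diff exp_minus divide_inverse)
  also have "\<dots> \<le> exp (t * mean d) * exp (- (t * mean d) + t\<^sup>2 / 2 * square d)"
  proof (rule mult_left_mono)
    have "expectation (\<lambda>z. exp (- (t * X z (j, d)))) \<le> expectation (\<lambda>z. 1 - t * X z (j, d) + t\<^sup>2 / 2 * (X z (j, d))\<^sup>2)"
    proof (rule integral_mono_AE)
      show "AE z in N. exp (- (t * X z (j, d))) \<le> 1 - t * X z (j, d) + t\<^sup>2 / 2 * (X z (j, d))\<^sup>2"
        using AE_X_pos[of "(j, d)"]
      proof eventually_elim
        case (elim z)
        define y where "y = t * X z (j, d)"
        have y: "0 \<le> y" using elim t by (simp add: y_def)
        have "exp (- y) \<le> 1 - y + y\<^sup>2 / 2"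
        proof -
          have "1 + y + y\<^sup>2 / 2 \<le> exp y" using exp_lower_Taylor_quadratic[OF y] .
          then have "exp (- y) \<le> 1 / (1 + y + y\<^sup>2 / 2)"
            using y unfolding exp_minus inverse_eq_divide by (intro divide_left_mono) (auto intro!: add_pos_nonneg mult_pos_pos)
          also have "\<dots> \<le> 1 - y + y\<^sup>2 / 2"
          proof -
            \<comment> \<open>The product of the two quadratic polynomials is at least 1, which
              inverts the Taylor bound for \<open>exp y\<close>.\<close>
            have "(1 - y + y\<^sup>2 / 2) * (1 + y + y\<^sup>2 / 2) = 1 + (y\<^sup>2 / 2)\<^sup>2" by (simp add: power2_eq_square algebra_simps)
            moreover have "0 < 1 + y + y\<^sup>2 / 2" using y by (auto intro!: add_pos_nonneg)
            ultimately show ?thesis by (simp add: pos_divide_le_eq)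
          qed
          finally show ?thesis .
        qed
        then show ?case by (simp add: y_def power_mult_distrib)
      qed
    qed (use integrable_exp[of t] t integrable_clock integrable_square in auto)
    also have "\<dots> = 1 - t * mean d + t\<^sup>2 / 2 * square d"
      using integrable_clock integrable_square integral_X[of "\<lambda>x. x\<^sup>2" j d] by (simp add: prob_space expectation_clock)
    also have "\<dots> \<le> exp (- (t * mean d) + t\<^sup>2 / 2 * square d)"
      using exp_ge_add_one_self[of "- (t * mean d) + t\<^sup>2 / 2 * square d"] by linarith
    finally show "expectation (\<lambda>z. exp (- (t * X z (j, d)))) \<le> exp (- (t * mean d) + t\<^sup>2 / 2 * square d)" .
  qed simp
  also have "\<dots> = exp (t\<^sup>2 / 2 * square d)" by (simp add: exp_add[symmetric])
  finally show ?thesis .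
qed

lemma integrable_exp_birth: "integrable N (\<lambda>z. exp (- (t * birth (X z) j)))"
proof (rule integrable_const_bound[where B=1])
  show "AE z in N. norm (exp (- (t * birth (X z) j))) \<le> 1"
    using pos
  proof eventually_elim
    case (elim z)
    then have "0 \<le> birth (X z) j" by (intro birth_nonneg) blast
    then show ?case using t by simp
  qed
qed measurable

text \<open>If the centred sums of node \<open>0\<close> stay below \<open>K\<close>, only these nodes can ever be level with it.\<close>

definition contenders :: "real \<Rightarrow> nat \<Rightarrow> 'a set" where
  "contenders K j = {z \<in> space N. \<exists>n. birth (X z) j + (\<Sum>d<n. X z (j, d) - mean d) \<le> K}"

lemma measurable_contenders [measurable]: "contenders K j \<in> events"
  unfolding contenders_def by measurable

text \<open>A contender is a node for which the walk started at K - birth with steps mean - X ever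
  reaches 0. The maximal inequality for \<open>exp (t * s)\<close> applies: the start contributes
  \<open>exp (t * K) * growth j\<close>, and by \<open>exp_moment\<close> the steps contribute at
  most the middle factor, however many there are.\<close>

lemma prob_contenders:
  "prob (contenders K j) \<le> exp (t * K) * exp (t\<^sup>2 / 2 * total_square) * growth j"
proof -
  define Y where "Y i z = (case i of 0 \<Rightarrow> K - birth (X z) j | Suc d \<Rightarrow> mean d - X z (j, d))" for i z
  define S where "S n z = (\<Sum>i\<le>n. Y i z)" for n z
  have S: "S n z = K - birth (X z) j - (\<Sum>d<n. X z (j, d) - mean d)" for n z
    by (simp add: S_def sum.atMost_shift Y_def sum_subtractf)
  have "indep_vars (\<lambda>_. borel) (\<lambda>i z. case i of 0 \<Rightarrow> birth (X z) j | Suc d \<Rightarrow> X z (j, d)) (UNIV :: nat set)"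
    by (rule indep_past_row) (auto intro: birth_cong)
  then have "indep_vars (\<lambda>_. borel) (\<lambda>i z. (case i of 0 \<Rightarrow> (\<lambda>y. K - y) | Suc d \<Rightarrow> (\<lambda>y. mean d - y))
     (case i of 0 \<Rightarrow> birth (X z) j | Suc d \<Rightarrow> X z (j, d))) UNIV"
    by (rule indep_vars_compose2) (auto split: nat.split)
  also have "(\<lambda>i z. (case i of 0 \<Rightarrow> (\<lambda>y. K - y) | Suc d \<Rightarrow> (\<lambda>y. mean d - y))
     (case i of 0 \<Rightarrow> birth (X z) j | Suc d \<Rightarrow> X z (j, d))) = Y"
    by (auto simp: Y_def fun_eq_iff split: nat.split)
  finally have indY: "indep_vars (\<lambda>_. borel) Y I" for I by (rule indep_vars_subset) auto
  have Ym[measurable]: "Y i \<in> borel_measurable N" for i using indY[of UNIV] by (auto simp: indep_vars_def)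
  have [measurable]: "S n \<in> borel_measurable N" for n unfolding S_def by measurable
  have indE: "indep_vars (\<lambda>_. borel) (\<lambda>i z. exp (t * Y i z)) I" for I
    by (rule indep_vars_compose2[OF indY]) simp
  have Ei: "integrable N (\<lambda>z. exp (t * Y i z))" for i
  proof (cases i)
    case 0
    have "(\<lambda>z. exp (t * Y i z)) = (\<lambda>z. exp (t * K) * exp (- (t * birth (X z) j)))"
      by (simp add: 0 Y_def right_diff_distrib exp_diff exp_minus divide_inverse)
    then show ?thesis using integrable_exp_birth by simp
  next
    case (Suc d)
    have "(\<lambda>z. exp (t * Y i z)) = (\<lambda>z. exp (t * mean d) * exp (- (t * X z (j, d))))"
      by (simp add: Suc Y_def right_diff_distrib exp_diff exp_minus divide_inverse)
    then show ?thesis using integrable_exp[of t "(j, d)"] t by simp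
  qed
  have prodS: "exp (t * S n z) = (\<Prod>i\<le>n. exp (t * Y i z))" for n z
    by (simp add: S_def sum_distrib_left exp_sum)
  have SI: "integrable N (\<lambda>z. exp (t * S n z))" for n
    unfolding prodS by (rule indep_vars_integrable[OF _ indE Ei]) simp
  have ES: "expectation (\<lambda>z. exp (t * S n z)) \<le> exp (t * K) * exp (t\<^sup>2 / 2 * total_square) * growth j" for n
  proof -
    have "expectation (\<lambda>z. exp (t * S n z)) = (\<Prod>i\<le>n. expectation (\<lambda>z. exp (t * Y i z)))"
      unfolding prodS by (rule indep_vars_lebesgue_integral[OF _ indE Ei]) simp
    also have "\<dots> = expectation (\<lambda>z. exp (t * (K - birth (X z) j))) * (\<Prod>d<n. expectation (\<lambda>z. exp (t * (mean d - X z (j, d)))))"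
      by (simp add: prod.atMost_shift Y_def)
    also have "expectation (\<lambda>z. exp (t * (K - birth (X z) j))) = exp (t * K) * growth j"
      by (simp add: right_diff_distrib exp_diff exp_minus divide_inverse)
    also have "exp (t * K) * growth j * (\<Prod>d<n. expectation (\<lambda>z. exp (t * (mean d - X z (j, d)))))
       \<le> exp (t * K) * growth j * exp (t\<^sup>2 / 2 * total_square)"
    proof (rule mult_left_mono)
      have "(\<Prod>d<n. expectation (\<lambda>z. exp (t * (mean d - X z (j, d))))) \<le> (\<Prod>d<n. exp (t\<^sup>2 / 2 * square d))"
        by (intro prod_mono conjI exp_moment integral_nonneg_AE) auto
      also have "\<dots> = exp (t\<^sup>2 / 2 * (\<Sum>d<n. square d))" by (simp add: exp_sum sum_distrib_left)
      also have "\<dots> \<le> exp (t\<^sup>2 / 2 * total_square)"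
        unfolding total_square_def exp_le_cancel_iff
        by (intro mult_left_mono sum_le_suminf sq_summable) (auto intro!: integral_nonneg_AE)
      finally show "(\<Prod>d<n. expectation (\<lambda>z. exp (t * (mean d - X z (j, d))))) \<le> exp (t\<^sup>2 / 2 * total_square)" .
    qed (auto intro!: mult_nonneg_nonneg integral_nonneg_AE)
    finally show ?thesis by (simp add: mult_ac)
  qed
  define C where "C n = {z \<in> space N. \<exists>k\<le>n. 1 \<le> exp (t * S k z)}" for n
  have PC: "prob (C n) \<le> exp (t * K) * exp (t\<^sup>2 / 2 * total_square) * growth j" for n
  proof -
    have "prob (C n) \<le> expectation (\<lambda>z. exp (t * S n z)) / 1"
      unfolding C_def S_def
    proof (rule convex_maximal_inequality[where \<phi>="\<lambda>s. exp (t * s)" and \<psi>="\<lambda>s. t * exp (t * s)"])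
      show "indep_vars (\<lambda>_. borel) Y {..n}" by (rule indY)
      fix i :: nat assume "0 < i"
      then obtain d where i: "i = Suc d" by (cases i) auto
      show "integrable N (Y i)" using integrable_clock[of j d] by (simp add: i Y_def[abs_def])
      show "expectation (Y i) = 0" using integrable_clock[of j d] by (simp add: i Y_def[abs_def] expectation_clock prob_space)
    next
      fix s r :: real
      have "exp (t * s) * (1 + t * r) \<le> exp (t * s) * exp (t * r)"
        by (intro mult_left_mono exp_ge_add_one_self) simp
      then show "exp (t * s) + t * exp (t * s) * r \<le> exp (t * (s + r))"
        by (simp add: distrib_left exp_add mult_ac)
    qed (use SI in \<open>auto simp: S_def\<close>)
    then show ?thesis using ES[of n] by simp
  qed
  have "1 \<le> exp (t * S k z) \<longleftrightarrow> birth (X z) j + (\<Sum>d<k. X z (j, d) - mean d) \<le> K" for k z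
    unfolding S using t by (simp add: zero_le_mult_iff) linarith
  then have "contenders K j = {z \<in> space N. \<exists>n. 1 \<le> exp (t * S n z)}" unfolding contenders_def by auto
  then show ?thesis using prob_ex_le[of "\<lambda>n z. 1 \<le> exp (t * S n z)"] PC unfolding C_def by simp
qed

lemma summable_exp_birth: "summable (\<lambda>j. growth j)"
proof (rule bounded_imp_summable)
  show "0 \<le> growth j" for j by (rule integral_nonneg_AE) simp
  show "(\<Sum>j\<le>k. growth j) \<le> 2" for k by (rule malthusian)
qed

lemma AE_finite_contenders: "AE z in N. \<forall>K::nat. finite {j. z \<in> contenders (real K) j}"
  unfolding AE_all_countable
proof
  fix K :: nat
  have "AE z in N. eventually (\<lambda>j. z \<in> space N - contenders (real K) j) sequentially"
  proof (rule borel_cantelli_AE1)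
    show "summable (\<lambda>j. prob (contenders (real K) j))"
    proof (rule summable_comparison_test)
      show "summable (\<lambda>j. exp (t * K) * exp (t\<^sup>2 / 2 * total_square) * growth j)"
        by (rule summable_mult[OF summable_exp_birth])
      show "\<exists>n0. \<forall>j\<ge>n0. norm (prob (contenders (real K) j)) \<le> exp (t * K) * exp (t\<^sup>2 / 2 * total_square) * growth j"
        using prob_contenders[of "real K"] by auto
    qed
  qed (auto simp: emeasure_eq_measure)
  then show "AE z in N. finite {j. z \<in> contenders (real K) j}"
  proof eventually_elim
    case (elim z)
    then obtain n where "\<And>j. n \<le> j \<Longrightarrow> z \<notin> contenders (real K) j" by (auto simp: eventually_sequentially)
    then have "{j. z \<in> contenders (real K) j} \<subseteq> {..<n}" by (auto simp: not_le[symmetric])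
    then show ?case by (rule finite_subset) simp
  qed
qed

lemma AE_no_explosion: "AE z in N. \<forall>B. \<exists>k. B < birth (X z) k"
proof -
  have "AE z in N. summable (\<lambda>j. exp (- (t * birth (X z) j)))"
    by (rule AE_summable[OF integrable_exp_birth _ summable_exp_birth]) simp
  then show ?thesis
    by eventually_elim (use t in \<open>blast intro: unbounded_of_exp_tendsto_0 summable_LIMSEQ_zero\<close>)
qed

text \<open>Births up to \<open>v\<close> depend on the clocks of nodes below \<open>v\<close> only, so the limit is a variable
  independent of the clock \<open>(v, 0)\<close> minus that clock.\<close>

lemma AE_limit_nonzero:
  assumes uv: "u < v"
  shows "AE z in N. \<exists>l. l \<noteq> 0 \<and> (\<lambda>n. hit (X z) u n - hit (X z) v n) \<longlonglongrightarrow> l"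
proof -
  let ?W = "PiM UNIV (\<lambda>_. borel) :: (nat \<times> nat \<Rightarrow> real) measure"
  \<comment> \<open>Setting the clock \<open>(v, 0)\<close> to 0 removes it from the limit.
    \<open>lim\<close> takes some value even where the sequence diverges, so \<open>R\<close> is a
    measurable function everywhere.\<close>
  define R where "R x = lim (\<lambda>n. hit (x((v, 0) := 0)) u n - hit (x((v, 0) := 0)) v n)" for x
  have eq: "hit x u n - hit x v n = hit (x((v, 0) := 0)) u n - hit (x((v, 0) := 0)) v n - x (v, 0)" if "0 < n" for x n
  proof -
    have b: "birth x k = birth (x((v, 0) := 0)) k" if "k \<le> v" for k
      using that by (intro birth_cong) auto
    have "(\<Sum>d<n. x (v, d)) = x (v, 0) + (\<Sum>d\<in>{..<n}-{0}. x (v, d))"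
      using \<open>0 < n\<close> by (subst sum.remove[of _ 0]) auto
    moreover have "(\<Sum>d<n. (x((v, 0) := 0)) (v, d)) = (\<Sum>d\<in>{..<n}-{0}. x (v, d))"
      using \<open>0 < n\<close> by (subst sum.remove[of _ 0]) (auto intro!: sum.cong)
    moreover have "(\<Sum>d<n. (x((v, 0) := 0)) (u, d)) = (\<Sum>d<n. x (u, d))"
      using uv by (intro sum.cong) auto
    ultimately show ?thesis using b[of u] b[of v] uv by (simp add: hit_def)
  qed
  have upd: "(\<lambda>x. (x((v, 0) := 0)) i) \<in> borel_measurable ?W" for i
    by (cases "i = (v, 0)") simp_all
  have R: "R \<in> borel_measurable ?W"
  proof -
    have b: "(\<lambda>x. birth (x((v, 0) := 0)) k) \<in> borel_measurable ?W" for k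
      by (rule measurable_birth) (rule upd)
    show ?thesis unfolding R_def hit_def
      by (intro borel_measurable_lim_metric borel_measurable_diff borel_measurable_add borel_measurable_sum upd b)
  qed
  let ?A = "UNIV - {(v, 0 :: nat)}"
  define R' where "R' f = R (\<lambda>k. if k \<in> ?A then f k else 0)" for f :: "nat \<times> nat \<Rightarrow> real"
  have R'm: "R' \<in> borel_measurable (PiM ?A (\<lambda>_. borel))"
    using measurable_compose[OF measurable_extend_zero R, of ?A] by (simp add: R'_def[abs_def])
  have "indep_var borel (R' \<circ> (\<lambda>z. restrict (\<lambda>k. X z k) ?A)) borel ((\<lambda>f. f (v, 0)) \<circ> (\<lambda>z. restrict (\<lambda>k. X z k) {(v, 0)}))"
    by (intro indep_var_compose[OF indep_var_restrict[OF indep]] R'm) auto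
  moreover have "R' (restrict (\<lambda>k. X z k) ?A) = R (X z)" for z
  proof -
    have "(\<lambda>k. if k \<in> ?A then restrict (\<lambda>k. X z k) ?A k else 0)((v, 0) := 0) = (X z)((v, 0) := 0)"
      by (auto simp: fun_eq_iff)
    then show ?thesis unfolding R'_def R_def by (simp only:)
  qed
  ultimately have "indep_var borel (\<lambda>z. R (X z)) borel (\<lambda>z. X z (v, 0))" by (simp add: comp_def)
  then have "AE z in N. R (X z) \<noteq> X z (v, 0)"
    by (rule AE_indep_neq) (simp add: law atomless)
  then show ?thesis using AE_row_convergent[of u] AE_row_convergent[of v]
  proof eventually_elim
    case (elim z)
    define x where "x = X z"
    obtain a b where ab: "(\<lambda>n. \<Sum>d<n. x (u, d) - mean d) \<longlonglongrightarrow> a" "(\<lambda>n. \<Sum>d<n. x (v, d) - mean d) \<longlonglongrightarrow> b"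
      using elim(2,3) unfolding x_def convergent_def by blast
    \<comment> \<open>Both rows have the same means, which cancel in the difference, so the centred
      limits \<open>a\<close> and \<open>b\<close> determine its limit.\<close>
    have "(\<lambda>n. birth x u - birth x v + ((\<Sum>d<n. x (u, d) - mean d) - (\<Sum>d<n. x (v, d) - mean d))) \<longlonglongrightarrow> birth x u - birth x v + (a - b)"
      by (intro tendsto_intros ab)
    then have lim: "(\<lambda>n. hit x u n - hit x v n) \<longlonglongrightarrow> birth x u - birth x v + (a - b)"
      by (simp add: hit_def sum_subtractf algebra_simps)
    have "(\<lambda>n. hit x u n - hit x v n + x (v, 0)) \<longlonglongrightarrow> birth x u - birth x v + (a - b) + x (v, 0)"
      by (intro tendsto_intros lim)
    moreover have "eventually (\<lambda>n. hit x u n - hit x v n + x (v, 0) = hit (x((v, 0) := 0)) u n - hit (x((v, 0) := 0)) v n) sequentially"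
      using eventually_gt_at_top[of 0]
    proof eventually_elim
      case (elim n)
      then show ?case using eq[of n x] by linarith
    qed
    ultimately have "(\<lambda>n. hit (x((v, 0) := 0)) u n - hit (x((v, 0) := 0)) v n) \<longlonglongrightarrow> birth x u - birth x v + (a - b) + x (v, 0)"
      by (rule Lim_transform_eventually)
    then have "R x = birth x u - birth x v + (a - b) + x (v, 0)" unfolding R_def by (rule limI)
    then have "birth x u - birth x v + (a - b) \<noteq> 0" using elim(1) by (simp add: x_def)
    then show ?case using lim unfolding x_def by blast
  qed
qed

theorem AE_unique_persistent_hub: "AE z in N. \<exists>u. unique_persistent_hub (clock_tree (X z)) u"
proof -
  have "AE z in N. \<forall>u v. u < v \<longrightarrow> (\<exists>l. l \<noteq> 0 \<and> (\<lambda>n. hit (X z) u n - hit (X z) v n) \<longlonglongrightarrow> l)"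
    unfolding AE_all_countable
  proof (intro allI)
    fix u v :: nat
    show "AE z in N. u < v \<longrightarrow> (\<exists>l. l \<noteq> 0 \<and> (\<lambda>n. hit (X z) u n - hit (X z) v n) \<longlonglongrightarrow> l)"
      using AE_limit_nonzero[of u v] by (cases "u < v") auto
  qed
  then show ?thesis using pos AE_no_explosion AE_finite_contenders AE_row_convergent[of 0] AE_space
  proof eventually_elim
    case (elim z)
    define x where "x = X z"
    have x: "\<And>i. 0 < x i" using elim(2) unfolding x_def by blast
    have "Bseq (\<lambda>n. \<Sum>d<n. x (0, d) - mean d)" using elim(5) unfolding x_def by (rule convergent_imp_Bseq)
    then obtain K0 where K0: "\<And>n. \<bar>\<Sum>d<n. x (0, d) - mean d\<bar> \<le> K0" by (auto simp: Bseq_def)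
    \<comment> \<open>A natural level is taken because the contenders are controlled almost surely
      for countably many levels at once.\<close>
    obtain K :: nat where K: "K0 < real K" using reals_Archimedean2 by blast
    have "\<exists>u. unique_persistent_hub (clock_tree x) u"
    proof (rule unique_persistent_hub_exists[OF x])
      show "\<exists>k. B < birth x k" for B using elim(3) unfolding x_def by blast
      show "finite {j. z \<in> contenders (real K) j}" using elim(4) by blast
      fix v n assume "v \<notin> {j. z \<in> contenders (real K) j}"
      then have "real K < birth x v + (\<Sum>d<n. x (v, d) - mean d)"
        using elim(6) unfolding contenders_def x_def by (auto simp: not_le)
      then have "(\<Sum>d<n. x (0, d) - mean d) < birth x v + (\<Sum>d<n. x (v, d) - mean d)"
        using K0[of n] K by linarith
      then show "hit x 0 n < hit x v n" by (simp add: hit_def sum_subtractf)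
    next
      fix u v :: nat assume "u < v"
      then obtain l where l: "l \<noteq> 0" "(\<lambda>n. hit x u n - hit x v n) \<longlonglongrightarrow> l" using elim(1) unfolding x_def by blast
      consider "l < 0" | "0 < l" using l(1) by linarith
      then show "(\<exists>m. \<forall>n\<ge>m. hit x u n < hit x v n) \<or> (\<exists>m. \<forall>n\<ge>m. hit x v n < hit x u n)"
      proof cases
        case 1
        from order_tendstoD(2)[OF l(2) 1] show ?thesis by (auto simp: eventually_sequentially)
      next
        case 2
        from order_tendstoD(1)[OF l(2) 2] show ?thesis by (auto simp: eventually_sequentially)
      qed
    qed
    then show ?case by (simp add: x_def)
  qed
qed

end

section \<open>The clocks of the attachment tree\<close>

text \<open>With w = 1 - i s the integrand is exp (- w x), whose primitive - exp (- w x) / w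
  vanishes at infinity because w has real part 1.\<close>

lemma char_exp_law: "char exp_law s = 1 / (1 - \<i> * complex_of_real s)"
proof -
  define w where "w = 1 - \<i> * complex_of_real s"
  have Re: "Re w = 1" by (simp add: w_def)
  then have w0: "w \<noteq> 0" by auto
  define f where "f x = exp (- (w * complex_of_real x))" for x
  have nf: "norm (f x) = exp (- x)" for x by (simp add: f_def norm_exp_eq_Re Re)
  have fm[measurable]: "f \<in> borel_measurable borel"
    unfolding f_def by (intro borel_measurable_continuous_onI continuous_intros)
  have int: "set_integrable lborel {0<..} f"
  proof -
    have "integrable lborel (\<lambda>x. exponential_density 1 x)"
    proof (rule integrableI_nonneg)
      interpret prob_space exp_law by (rule prob_space_exp_law)
      show "(\<integral>\<^sup>+x. ennreal (exponential_density 1 x) \<partial>lborel) < \<infinity>"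
        using emeasure_space_1 by (simp add: emeasure_density)
    qed (auto simp: exponential_density_nonneg)
    then show ?thesis unfolding set_integrable_def
      by (rule Bochner_Integration.integrable_bound) (auto simp: nf indicator_def exponential_density_def)
  qed
  have ftc: "(LBINT x=0..\<infinity>. f x) = 0 - (- 1 / w)"
  proof (rule interval_integral_FTC_integrable[where F="\<lambda>x. - f x / w"])
    fix x :: real
    have "((\<lambda>z. - exp (- (w * z)) / w) has_field_derivative exp (- (w * of_real x))) (at (of_real x))"
      using w0 by (auto intro!: derivative_eq_intros)
    then show "((\<lambda>x. - f x / w) has_vector_derivative f x) (at x)"
      unfolding f_def by (rule has_vector_derivative_real_field)
    show "isCont f x" unfolding f_def by (intro continuous_intros)
  next
    show "set_integrable lborel (einterval 0 \<infinity>) f" using int by (simp add: zero_ereal_def)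
    have "((\<lambda>x. - f x / w) \<longlongrightarrow> - f 0 / w) (at_right 0)"
      unfolding f_def by (intro tendsto_intros) (use w0 in auto)
    then show "(((\<lambda>x. - f x / w) \<circ> real_of_ereal) \<longlongrightarrow> - 1 / w) (at_right 0)"
      by (simp add: zero_ereal_def ereal_tendsto_simps f_def)
    have "((\<lambda>x. - f x / w) \<longlongrightarrow> 0) at_top"
    proof (rule tendsto_norm_zero_cancel)
      have "((\<lambda>x::real. exp (- x) / norm w) \<longlongrightarrow> 0 / norm w) at_top"
        by (intro tendsto_divide tendsto_const filterlim_compose[OF exp_at_bot filterlim_uminus_at_bot_at_top]) (use w0 in auto)
      then show "((\<lambda>x. norm (- f x / w)) \<longlongrightarrow> 0) at_top" by (simp add: norm_divide nf)
    qed
    then show "(((\<lambda>x. - f x / w) \<circ> real_of_ereal) \<longlongrightarrow> 0) (at_left \<infinity>)"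
      by (simp add: ereal_tendsto_simps)
  qed simp
  have "char exp_law s = (\<integral>x. exponential_density 1 x *\<^sub>R iexp (s * x) \<partial>lborel)"
    unfolding char_def by (rule integral_density) (auto simp: exponential_density_nonneg)
  also have "\<dots> = (\<integral>x. indicator {0<..} x *\<^sub>R f x \<partial>lborel)"
  proof (rule integral_cong_AE)
    have "AE x in lborel. x \<noteq> (0::real)" by (rule AE_lborel_singleton)
    then show "AE x in lborel. exponential_density 1 x *\<^sub>R iexp (s * x) = indicator {0<..} x *\<^sub>R f x"
    proof eventually_elim
      case (elim x)
      have "complex_of_real (exp (- x)) * iexp (s * x) = f x"
        by (simp add: f_def w_def exp_of_real[symmetric] mult_exp_exp algebra_simps)
      then show ?case using elim by (auto simp: exponential_density_def indicator_def scaleR_conv_of_real)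
    qed
  qed auto
  also have "\<dots> = (LBINT x=0..\<infinity>. f x)"
    by (simp add: interval_lebesgue_integral_0_infty set_lebesgue_integral_def)
  finally show ?thesis by (simp add: ftc w_def)
qed

lemma nn_integral_exp_law_square:
  assumes "0 < f"
  shows "(\<integral>\<^sup>+y. ennreal ((y / f)\<^sup>2) \<partial>exp_law) = ennreal (2 / f\<^sup>2)"
proof -
  have "(\<integral>\<^sup>+y. ennreal ((y / f)\<^sup>2) \<partial>exp_law) = (\<integral>\<^sup>+y. ennreal (1 / f\<^sup>2) * ennreal (erlang_density 0 1 y * y ^ 2) \<partial>lborel)"
    by (subst nn_integral_density)
       (auto intro!: nn_integral_cong simp: ennreal_mult[symmetric] exponential_density_nonneg power_divide)
  also have "\<dots> = ennreal (1 / f\<^sup>2) * (\<integral>\<^sup>+y. ennreal (erlang_density 0 1 y * y ^ 2) \<partial>lborel)"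
    by (rule nn_integral_cmult) simp
  also have "(\<integral>\<^sup>+y. ennreal (erlang_density 0 1 y * y ^ 2) \<partial>lborel) = ennreal 2"
    by (subst nn_integral_erlang_ith_moment) (simp_all add: numeral_2_eq_2)
  also have "ennreal (1 / f\<^sup>2) * ennreal 2 = ennreal (1 / f\<^sup>2 * 2)" by (rule ennreal_mult[symmetric]) auto
  finally show ?thesis by simp
qed

text \<open>Since 1 - e \<le> exp (- e), the product is at most the exponential of minus a divergent
  sum.\<close>

lemma prod_tendsto_0_of_deficit:
  fixes b e :: "nat \<Rightarrow> real"
  assumes b: "\<And>i. 0 \<le> b i" "\<And>i. b i \<le> 1 - e i" and e: "\<And>i. 0 \<le> e i" "\<not> summable e"
  shows "(\<lambda>n. \<Prod>i<n. b i) \<longlonglongrightarrow> 0"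
proof (rule LIMSEQ_I)
  fix r :: real assume r: "0 < r"
  have "\<exists>n. - ln r < (\<Sum>i<n. e i)"
  proof (rule ccontr)
    assume "\<nexists>n. - ln r < (\<Sum>i<n. e i)"
    then have "(\<Sum>i\<le>n. e i) \<le> - ln r" for n by (metis lessThan_Suc_atMost not_less)
    then have "summable e" by (intro bounded_imp_summable[of e "- ln r"] e)
    then show False using e(2) by simp
  qed
  then obtain n0 where n0: "- ln r < (\<Sum>i<n0. e i)" by blast
  show "\<exists>no. \<forall>n\<ge>no. norm ((\<Prod>i<n. b i) - 0) < r"
  proof (intro exI[of _ n0] allI impI)
    fix n assume n: "n0 \<le> n"
    have "(\<Prod>i<n. b i) \<le> (\<Prod>i<n. exp (- e i))"
    proof (intro prod_mono conjI b(1))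
      fix i
      have "b i \<le> 1 + - e i" using b(2)[of i] by simp
      also have "\<dots> \<le> exp (- e i)" by (rule exp_ge_add_one_self)
      finally show "b i \<le> exp (- e i)" .
    qed
    also have "\<dots> = exp (- (\<Sum>i<n. e i))" by (simp add: exp_sum[symmetric] sum_negf)
    also have "\<dots> \<le> exp (- (\<Sum>i<n0. e i))" using e n by (simp add: sum_mono2)
    also have "\<dots> < exp (ln r)" using n0 by simp
    finally show "norm ((\<Prod>i<n. b i) - 0) < r" using r b(1) by (simp add: prod_nonneg)
  qed
qed

section \<open>The law of a single clock\<close>

definition clock_law :: "'a measure \<Rightarrow> (nat \<Rightarrow> nat \<Rightarrow> 'a \<Rightarrow> real) \<Rightarrow> nat \<Rightarrow> real measure" where
  "clock_law M F d = distr (clock_space M) borel (\<lambda>z. clock F z (0, d))"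

lemma measurable_exp_clocks_component: "(\<lambda>e. e i) \<in> borel_measurable exp_clocks"
  by measurable

lemma square_ratio_le_1: "t\<^sup>2 / (f\<^sup>2 + t\<^sup>2) \<le> (1 :: real)"
  using sum_power2_ge_zero[of f t] by (auto simp: divide_le_eq_1 less_le)

context gpa_process
begin

lemma weight_law: "distr M borel (F j d) = distr M borel (F 0 d)"
proof -
  let ?W = "PiM UNIV (\<lambda>_::nat. borel :: real measure)"
  have "distr M borel (F j d) = distr (distr M ?W (\<lambda>\<omega> d. F j d \<omega>)) borel (\<lambda>f. f d)" for j
    by (subst distr_distr) (auto simp: comp_def intro!: measurable_PiM_single' simp: space_PiM)
  moreover have "distr M ?W (\<lambda>\<omega> d. F j d \<omega>) = distr M ?W (\<lambda>\<omega> d. F 0 d \<omega>)"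
    using gpa unfolding gpa_tree_def by blast
  ultimately show ?thesis by metis
qed

lemma AE_weight_pos: "AE w in M. 0 < F j d w"
  using gpa by (simp add: gpa_tree_def)

lemma exp_clocks_component: "distr exp_clocks borel (\<lambda>e. e i) = exp_law"
proof -
  have "distr exp_clocks borel (\<lambda>e. e i) = distr exp_clocks exp_law (\<lambda>e. e i)"
    by (rule distr_cong) simp_all
  also have "\<dots> = exp_law" by (rule distr_PiM_component) (auto intro: prob_space_exp_law)
  finally show ?thesis .
qed

text \<open>Given the weights, a clock is a standard exponential variable divided by its weight;
  averaging over the weight then replaces row \<open>j\<close> by row 0 through
  \<open>weight_law\<close>.\<close>

lemma nn_integral_clock:
  assumes [measurable]: "h \<in> borel_measurable borel"
  shows "(\<integral>\<^sup>+z. h (clock F z (j, d)) \<partial>clock_space M) = (\<integral>\<^sup>+w. \<integral>\<^sup>+y. h (y / F 0 d w) \<partial>exp_law \<partial>M)"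
proof -
  interpret C: prob_space exp_clocks by (rule prob_space_exp_clocks)
  interpret E: prob_space exp_law by (rule prob_space_exp_law)
  have m: "(\<lambda>z. h (clock F z (j, d))) \<in> borel_measurable (M \<Otimes>\<^sub>M exp_clocks)"
    using measurable_clock[of "(j, d)"] unfolding clock_space_def by measurable
  define g where "g f = (\<integral>\<^sup>+y. h (y / f) \<partial>exp_law)" for f
  have [measurable]: "g \<in> borel_measurable borel" unfolding g_def by measurable
  have "(\<integral>\<^sup>+z. h (clock F z (j, d)) \<partial>clock_space M) = (\<integral>\<^sup>+w. \<integral>\<^sup>+e. h (clock F (w, e) (j, d)) \<partial>exp_clocks \<partial>M)"
    unfolding clock_space_def by (rule C.nn_integral_fst[OF m, symmetric])
  also have "\<dots> = (\<integral>\<^sup>+w. g (F j d w) \<partial>M)"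
  proof (rule nn_integral_cong)
    fix w
    have "(\<integral>\<^sup>+e. h (clock F (w, e) (j, d)) \<partial>exp_clocks) = (\<integral>\<^sup>+y. h (y / F j d w) \<partial>distr exp_clocks borel (\<lambda>e. e (j, d)))"
      using measurable_exp_clocks_component by (subst nn_integral_distr) (auto simp: clock_def weights_def)
    then show "(\<integral>\<^sup>+e. h (clock F (w, e) (j, d)) \<partial>exp_clocks) = g (F j d w)"
      unfolding exp_clocks_component g_def .
  qed
  also have "\<dots> = (\<integral>\<^sup>+f. g f \<partial>distr M borel (F j d))" by (subst nn_integral_distr) auto
  also have "\<dots> = (\<integral>\<^sup>+f. g f \<partial>distr M borel (F 0 d))" unfolding weight_law[of j d] ..
  also have "\<dots> = (\<integral>\<^sup>+w. g (F 0 d w) \<partial>M)" by (subst nn_integral_distr) auto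
  finally show ?thesis unfolding g_def .
qed

lemma nn_integral_clock_law:
  assumes [measurable]: "h \<in> borel_measurable borel"
  shows "(\<integral>\<^sup>+x. h x \<partial>clock_law M F d) = (\<integral>\<^sup>+w. \<integral>\<^sup>+y. h (y / F 0 d w) \<partial>exp_law \<partial>M)"
  unfolding clock_law_def using nn_integral_clock[of h 0 d] measurable_clock[of "(0, d)"]
  by (subst nn_integral_distr) auto

lemma clock_law_eq: "distr (clock_space M) borel (\<lambda>z. clock F z (j, d)) = clock_law M F d"
proof (rule measure_eqI)
  fix A assume "A \<in> sets (distr (clock_space M) borel (\<lambda>z. clock F z (j, d)))"
  then have A[measurable]: "A \<in> sets borel" by simp
  have "emeasure (distr (clock_space M) borel (\<lambda>z. clock F z (j, d))) A = (\<integral>\<^sup>+z. indicator A (clock F z (j, d)) \<partial>clock_space M)" for j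
    by (subst nn_integral_indicator[symmetric], simp, subst nn_integral_distr) auto
  then show "emeasure (distr (clock_space M) borel (\<lambda>z. clock F z (j, d))) A = emeasure (clock_law M F d) A"
    unfolding clock_law_def by (simp only: nn_integral_clock[OF borel_measurable_indicator[OF A]])
qed (simp add: clock_law_def)

text \<open>Given the weights the clocks are independent, each depending on its own weight; as the
  weights are independent too, the mean of the product of conditional probabilities
  factorises.\<close>

lemma clock_indep: "prob_space.indep_vars (clock_space M) (\<lambda>_. borel) (\<lambda>i z. clock F z i) UNIV"
proof -
  interpret A: prob_space M by (rule gpa_prob_space)
  interpret N: prob_space "clock_space M" by (rule prob_space_clock_space)
  interpret C: prob_space exp_clocks by (rule prob_space_exp_clocks)
  interpret E: prob_space exp_law by (rule prob_space_exp_law)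
  let ?W = "PiM UNIV (\<lambda>_::nat \<times> nat. borel :: real measure)"
  have Lp: "prob_space (clock_law M F d)" for d unfolding clock_law_def by (rule N.prob_space_distr) simp
  have Ls: "sets (clock_law M F d) = sets borel" for d by (simp add: clock_law_def)
  have "distr (clock_space M) ?W (clock F) = PiM UNIV (\<lambda>i. clock_law M F (snd i))"
  proof (rule measure_eqI_PiM_infinite[where M="\<lambda>i. clock_law M F (snd i)" and I=UNIV])
    have cm: "clock F \<in> measurable (clock_space M) ?W"
      by (rule measurable_PiM_single') (auto simp: space_PiM)
    have sP: "sets (PiM UNIV (\<lambda>i. clock_law M F (snd i))) = sets ?W"
      by (rule sets_PiM_cong) (simp_all add: Ls)
    show "sets (distr (clock_space M) ?W (clock F)) = sets (PiM UNIV (\<lambda>i. clock_law M F (snd i)))"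
      by (simp add: sP)
    show "finite_measure (distr (clock_space M) ?W (clock F))"
      by (rule prob_space.finite_measure[OF N.prob_space_distr[OF cm]])
    fix A :: "nat \<times> nat \<Rightarrow> real set" and J :: "(nat \<times> nat) set"
    assume J: "finite J" "\<And>i. i \<in> J \<Longrightarrow> A i \<in> sets (clock_law M F (snd i))"
    have A[measurable]: "i \<in> J \<Longrightarrow> A i \<in> sets borel" for i using J(2)[of i] by (simp add: Ls)
    define R where "R = prod_emb UNIV (\<lambda>i. clock_law M F (snd i)) J (Pi\<^sub>E J A)"
    have R: "R \<in> sets ?W" unfolding R_def sP[symmetric] using J by (intro sets_PiM_I) auto
    have Rs: "space (clock_law M F d) = UNIV" for d by (simp add: clock_law_def)
    have R_iff: "g \<in> R \<longleftrightarrow> (\<forall>i\<in>J. g i \<in> A i)" for g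
      unfolding R_def by (auto simp: prod_emb_def space_PiM PiE_iff Rs)
    \<comment> \<open>The conditional probability that clock \<open>i\<close> lies in
      \<open>A i\<close> when its weight is \<open>f\<close>.\<close>
    define h where "h i f = emeasure exp_law {y. y / f \<in> A i}" for i f
    have pm: "{y. y / f \<in> A i} \<in> sets borel" if "i \<in> J" for i f
    proof -
      have "(\<lambda>y. y / f) -` A i \<inter> space borel \<in> sets borel"
        using A[OF that] by (intro measurable_sets[of _ borel borel]) auto
      then show ?thesis by (simp add: vimage_def)
    qed
    have hi: "h i f = (\<integral>\<^sup>+y. indicator (A i) (y / f) \<partial>exp_law)" if "i \<in> J" for i f
    proof -
      have "h i f = (\<integral>\<^sup>+y. indicator {y. y / f \<in> A i} y \<partial>exp_law)"
        unfolding h_def using pm[OF that] by (subst nn_integral_indicator) auto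
      then show ?thesis by (simp add: indicator_def)
    qed
    have hm: "h i \<in> borel_measurable borel" if "i \<in> J" for i
    proof -
      note [measurable] = A[OF that]
      show ?thesis unfolding hi[OF that, abs_def] by measurable
    qed
    have "emeasure (distr (clock_space M) ?W (clock F)) R = emeasure (clock_space M) {z \<in> space (clock_space M). \<forall>i\<in>J. clock F z i \<in> A i}"
      by (subst emeasure_distr[OF cm R]) (auto intro!: arg_cong[where f="emeasure (clock_space M)"] simp: R_iff)
    also have "\<dots> = (\<integral>\<^sup>+w. emeasure exp_clocks (Pair w -` {z \<in> space (clock_space M). \<forall>i\<in>J. clock F z i \<in> A i}) \<partial>M)"
    proof -
      have "{z \<in> space (clock_space M). \<forall>i\<in>J. clock F z i \<in> A i} = clock F -` R \<inter> space (clock_space M)"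
        by (auto simp: R_iff)
      also have "\<dots> \<in> sets (clock_space M)" by (rule measurable_sets[OF cm R])
      finally show ?thesis using C.emeasure_pair_measure_alt[of _ M] unfolding clock_space_def by simp
    qed
    also have "\<dots> = (\<integral>\<^sup>+w. (\<Prod>i\<in>J. h i (weights F w i)) \<partial>M)"
    proof (rule nn_integral_cong)
      fix w assume "w \<in> space M"
      then have "Pair w -` {z \<in> space (clock_space M). \<forall>i\<in>J. clock F z i \<in> A i}
         = prod_emb UNIV (\<lambda>_. exp_law) J (Pi\<^sub>E J (\<lambda>i. {y. y / weights F w i \<in> A i}))"
        by (auto simp: clock_space_def space_pair_measure space_PiM clock_def prod_emb_def PiE_iff)
      moreover have "emeasure exp_clocks (prod_emb UNIV (\<lambda>_. exp_law) J (Pi\<^sub>E J (\<lambda>i. {y. y / weights F w i \<in> A i})))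
         = (\<Prod>i\<in>J. h i (weights F w i))"
        unfolding h_def using J(1) pm by (intro emeasure_PiM_emb) (auto intro: prob_space_exp_law)
      ultimately show "emeasure exp_clocks (Pair w -` {z \<in> space (clock_space M). \<forall>i\<in>J. clock F z i \<in> A i}) = (\<Prod>i\<in>J. h i (weights F w i))"
        by simp
    qed
    also have "\<dots> = (\<Prod>i\<in>J. \<integral>\<^sup>+w. h i (weights F w i) \<partial>M)"
    proof (rule A.indep_vars_nn_integral[OF J(1)])
      have "A.indep_vars (\<lambda>_. borel) (\<lambda>i w. weights F w i) UNIV"
        using gpa by (simp add: gpa_tree_def weights_def case_prod_beta')
      then have "A.indep_vars (\<lambda>_. borel) (\<lambda>i w. weights F w i) J" by (rule A.indep_vars_subset) auto
      then show "A.indep_vars (\<lambda>_. borel) (\<lambda>i w. h i (weights F w i)) J"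
        by (rule A.indep_vars_compose2) (rule hm)
    qed auto
    also have "\<dots> = (\<Prod>i\<in>J. emeasure (clock_law M F (snd i)) (A i))"
    proof (rule prod.cong[OF refl])
      fix i assume i: "i \<in> J"
      obtain j d where jd: "i = (j, d)" by (cases i)
      note Ai = A[OF i]
      have "(\<integral>\<^sup>+w. h i (weights F w i) \<partial>M) = (\<integral>\<^sup>+f. h i f \<partial>distr M borel (F j d))"
        using hm[OF i] by (subst nn_integral_distr) (auto simp: jd weights_def)
      also have "\<dots> = (\<integral>\<^sup>+w. h i (F 0 d w) \<partial>M)"
        unfolding weight_law[of j d] using hm[OF i] by (subst nn_integral_distr) auto
      also have "\<dots> = (\<integral>\<^sup>+x. indicator (A i) x \<partial>clock_law M F d)"
        unfolding hi[OF i] by (rule nn_integral_clock_law[OF borel_measurable_indicator[OF Ai], symmetric])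
      also have "\<dots> = emeasure (clock_law M F d) (A i)" using Ai by (subst nn_integral_indicator) (auto simp: Ls)
      finally show "(\<integral>\<^sup>+w. h i (weights F w i) \<partial>M) = emeasure (clock_law M F (snd i)) (A i)" by (simp add: jd)
    qed
    also have "\<dots> = emeasure (PiM UNIV (\<lambda>i. clock_law M F (snd i))) R"
      unfolding R_def using J by (intro emeasure_PiM_emb[symmetric] Lp) auto
    finally show "emeasure (distr (clock_space M) ?W (clock F)) (prod_emb UNIV (\<lambda>i. clock_law M F (snd i)) J (Pi\<^sub>E J A)) =
      emeasure (PiM UNIV (\<lambda>i. clock_law M F (snd i))) (prod_emb UNIV (\<lambda>i. clock_law M F (snd i)) J (Pi\<^sub>E J A))"
      unfolding R_def .
  qed simp
  moreover have "clock_law M F (snd i) = distr (clock_space M) borel (\<lambda>z. clock F z i)" for i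
    by (cases i) (simp add: clock_law_eq)
  ultimately have "distr (clock_space M) ?W (\<lambda>z. \<lambda>i\<in>UNIV. clock F z i) = PiM UNIV (\<lambda>i. distr (clock_space M) borel (\<lambda>z. clock F z i))"
    by (simp add: restrict_def)
  then show ?thesis by (intro N.indep_vars_iff_distr_eq_PiM[THEN iffD2]) auto
qed

lemma AE_clock_pos: "AE z in clock_space M. \<forall>i. 0 < clock F z i"
  unfolding AE_all_countable
proof
  fix i :: "nat \<times> nat"
  obtain j d where i: "i = (j, d)" by (cases i)
  have "(\<integral>\<^sup>+z. indicator {..0} (clock F z (j, d)) \<partial>clock_space M) = (\<integral>\<^sup>+w. \<integral>\<^sup>+y. indicator {..0} (y / F 0 d w) \<partial>exp_law \<partial>M)"
    by (rule nn_integral_clock) simp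
  also have "\<dots> = (\<integral>\<^sup>+w. 0 \<partial>M)"
  proof (rule nn_integral_cong_AE)
    show "AE w in M. (\<integral>\<^sup>+y. indicator {..0} (y / F 0 d w) \<partial>exp_law) = 0"
      using AE_weight_pos[of 0 d]
    proof eventually_elim
      case (elim w)
      have "(\<integral>\<^sup>+y. indicator {..0} (y / F 0 d w) \<partial>exp_law) = (\<integral>\<^sup>+y. 0 \<partial>exp_law)"
        by (rule nn_integral_cong_AE)
           (use AE_exp_law_pos elim in \<open>auto elim!: eventually_mono simp: indicator_def divide_le_0_iff\<close>)
      then show ?case by simp
    qed
  qed
  finally have "(\<integral>\<^sup>+z. indicator {..0} (clock F z (j, d)) \<partial>clock_space M) = 0" by simp
  then have "AE z in clock_space M. indicator {..0} (clock F z (j, d)) = (0::ennreal)"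
    by (subst (asm) nn_integral_0_iff_AE) auto
  then show "AE z in clock_space M. 0 < clock F z i"
    unfolding i by eventually_elim (auto simp: indicator_def split: if_splits)
qed

lemma clock_process_gpa: "clock_process (clock_space M) (clock F) (clock_law M F)"
proof -
  interpret N: prob_space "clock_space M" by (rule prob_space_clock_space)
  show ?thesis by unfold_locales (rule clock_indep clock_law_eq AE_clock_pos)+
qed

text \<open>The transform 1 / (1 + s / f) of an exponential variable of rate f, averaged over the
  weight; it identifies the factors in condition (b).\<close>

lemma laplace_clock_law:
  assumes s: "0 < s"
  shows "clock_process.laplace (clock_law M F) d s = (\<integral>w. F 0 d w / (F 0 d w + s) \<partial>M)"
proof -
  interpret clock_process "clock_space M" "clock F" "clock_law M F" by (rule clock_process_gpa)
  interpret A: prob_space M by (rule gpa_prob_space)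
  have "laplace d s = enn2real (\<integral>\<^sup>+x. ennreal (exp (- (s * x))) \<partial>clock_law M F d)"
    unfolding laplace_def by (rule integral_eq_nn_integral) (auto simp: clock_law_def)
  also have "(\<integral>\<^sup>+x. ennreal (exp (- (s * x))) \<partial>clock_law M F d) = (\<integral>\<^sup>+w. \<integral>\<^sup>+y. ennreal (exp (- (s * (y / F 0 d w)))) \<partial>exp_law \<partial>M)"
    by (rule nn_integral_clock_law) simp
  also have "\<dots> = (\<integral>\<^sup>+w. ennreal (F 0 d w / (F 0 d w + s)) \<partial>M)"
  proof (rule nn_integral_cong_AE)
    show "AE w in M. (\<integral>\<^sup>+y. ennreal (exp (- (s * (y / F 0 d w)))) \<partial>exp_law) = ennreal (F 0 d w / (F 0 d w + s))"
      using AE_weight_pos[of 0 d]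
    proof eventually_elim
      case (elim w)
      have "(\<integral>\<^sup>+y. ennreal (exp (- (s / F 0 d w * y))) \<partial>exp_law) = ennreal (1 / (1 + s / F 0 d w))"
        using elim s by (intro exp_law_laplace) simp
      moreover have "1 / (1 + s / F 0 d w) = F 0 d w / (F 0 d w + s)" using elim s by (simp add: field_simps)
      ultimately show ?case by simp
    qed
  qed
  also have "enn2real \<dots> = (\<integral>w. F 0 d w / (F 0 d w + s) \<partial>M)"
    using AE_weight_pos[of 0 d] s by (intro integral_eq_nn_integral[symmetric]) (auto elim!: eventually_mono)
  finally show ?thesis .
qed

text \<open>Given the weight the second moment is 2 / F^2, so the deterministic lower bound in
  condition (a) makes it finite and summable without further moments.\<close>

lemma clock_law_square:
  assumes x: "0 < x" "AE w in M. x \<le> F 0 d w"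
  shows "integrable (clock_law M F d) (\<lambda>y. y\<^sup>2)" "(\<integral>y. y\<^sup>2 \<partial>clock_law M F d) \<le> 2 * (1 / x\<^sup>2)"
proof -
  interpret A: prob_space M by (rule gpa_prob_space)
  have "(\<integral>\<^sup>+y. ennreal (y\<^sup>2) \<partial>clock_law M F d) = (\<integral>\<^sup>+w. \<integral>\<^sup>+y. ennreal ((y / F 0 d w)\<^sup>2) \<partial>exp_law \<partial>M)"
    by (rule nn_integral_clock_law) simp
  also have "\<dots> \<le> (\<integral>\<^sup>+w. ennreal (2 * (1 / x\<^sup>2)) \<partial>M)"
  proof (rule nn_integral_mono_AE)
    show "AE w in M. (\<integral>\<^sup>+y. ennreal ((y / F 0 d w)\<^sup>2) \<partial>exp_law) \<le> ennreal (2 * (1 / x\<^sup>2))"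
      using x(2)
    proof eventually_elim
      case (elim w)
      then have F0: "0 < F 0 d w" using x(1) by simp
      have "x\<^sup>2 \<le> (F 0 d w)\<^sup>2" using elim x(1) by (intro power_mono) auto
      then have "2 / (F 0 d w)\<^sup>2 \<le> 2 * (1 / x\<^sup>2)" using x(1) by (simp add: frac_le)
      then show ?case by (simp add: nn_integral_exp_law_square[OF F0] ennreal_leI)
    qed
  qed
  also have "\<dots> = ennreal (2 * (1 / x\<^sup>2))" by (simp add: A.emeasure_space_1)
  finally have le: "(\<integral>\<^sup>+y. ennreal (y\<^sup>2) \<partial>clock_law M F d) \<le> ennreal (2 * (1 / x\<^sup>2))" .
  have m: "(\<lambda>y. y\<^sup>2) \<in> borel_measurable (clock_law M F d)" by (simp add: clock_law_def)
  show i: "integrable (clock_law M F d) (\<lambda>y. y\<^sup>2)"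
    by (rule integrableI_nonneg) (use m le in \<open>auto intro: le_less_trans\<close>)
  have "ennreal (\<integral>y. y\<^sup>2 \<partial>clock_law M F d) = (\<integral>\<^sup>+y. ennreal (y\<^sup>2) \<partial>clock_law M F d)"
    by (rule nn_integral_eq_integral[symmetric, OF i]) simp
  then have "ennreal (\<integral>y. y\<^sup>2 \<partial>clock_law M F d) \<le> ennreal (2 * (1 / x\<^sup>2))" using le by (simp only:)
  then show "(\<integral>y. y\<^sup>2 \<partial>clock_law M F d) \<le> 2 * (1 / x\<^sup>2)" by (subst (asm) ennreal_le_iff) auto
qed

lemma clock_law_atomless: "emeasure (clock_law M F d) {c} = 0"
proof -
  have "emeasure (clock_law M F d) {c} = (\<integral>\<^sup>+x. indicator {c} x \<partial>clock_law M F d)"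
    by (subst nn_integral_indicator) (auto simp: clock_law_def)
  also have "\<dots> = (\<integral>\<^sup>+w. \<integral>\<^sup>+y. indicator {c} (y / F 0 d w) \<partial>exp_law \<partial>M)"
    by (rule nn_integral_clock_law) simp
  also have "\<dots> = (\<integral>\<^sup>+w. 0 \<partial>M)"
  proof (rule nn_integral_cong_AE)
    show "AE w in M. (\<integral>\<^sup>+y. indicator {c} (y / F 0 d w) \<partial>exp_law) = 0"
      using AE_weight_pos[of 0 d]
    proof eventually_elim
      case (elim w)
      have "AE y in lborel. y \<noteq> c * F 0 d w" by (rule AE_lborel_singleton)
      then have "AE y in exp_law. y \<noteq> c * F 0 d w" by (subst AE_density) auto
      then have "AE y in exp_law. indicator {c} (y / F 0 d w) = (0 :: ennreal)"
        by eventually_elim (use elim in \<open>auto simp: indicator_def\<close>)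
      then have "(\<integral>\<^sup>+y. indicator {c} (y / F 0 d w) \<partial>exp_law) = (\<integral>\<^sup>+y. 0 \<partial>exp_law)"
        by (rule nn_integral_cong_AE)
      then show ?case by simp
    qed
  qed
  finally show ?thesis by simp
qed

text \<open>The squared modulus of 1 / (1 - i t / F) is F^2 / (F^2 + t^2), that is, 1 minus the
  displayed deficit. The modulus of a mixture is at most the mean modulus, and squaring is paid for
  by Jensen's inequality.\<close>

lemma norm_char_clock_law:
  "(cmod (char (clock_law M F d) t))\<^sup>2 \<le> 1 - (\<integral>w. t\<^sup>2 / ((F 0 d w)\<^sup>2 + t\<^sup>2) \<partial>M)"
proof -
  interpret A: prob_space M by (rule gpa_prob_space)
  interpret C: prob_space exp_clocks by (rule prob_space_exp_clocks)
  interpret pair_prob_space M exp_clocks ..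
  interpret N: prob_space "clock_space M" by (rule prob_space_clock_space)
  have ci: "integrable (clock_space M) (\<lambda>z. iexp (t * clock F z (0, d)))"
    by (rule N.integrable_const_bound[where B=1]) auto
  have "char (clock_law M F d) t = (\<integral>z. iexp (t * clock F z (0, d)) \<partial>clock_space M)"
    unfolding char_def clock_law_def by (subst integral_distr) auto
  also have "\<dots> = (\<integral>w. \<integral>e. iexp (t * clock F (w, e) (0, d)) \<partial>exp_clocks \<partial>M)"
    using ci unfolding clock_space_def by (rule integral_fst'[symmetric])
  also have "\<dots> = (\<integral>w. char exp_law (t / F 0 d w) \<partial>M)"
  proof (rule Bochner_Integration.integral_cong[OF refl])
    fix w
    have "(\<integral>e. iexp (t * clock F (w, e) (0, d)) \<partial>exp_clocks) = (\<integral>e. iexp (t / F 0 d w * e (0, d)) \<partial>exp_clocks)"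
      by (simp add: clock_def weights_def)
    also have "\<dots> = char (distr exp_clocks borel (\<lambda>e. e (0, d))) (t / F 0 d w)"
      unfolding char_def using measurable_exp_clocks_component by (subst integral_distr) auto
    finally show "(\<integral>e. iexp (t * clock F (w, e) (0, d)) \<partial>exp_clocks) = char exp_law (t / F 0 d w)"
      unfolding exp_clocks_component .
  qed
  finally have ch: "char (clock_law M F d) t = (\<integral>w. char exp_law (t / F 0 d w) \<partial>M)" .
  let ?g = "\<lambda>w. cmod (char exp_law (t / F 0 d w))"
  have gm: "?g \<in> borel_measurable M" unfolding char_exp_law by measurable
  have cb: "cmod (char exp_law s) \<le> 1" for s
    using real_distribution.cmod_char_le_1[of exp_law s] prob_space_exp_law
    by (auto simp: real_distribution_def real_distribution_axioms_def)
  have g1: "integrable M ?g" by (rule A.integrable_const_bound[where B=1]) (use gm cb in auto)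
  have g2: "integrable M (\<lambda>w. (?g w)\<^sup>2)"
    by (rule A.integrable_const_bound[where B=1]) (use gm cb in \<open>auto intro!: power_le_one\<close>)
  have "cmod (char (clock_law M F d) t) \<le> (\<integral>w. ?g w \<partial>M)" unfolding ch by (rule integral_norm_bound)
  then have "(cmod (char (clock_law M F d) t))\<^sup>2 \<le> (\<integral>w. ?g w \<partial>M)\<^sup>2" by (intro power_mono) auto
  \<comment> \<open>Jensen's inequality in the form that the variance of \<open>?g\<close> is
    nonnegative.\<close>
  also have "\<dots> \<le> (\<integral>w. (?g w)\<^sup>2 \<partial>M)"
    using A.variance_eq[OF g1 g2] A.variance_positive[of ?g] by simp
  also have "\<dots> = (\<integral>w. 1 - t\<^sup>2 / ((F 0 d w)\<^sup>2 + t\<^sup>2) \<partial>M)"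
  proof (rule integral_cong_AE)
    show "AE w in M. (?g w)\<^sup>2 = 1 - t\<^sup>2 / ((F 0 d w)\<^sup>2 + t\<^sup>2)"
      using AE_weight_pos[of 0 d]
    proof eventually_elim
      case (elim w)
      have "(?g w)\<^sup>2 = 1 / (1 + (t / F 0 d w)\<^sup>2)"
        by (simp add: char_exp_law norm_divide power_divide cmod_power2)
      also have "\<dots> = 1 - t\<^sup>2 / ((F 0 d w)\<^sup>2 + t\<^sup>2)"
      proof -
        have "0 < (F 0 d w)\<^sup>2 + t\<^sup>2" using elim by (simp add: add_pos_nonneg)
        then show ?thesis using elim by (simp add: field_simps)
      qed
      finally show ?case .
    qed
  qed (use gm in auto)
  also have "\<dots> = 1 - (\<integral>w. t\<^sup>2 / ((F 0 d w)\<^sup>2 + t\<^sup>2) \<partial>M)"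
  proof -
    have "integrable M (\<lambda>w. t\<^sup>2 / ((F 0 d w)\<^sup>2 + t\<^sup>2))"
      by (rule A.integrable_const_bound[where B=1]) (auto intro: square_ratio_le_1)
    then show ?thesis by (simp add: A.prob_space)
  qed
  finally show ?thesis .
qed

text \<open>Summable mean deficits would make the deficits almost surely summable, hence eventually
  below 1/2. That means t^2 < F^2, and then 1 / F^2 is at most 2 / t^2 times the deficit, against
  divergence.\<close>

lemma deficit_not_summable:
  assumes div: "AE w in M. \<not> summable (\<lambda>j. 1 / (F 0 j w)\<^sup>2)" and t: "t \<noteq> 0"
  shows "\<not> summable (\<lambda>d. \<integral>w. t\<^sup>2 / ((F 0 d w)\<^sup>2 + t\<^sup>2) \<partial>M)"
proof
  interpret A: prob_space M by (rule gpa_prob_space)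
  let ?g = "\<lambda>d w. t\<^sup>2 / ((F 0 d w)\<^sup>2 + t\<^sup>2)"
  assume summ: "summable (\<lambda>d. \<integral>w. ?g d w \<partial>M)"
  have gi: "integrable M (?g d)" for d
    by (rule A.integrable_const_bound[where B=1]) (auto intro: square_ratio_le_1)
  have "AE w in M. summable (\<lambda>d. ?g d w)" by (rule AE_summable[OF gi _ summ]) simp
  moreover have "AE w in M. \<forall>d. 0 < F 0 d w" unfolding AE_all_countable using AE_weight_pos by blast
  ultimately have "AE w in M. False" using div
  proof eventually_elim
    case (elim w)
    note sg = elim(1)
    then have "(\<lambda>d. ?g d w) \<longlonglongrightarrow> 0" by (rule summable_LIMSEQ_zero)
    then have "eventually (\<lambda>d. ?g d w < 1 / 2) sequentially" by (rule order_tendstoD) simp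
    then obtain n0 where n0: "\<And>d. n0 \<le> d \<Longrightarrow> ?g d w < 1 / 2" by (auto simp: eventually_sequentially)
    have "summable (\<lambda>j. 1 / (F 0 j w)\<^sup>2)"
    proof (rule summable_comparison_test)
      show "summable (\<lambda>d. 2 / t\<^sup>2 * ?g d w)" by (rule summable_mult[OF sg])
      show "\<exists>N. \<forall>d\<ge>N. norm (1 / (F 0 d w)\<^sup>2) \<le> 2 / t\<^sup>2 * ?g d w"
      proof (intro exI[of _ n0] allI impI)
        fix d assume "n0 \<le> d"
        have p: "0 < (F 0 d w)\<^sup>2" "0 < t\<^sup>2" using spec[OF elim(2), of d] t by auto
        then have "t\<^sup>2 * 2 < (F 0 d w)\<^sup>2 + t\<^sup>2" using n0[OF \<open>n0 \<le> d\<close>] pos_divide_less_eq[OF add_pos_pos[OF p]] by simp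
        then have "(F 0 d w)\<^sup>2 + t\<^sup>2 \<le> 2 * (F 0 d w)\<^sup>2" by simp
        then have "2 / (2 * (F 0 d w)\<^sup>2) \<le> 2 / ((F 0 d w)\<^sup>2 + t\<^sup>2)"
          using add_pos_pos[OF p] by (intro frac_le) simp_all
        then have "1 / (F 0 d w)\<^sup>2 \<le> 2 / ((F 0 d w)\<^sup>2 + t\<^sup>2)" by simp
        also have "\<dots> = 2 / t\<^sup>2 * ?g d w" using p by simp
        finally show "norm (1 / (F 0 d w)\<^sup>2) \<le> 2 / t\<^sup>2 * ?g d w" by simp
      qed
    qed
    then show ?case using elim(3) by simp
  qed
  then show False by (simp add: A.AE_False)
qed

end

lemma persistent_hub_cong:
  assumes "\<And>i. 1 \<le> i \<Longrightarrow> q i = q' i"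
  shows "persistent_hub q = persistent_hub q'"
proof -
  have "outdeg q n u = outdeg q' n u" for n u using assms by (intro outdeg_cong) auto
  then have "outdeg q = outdeg q'" by (auto simp: fun_eq_iff)
  then show ?thesis by (simp add: persistent_hub_def fun_eq_iff)
qed

theorem theorem2p11:
  fixes M :: "'a measure" and F :: "nat \<Rightarrow> nat \<Rightarrow> 'a \<Rightarrow> real" and P :: "nat \<Rightarrow> 'a \<Rightarrow> nat"
  assumes "gpa_tree M F P"
  shows "((AE \<omega> in M. \<not> summable (\<lambda>j. 1 / (F 0 j \<omega>)\<^sup>2)) \<longrightarrow>
            (AE \<omega> in M. \<not> (\<exists>u. persistent_hub (\<lambda>i. P i \<omega>) u)))
       \<and> (((\<exists>x :: nat \<Rightarrow> real. (\<forall>j. x j > 0) \<and> summable (\<lambda>j. 1 / (x j)\<^sup>2) \<and>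
               (\<forall>j. AE \<omega> in M. F 0 j \<omega> \<ge> x j))
           \<and> (\<exists>lam>0. summable (\<lambda>i. \<Prod>j\<le>i. integral\<^sup>L M (\<lambda>\<omega>. F 0 j \<omega> / (F 0 j \<omega> + lam)))))
          \<longrightarrow> (AE \<omega> in M. \<exists>u. unique_persistent_hub (\<lambda>i. P i \<omega>) u))"
proof (intro conjI impI)
  interpret gpa_process M F P by unfold_locales (rule assms)
  interpret clock_process "clock_space M" "clock F" "clock_law M F" by (rule clock_process_gpa)
  assume div: "AE \<omega> in M. \<not> summable (\<lambda>j. 1 / (F 0 j \<omega>)\<^sup>2)"
  have "AE z in clock_space M. \<not> (\<exists>u. persistent_hub (clock_tree (clock F z)) u)"
  proof (rule AE_no_persistent_hub)
    fix t :: real assume t: "t \<noteq> 0"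
    let ?e = "\<lambda>d. \<integral>w. t\<^sup>2 / ((F 0 d w)\<^sup>2 + t\<^sup>2) \<partial>M"
    show "(\<lambda>n. \<Prod>i<n. cmod (char (clock_law M F i) t) * cmod (char (clock_law M F i) (- t))) \<longlonglongrightarrow> 0"
    proof (rule prod_tendsto_0_of_deficit[where e="?e"])
      fix i
      let ?a = "cmod (char (clock_law M F i) t)" and ?b = "cmod (char (clock_law M F i) (- t))"
      have "?a\<^sup>2 \<le> 1 - ?e i" "?b\<^sup>2 \<le> 1 - ?e i"
        using norm_char_clock_law[of i t] norm_char_clock_law[of i "- t"] by simp_all
      \<comment> \<open>By the arithmetic-geometric inequality the product inherits the bound on the
        two squares; \<open>t\<close> and \<open>- t\<close> have the same deficit.\<close>
      moreover have "2 * ?a * ?b \<le> ?a\<^sup>2 + ?b\<^sup>2" by (rule sum_squares_bound)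
      ultimately show "?a * ?b \<le> 1 - ?e i" by simp
      show "0 \<le> ?e i" by (rule integral_nonneg_AE) simp
    qed (use deficit_not_summable[OF div t] in auto)
  qed
  then show "AE \<omega> in M. \<not> (\<exists>u. persistent_hub (\<lambda>i. P i \<omega>) u)"
  proof (subst AE_gpa_iff[where \<Phi>="\<lambda>q. \<not> (\<exists>u. persistent_hub q u)"])
    fix q q' :: "nat \<Rightarrow> nat" assume "\<And>i. 1 \<le> i \<Longrightarrow> q i = q' i"
    then have "persistent_hub q = persistent_hub q'" by (rule persistent_hub_cong)
    then show "\<not> (\<exists>u. persistent_hub q u) \<longleftrightarrow> \<not> (\<exists>u. persistent_hub q' u)" by simp
  qed measurable
next
  interpret gpa_process M F P by unfold_locales (rule assms)
  interpret clock_process "clock_space M" "clock F" "clock_law M F" by (rule clock_process_gpa)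
  assume "(\<exists>x :: nat \<Rightarrow> real. (\<forall>j. x j > 0) \<and> summable (\<lambda>j. 1 / (x j)\<^sup>2) \<and> (\<forall>j. AE \<omega> in M. F 0 j \<omega> \<ge> x j))
     \<and> (\<exists>lam>0. summable (\<lambda>i. \<Prod>j\<le>i. integral\<^sup>L M (\<lambda>\<omega>. F 0 j \<omega> / (F 0 j \<omega> + lam))))"
  then obtain x :: "nat \<Rightarrow> real" and lam where x: "\<And>j. 0 < x j" "summable (\<lambda>j. 1 / (x j)\<^sup>2)" "\<And>j. AE \<omega> in M. x j \<le> F 0 j \<omega>"
    and lam: "0 < lam" "summable (\<lambda>i. \<Prod>j\<le>i. integral\<^sup>L M (\<lambda>\<omega>. F 0 j \<omega> / (F 0 j \<omega> + lam)))" by blast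
  \<comment> \<open>Condition (b) is read as summability of products of Laplace transforms of the
    waiting times.\<close>
  have "summable (\<lambda>i. \<Prod>j\<le>i. laplace j lam)" using lam by (simp add: laplace_clock_law)
  then obtain t where t: "0 < t" "\<And>k. (\<Sum>j\<le>k. expectation (\<lambda>z. exp (- (t * birth (clock F z) j)))) \<le> 2"
    using exists_malthusian[OF lam(1)] by blast
  interpret square_integrable_clocks "clock_space M" "clock F" "clock_law M F" t
  proof
    show "integrable (clock_law M F d) (\<lambda>x. x\<^sup>2)" for d by (rule clock_law_square(1)[OF x(1,3)])
    show "summable (\<lambda>d. \<integral>x. x\<^sup>2 \<partial>clock_law M F d)"
    proof (rule summable_comparison_test)
      show "summable (\<lambda>d. 2 * (1 / (x d)\<^sup>2))" by (rule summable_mult[OF x(2)])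
      show "\<exists>n0. \<forall>d\<ge>n0. norm (\<integral>x. x\<^sup>2 \<partial>clock_law M F d) \<le> 2 * (1 / (x d)\<^sup>2)"
        using clock_law_square(2)[OF x(1,3)] by (auto simp: integral_nonneg_AE)
    qed
  qed (use t clock_law_atomless in auto)
  show "AE \<omega> in M. \<exists>u. unique_persistent_hub (\<lambda>i. P i \<omega>) u"
    using AE_unique_persistent_hub
  proof (subst AE_gpa_iff[where \<Phi>="\<lambda>q. \<exists>u. unique_persistent_hub q u"])
    fix q q' :: "nat \<Rightarrow> nat" assume "\<And>i. 1 \<le> i \<Longrightarrow> q i = q' i"
    then have "persistent_hub q = persistent_hub q'" by (rule persistent_hub_cong)
    then show "(\<exists>u. unique_persistent_hub q u) \<longleftrightarrow> (\<exists>u. unique_persistent_hub q' u)"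
      unfolding unique_persistent_hub_def by simp
  qed measurable
qed

end
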